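(* The functions $H_0$, $H_n$, $M_n$ ($n\in\mathbb{Z}\setminus\{0\}$) all belong to $L^1(\mathbb{R})\cap C^\infty(\mathbb{R})$, and the system they form is biorthogonal to the hyperbolic trigonometric system $1,\ e^{i\pi nx},\ e^{i\pi n/x}$ ($n\in\mathbb{Z}\setminus\{0\}$) in $L^\infty(\mathbb{R})$; that is, for all $n,p\in\mathbb{Z}$ and $m,q\in\mathbb{Z}\setminus\{0\}$, $$\int_{\mathbb{R}}e^{-i\pi nx}H_p(x)\,dx=\delta_{n,p},\qquad \int_{\mathbb{R}}e^{i\pi m/x}H_p(x)\,dx=0,$$ $$\int_{\mathbb{R}}e^{i\pi nx}M_q(x)\,dx=0,\qquad \int_{\mathbb{R}}e^{i\pi m/x}M_q(x)\,dx=\delta_{m,q}.$$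
   Context: $\mathbb{D}$ is the open unit disk and $\delta_{n,m}$ is the Kronecker delta. $F(z)={}_2F_1(1/2,1/2;1;z)=1+\frac{1}{\pi}\sum_{n\ge1}\frac{\Gamma(n+1/2)^2}{(n!)^2}z^n$ for $z\in\mathbb{D}$, extended to a nonvanishing holomorphic function on $\mathbb{C}\setminus[1,+\infty)$. For each integer $n\ge1$ the function $\exp\left(n\pi F(1-z)/F(z)\right)$, $z\in\mathbb{D}\setminus(-1,0]$, extends to a meromorphic function in $\mathbb{D}$ whose only pole is at $0$; $S_n$ denotes the unique algebraic polynomial (of degree $n$, with real coefficients) with $S_n(0)=0$ such that $\exp\left(n\pi F(1-z)/F(z)\right)-S_n(1/z)$ extends holomorphically to $\mathbb{D}$. For $x\in\mathbb{R}$ define $$H_0(x):=\frac{1}{2\pi^2}\int_{-\infty}^{+\infty}\frac{|F(1/2+it)|^2\,dt}{(t^2+1/4)\left(F(1/2-it)^2+x^2F(1/2+it)^2\right)},$$ $$H_n(x):=\frac{1}{4\pi^3 n}\int_{-\infty}^{+\infty}\frac{S_n\!\left(\frac{1}{1/2+it}\right)dt}{(t^2+1/4)\left(F(1/2-it)-ixF(1/2+it)\right)^2}\quad(n\ge 1),$$ $H_{-n}(x):=H_n(-x)$ for $n\ge1$, and $M_n(x):=H_n(-1/x)/x^2$ for $n\in\mathbb{Z}\setminus\{0\}$, $x\in\mathbb{R}\setminus\{0\}$, with $M_n(0)$ defined by continuity. *)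

theory Defs
  imports "HOL-Complex_Analysis.Complex_Analysis"
begin

text \<open>The hypergeometric function with parameters 1/2, 1/2; 1, as a power series on the
  unit disk.\<close>

definition hyp_series :: "complex \<Rightarrow> complex" where
  "hyp_series z = 1 + 1 / of_real pi *
     (\<Sum>k. of_real ((Gamma (real (Suc k) + 1/2))\<^sup>2 / (fact (Suc k))\<^sup>2) * z ^ Suc k)"

definition slit_plane :: "complex set" where
  "slit_plane = - (complex_of_real ` {1..})"

text \<open>The analytic continuation to the plane slit along \<open>[1, \<infinity>)\<close>. By the identity theorem its values
  on the slit plane do not depend on the choice; nothing below evaluates it on the slit.\<close>

definition hypF :: "complex \<Rightarrow> complex" where
  "hypF = (SOME f. f holomorphic_on slit_plane \<and> (\<forall>z\<in>ball 0 1. f z = hyp_series z))"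

text \<open>The function below is \<open>z \<mapsto> exp (n \<pi> F(1-z) / F(z))\<close> on the unit disk cut along
  \<open>(-1, 0]\<close>; the polynomial \<open>S\<^sub>n\<close> describes its principal part at 0.\<close>

definition is_S :: "nat \<Rightarrow> complex poly \<Rightarrow> bool" where
  "is_S n p \<longleftrightarrow> degree p = n \<and> (\<forall>i. coeff p i \<in> \<real>) \<and> poly p 0 = 0 \<and>
     (\<exists>g. g holomorphic_on ball 0 1 \<and>
        (\<forall>z\<in>ball 0 1 - \<real>\<^sub>\<le>\<^sub>0.
           exp (of_nat n * of_real pi * hypF (1 - z) / hypF z) - poly p (1 / z) = g z))"

definition S :: "nat \<Rightarrow> complex poly" where
  "S n = (THE p. is_S n p)"

definition H_zero :: "real \<Rightarrow> complex" where
  "H_zero x = 1 / (2 * (of_real pi)\<^sup>2) *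
     (\<integral>t. of_real ((cmod (hypF (Complex (1/2) t)))\<^sup>2) /
          (of_real (t\<^sup>2 + 1/4) *
            ((hypF (Complex (1/2) (-t)))\<^sup>2 + (of_real x)\<^sup>2 * (hypF (Complex (1/2) t))\<^sup>2)) \<partial>lborel)"

definition H_pos :: "nat \<Rightarrow> real \<Rightarrow> complex" where
  "H_pos n x = 1 / (4 * (of_real pi) ^ 3 * of_nat n) *
     (\<integral>t. poly (S n) (1 / Complex (1/2) t) /
          (of_real (t\<^sup>2 + 1/4) *
            (hypF (Complex (1/2) (-t)) - \<i> * of_real x * hypF (Complex (1/2) t))\<^sup>2) \<partial>lborel)"

definition H :: "int \<Rightarrow> real \<Rightarrow> complex" where
  "H n x = (if n = 0 then H_zero x else if n > 0 then H_pos (nat n) x else H_pos (nat (- n)) (- x))"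

definition M :: "int \<Rightarrow> real \<Rightarrow> complex" where
  "M n x = (if x \<noteq> 0 then H n (- 1 / x) / (of_real x)\<^sup>2
            else Lim (at 0) (\<lambda>y. H n (- 1 / y) / (of_real y)\<^sup>2))"

text \<open>\<open>C\<^sup>\<infinity>\<close> on the real line: \<open>D k\<close> is the \<open>k\<close>-th derivative.\<close>

definition smooth :: "(real \<Rightarrow> complex) \<Rightarrow> bool" where
  "smooth f \<longleftrightarrow> (\<exists>D :: nat \<Rightarrow> real \<Rightarrow> complex. D 0 = f \<and>
     (\<forall>k x. (D k has_vector_derivative D (Suc k) x) (at x)))"

end

theory Submission
  imports Defs "HOL-Probability.Sinc_Integral" "HOL-Computational_Algebra.Fundamental_Theorem_Algebra"
begin

text \<open>
  Let \<open>q(z) = exp (-\<pi> F(1 - z) / F(z))\<close>. On the line \<open>Re z = 1/2\<close> the quotient \<open>w = F(1 - z) / F(z)\<close> equals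
  \<open>cnj F(z) / F(z)\<close>; it has modulus 1 and positive real part. Taking \<open>F(z)\<^sup>2\<close> out of the denominators, one
  finds that \<open>H\<^sub>n\<close> is a superposition over the line of the kernels \<open>(w - \<i>x)\<^sup>-\<^sup>2\<close> with the weights
  \<open>R(z) / (z (1 - z) F(z)\<^sup>2)\<close>, \<open>R(z) = S\<^sub>n(1/z)\<close>, up to the factor \<open>1 / (4\<pi>\<^sup>3n)\<close>. The inversion \<open>x \<mapsto> -1/x\<close>
  combined with \<open>z \<mapsto> 1 - z\<close> shows that \<open>M\<^sub>n\<close> has, up to sign, the same form with \<open>R(z) = S\<^sub>n(1 / (1 - z))\<close>
  (\<open>H_pos_eq\<close>, \<open>H_pos_inversion\<close>).

  The integral of \<open>exp (-\<i>ax) (w - \<i>x)\<^sup>-\<^sup>2\<close> is \<open>2\<pi>a exp (-aw)\<close> for \<open>a \<ge> 0\<close> and 0 for \<open>a \<le> 0\<close>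
  (\<open>fourier_double_kernel\<close>). For \<open>a = \<pi>m\<close> the exponential is \<open>q(z)\<^sup>m\<close>, and the Wronskian identity
  \<open>q' = q / (z (1 - z) F\<^sup>2)\<close> shows that the \<open>m\<close>-th coefficient is a multiple of the integral of \<open>R d(q\<^sup>m)\<close>, or
  of \<open>-R' q\<^sup>m dz\<close> after integration by parts. Here \<open>R'\<close> decays quadratically and \<open>|q| \<le> 1\<close> to the left of
  the line, so the contour can be closed on the left, where only the origin can be singular. For
  \<open>R = S\<^sub>n(1/z)\<close>, which is \<open>q\<^sup>-\<^sup>n\<close> up to a holomorphic function, the residue is that of \<open>q\<^sup>-\<^sup>n d(q\<^sup>m)\<close>, and this is
  \<open>m\<close> or 0 according as \<open>m = n\<close> or not (\<open>pairing\<close>). For \<open>R = S\<^sub>n(1 / (1 - z))\<close> there is no singularity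
  (\<open>pairing_cusp1\<close>). The function \<open>H\<^sub>0\<close> is treated in the same way with the kernel \<open>w / (w\<^sup>2 + x\<^sup>2)\<close>, whose
  Fourier transform is \<open>\<pi> exp (-|a| w)\<close>.

  Three properties of \<open>F\<close> carry this argument. All are drawn from the elliptic integral for \<open>F\<close> and from
  the hypergeometric equation. First, \<open>q\<close> continues holomorphically across the negative axis, with a simple
  zero at 0: its logarithmic derivative is given by the Wronskian (\<open>wronskian_eq\<close>) and has residue 1 at 0
  (\<open>log_nome_exists\<close>). Second, \<open>F(1 - z) / F(z)\<close> has positive real part off the cuts
  (\<open>Re_hypF_mult_pos\<close>). Third, on the line \<open>1 / Re w\<close> grows at most like a power of \<open>log |z|\<close>
  (\<open>inverse_Re_line_quot_power\<close>). As the derivatives of the kernel in \<open>x\<close> are bounded by powers of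
  \<open>1 / Re w\<close>, the last property gives smoothness, and it also justifies the interchange of integrals.
\<close>

section \<open>Integrals over the real line\<close>

text \<open>Symmetric increments of the primitive suffice, because integrability is assumed: the integrals
  over \<open>[-n, n]\<close> then converge to the integral over the line.\<close>

lemma integral_real_line_FTC:
  fixes f F :: "real \<Rightarrow> complex"
  assumes int: "integrable lborel f" and cont: "continuous_on UNIV f"
    and F: "\<And>x. (F has_vector_derivative f x) (at x)"
    and lim: "(\<lambda>n. F (real n) - F (- real n)) \<longlonglongrightarrow> L"
  shows "(\<integral>x. f x \<partial>lborel) = L"
proof -
  have "(\<lambda>n. \<integral>x. indicator {- real n..real n} x *\<^sub>R f x \<partial>lborel) \<longlonglongrightarrow> (\<integral>x. f x \<partial>lborel)"
  proof (rule integral_dominated_convergence[where w = "\<lambda>x. norm (f x)"])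
    show "AE x in lborel. (\<lambda>n. indicator {- real n..real n} x *\<^sub>R f x) \<longlonglongrightarrow> f x"
    proof (rule AE_I2)
      fix x :: real
      obtain N where N: "\<bar>x\<bar> \<le> real N" using real_arch_simple by blast
      have "eventually (\<lambda>n. indicator {- real n..real n} x *\<^sub>R f x = f x) sequentially"
        using eventually_ge_at_top[of N]
      proof eventually_elim
        case (elim n)
        then have "\<bar>x\<bar> \<le> real n" using N by linarith
        then show ?case by (auto simp: abs_le_iff)
      qed
      then show "(\<lambda>n. indicator {- real n..real n} x *\<^sub>R f x) \<longlonglongrightarrow> f x"
        by (rule tendsto_eventually)
    qed
  qed (use int in \<open>auto simp: indicator_def\<close>)
  moreover have "(\<integral>x. indicator {- real n..real n} x *\<^sub>R f x \<partial>lborel) = F (real n) - F (- real n)" for n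
    by (rule integral_FTC_atLeastAtMost)
      (auto intro: has_vector_derivative_at_within F continuous_on_subset[OF cont])
  ultimately show ?thesis
    using lim LIMSEQ_unique by auto
qed

lemma integrable_inverse_one_plus_square: "integrable lborel (\<lambda>x::real. 1 / (1 + x\<^sup>2))"
  using integrable_inverse_1_plus_square
  by (simp add: set_integrable_def inverse_eq_divide)

text \<open>On the critical line quadratic decay is spoiled by a factor that may grow like \<open>\<surd>\<bar>x\<bar>\<close>; the exponent
  \<open>-3/2\<close> is what is left.\<close>

lemma integrable_powr_decay: "integrable lborel (\<lambda>x::real. (1 + \<bar>x\<bar>) powr (-3/2))"
proof -
  have *: "set_integrable lborel (einterval (ereal 0) \<infinity>) (\<lambda>x::real. (1 + x) powr (-3/2))"
  proof (rule interval_integral_FTC_nonneg(1)[where F = "\<lambda>x. -2 * (1 + x) powr (-1/2)" and A = "-2" and B = 0])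
    show "(((\<lambda>x. - 2 * (1 + x) powr (- 1 / 2)) \<circ> real_of_ereal) \<longlongrightarrow> - 2) (at_right (ereal 0))"
      unfolding ereal_tendsto_simps by (auto intro!: tendsto_eq_intros)
    have "((\<lambda>x::real. (1 + x) powr (- 1 / 2)) \<longlongrightarrow> 0) at_top"
      by (rule tendsto_neg_powr)
        (auto intro!: filterlim_tendsto_add_at_top[OF tendsto_const] filterlim_ident)
    then show "(((\<lambda>x. - 2 * (1 + x) powr (- 1 / 2)) \<circ> real_of_ereal) \<longlongrightarrow> 0) (at_left \<infinity>)"
      unfolding ereal_tendsto_simps using tendsto_mult[OF tendsto_const[of "-2"]] by fastforce
  qed (auto intro!: derivative_eq_intros continuous_intros)
  have i1: "integrable lborel (\<lambda>x::real. indicator {0<..} x * (1 + \<bar>x\<bar>) powr (-3/2))"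
  proof -
    have "integrable lborel (\<lambda>x::real. indicator {0<..} x *\<^sub>R (1 + x) powr (-3/2))"
      using * by (simp add: set_integrable_def zero_ereal_def[symmetric] einterval_def greaterThan_def)
    then show ?thesis
      by (rule Bochner_Integration.integrable_cong[THEN iffD1, rotated 2]) (auto simp: indicator_def)
  qed
  have i2: "integrable lborel (\<lambda>x::real. indicator {..<0} x * (1 + \<bar>x\<bar>) powr (-3/2))"
    using lborel_integrable_real_affine[OF i1, of "-1" 0]
    by (rule Bochner_Integration.integrable_cong[THEN iffD1, rotated 2]) (auto simp: indicator_def)
  have "integrable lborel (\<lambda>x::real. indicator {0<..} x * (1 + \<bar>x\<bar>) powr (-3/2)
      + indicator {..<0} x * (1 + \<bar>x\<bar>) powr (-3/2))"
    by (intro Bochner_Integration.integrable_add i1 i2)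
  moreover have "AE x in lborel. x \<noteq> (0::real)" by (rule AE_lborel_singleton)
  ultimately show ?thesis
    by (subst integrable_cong_AE[where g = "\<lambda>x::real. indicator {0<..} x * (1 + \<bar>x\<bar>) powr (-3/2)
      + indicator {..<0} x * (1 + \<bar>x\<bar>) powr (-3/2)"]) (auto simp: indicator_def)
qed

lemma integrable_powr_decay_bound:
  fixes f :: "real \<Rightarrow> complex"
  assumes [measurable]: "f \<in> borel_measurable borel"
    and "\<And>x. norm (f x) \<le> C * (1 + \<bar>x\<bar>) powr (-3/2)"
  shows "integrable lborel f"
proof (rule Bochner_Integration.integrable_bound)
  show "integrable lborel (\<lambda>x. C * (1 + \<bar>x\<bar>) powr (-3/2))"
    by (intro integrable_mult_right integrable_powr_decay)
  show "AE x in lborel. norm (f x) \<le> norm (C * (1 + \<bar>x\<bar>) powr (- 3 / 2))"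
    using assms(2) by (auto intro!: AE_I2 order.trans[OF assms(2)])
qed auto

lemma integrable_quadratic_decay:
  fixes f :: "real \<Rightarrow> complex"
  assumes cont: "continuous_on UNIV f" and bd: "\<And>x. \<bar>x\<bar> \<ge> r \<Longrightarrow> norm (f x) \<le> C / x\<^sup>2"
  shows "integrable lborel f"
proof -
  define R where "R = max r 1"
  have "compact (f ` {-R..R})"
    by (intro compact_continuous_image continuous_on_subset[OF cont]) auto
  then obtain B where B: "\<And>x. x \<in> {-R..R} \<Longrightarrow> norm (f x) \<le> B"
    using compact_imp_bounded bounded_iff by (metis imageI)
  have "norm (f 0) \<le> B" by (rule B) (simp add: R_def max_def)
  then have B0: "B \<ge> 0" using norm_ge_zero order_trans by blast
  have "0 \<le> C / R\<^sup>2" by (rule order_trans[OF norm_ge_zero bd]) (simp add: R_def)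
  then have C0: "C \<ge> 0" by (simp add: R_def zero_le_divide_iff max_def split: if_splits)
  define K where "K = B * (1 + R\<^sup>2) + 2 * C"
  have "norm (f x) \<le> K * (1 / (1 + x\<^sup>2))" for x
  proof (cases "\<bar>x\<bar> \<le> R")
    case True
    then have "x\<^sup>2 \<le> R\<^sup>2" by (simp add: abs_le_square_iff[symmetric] R_def)
    then have "norm (f x) * (1 + x\<^sup>2) \<le> B * (1 + R\<^sup>2)"
      using B[of x] True B0 by (intro mult_mono) (auto simp: abs_le_iff)
    then show ?thesis using C0 by (simp add: K_def field_simps add_pos_nonneg)
  next
    case False
    then have x: "\<bar>x\<bar> \<ge> r" "\<bar>x\<bar> \<ge> 1" by (auto simp: R_def)
    then have x1: "x\<^sup>2 \<ge> 1" by (simp add: abs_le_square_iff[of 1 x, simplified])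
    have "norm (f x) * (1 + x\<^sup>2) \<le> C / x\<^sup>2 * (2 * x\<^sup>2)"
      using bd[OF x(1)] x1 C0 by (intro mult_mono) auto
    also have "\<dots> = 2 * C" using x1 by (auto simp: field_simps)
    finally show ?thesis using B0 by (simp add: K_def field_simps add_pos_nonneg)
       (smt (verit, best) mult_nonneg_nonneg zero_le_power2)
  qed
  then have "\<And>x. norm (f x) \<le> norm (K * (1 / (1 + x\<^sup>2)))"
    unfolding real_norm_def by (rule order_trans[OF _ abs_ge_self])
  then show ?thesis
    by (intro Bochner_Integration.integrable_bound[OF integrable_mult_right[OF integrable_inverse_one_plus_square]])
      (use borel_measurable_continuous_onI[OF cont] in auto)
qed

section \<open>Cauchy's theorem for half-planes\<close>

text \<open>Close the contour by a large semicircle; quadratic decay makes its contribution vanish.\<close>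

lemma integral_upper_half_plane_eq_0:
  fixes f :: "complex \<Rightarrow> complex"
  assumes cont: "continuous_on {z. Im z \<ge> 0} f" and hol: "f holomorphic_on {z. Im z > 0}"
    and bd: "\<And>z. Im z \<ge> 0 \<Longrightarrow> norm z \<ge> r \<Longrightarrow> norm (f z) \<le> C / norm z ^ 2"
  shows "integrable lborel (\<lambda>x::real. f (of_real x))" "(\<integral>x. f (of_real x) \<partial>lborel) = 0"
proof -
  let ?S = "{z. Im z \<ge> 0}"
  have contR: "continuous_on UNIV (\<lambda>x::real. f (of_real x))"
    by (rule continuous_on_compose2[OF cont]) (auto intro!: continuous_intros)
  show int: "integrable lborel (\<lambda>x::real. f (of_real x))"
    by (rule integrable_quadratic_decay[OF contR, of r C]) (use bd[of "of_real _"] in simp)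
  have cvx: "convex ?S" by (rule convex_halfspace_Im_ge)
  have intr: "interior ?S = {z. Im z > 0}"
    using interior_halfspace_ge[of \<i> 0] by (simp add: inner_complex_def)
  obtain g where g: "\<And>x. x \<in> ?S \<Longrightarrow> (g has_field_derivative f x) (at x within ?S)"
    by (rule holomorphic_convex_primitive[OF cvx finite.emptyI cont])
      (use hol intr in \<open>auto intro: holomorphic_on_imp_differentiable_at simp: open_halfspace_Im_gt\<close>)
  show "(\<integral>x. f (of_real x) \<partial>lborel) = 0"
  proof (rule integral_real_line_FTC[OF int contR, where F = "\<lambda>x. g (of_real x)"])
    fix x :: real
    have "((g \<circ> of_real) has_vector_derivative (1 * f (of_real x))) (at x)"
      by (rule field_vector_diff_chain_within)
        (auto intro!: derivative_eq_intros DERIV_subset[OF g] simp: has_vector_derivative_def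
          bounded_linear_of_real[THEN bounded_linear_imp_has_derivative] of_real_def)
    then show "((\<lambda>x. g (of_real x)) has_vector_derivative f (of_real x)) (at x)"
      by (simp add: o_def)
  next
    have "norm (g (of_real n) - g (- of_real n)) \<le> C * pi / n" if n: "n \<ge> r" "n > 0" for n :: real
    proof -
      have sub: "path_image (part_circlepath 0 n 0 pi) \<subseteq> ?S"
        using n by (auto simp: path_image_part_circlepath' cis.sel closed_segment_eq_real_ivl intro!: mult_nonneg_nonneg sin_ge_zero)
      have "(f has_contour_integral (g (pathfinish (part_circlepath 0 n 0 pi)) - g (pathstart (part_circlepath 0 n 0 pi))))
          (part_circlepath 0 n 0 pi)"
        by (rule contour_integral_primitive[OF g _ sub]) auto
      then have "norm (g (pathfinish (part_circlepath 0 n 0 pi)) - g (pathstart (part_circlepath 0 n 0 pi)))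
          \<le> (C / n^2) * n * (pi - 0)"
      proof (rule has_contour_integral_bound_part_circlepath)
        show "0 \<le> C / n\<^sup>2"
          using bd[of "of_real n"] n norm_ge_zero[of "f (of_real n)"] by (simp del: norm_ge_zero)
        fix z assume z: "z \<in> path_image (part_circlepath 0 n 0 pi)"
        then have "norm z = n" using in_path_image_part_circlepath[OF z] n by (simp add: dist_norm)
        then show "norm (f z) \<le> C / n\<^sup>2" using bd[of z] z sub n by auto
      qed (use n in auto)
      then show ?thesis
        using n by (simp add: norm_minus_commute power2_eq_square)
    qed
    note bound = this
    have ev: "eventually (\<lambda>n. norm (g (of_real (real n)) - g (- of_real (real n))) \<le> C * pi / real n) sequentially"
      using eventually_ge_at_top[of "nat \<lceil>max r 1\<rceil>"]
    proof eventually_elim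
      case (elim n)
      then have "real n \<ge> r" "real n > 0" by (auto simp: nat_le_iff ceiling_le_iff)
      then show ?case by (rule bound)
    qed
    have "(\<lambda>n. C * pi / real n) \<longlonglongrightarrow> 0"
      by (rule tendsto_divide_0[OF tendsto_const filterlim_at_top_imp_at_infinity[OF filterlim_real_sequentially]])
    then show "(\<lambda>n. g (of_real (real n)) - g (of_real (- real n))) \<longlonglongrightarrow> 0"
      using Lim_null_comparison[OF ev] by simp
  qed
qed

section \<open>Fourier integrals of the kernels\<close>

lemma Re_pos_kernel_nonzero:
  assumes "Re w > 0"
  shows "w - \<i> * of_real x \<noteq> 0" "w + \<i> * of_real x \<noteq> 0" "w\<^sup>2 + (of_real x)\<^sup>2 \<noteq> 0"
proof -
  show 1: "w - \<i> * of_real x \<noteq> 0" "w + \<i> * of_real x \<noteq> 0" for x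
    using assms by (auto simp: complex_eq_iff)
  have "w\<^sup>2 + (of_real x)\<^sup>2 = (w - \<i> * of_real x) * (w + \<i> * of_real x)"
    by (simp add: algebra_simps power2_eq_square)
  then show "w\<^sup>2 + (of_real x)\<^sup>2 \<noteq> 0" using 1 by simp
qed

lemma norm_kernel_ge:
  fixes w z :: complex
  assumes "norm z \<ge> 2 * norm w"
  shows "norm (w - \<i> * z) \<ge> norm z / 2" "norm (w + \<i> * z) \<ge> norm z / 2"
  using norm_triangle_ineq3[of "\<i> * z" w] norm_triangle_ineq4[of "w + \<i> * z" w] assms
  by (auto simp: norm_mult norm_minus_commute)

lemma norm_kernel_product_le:
  fixes w z :: complex
  assumes "norm z \<ge> 2 * norm w"
  shows "1 / norm (w\<^sup>2 + z\<^sup>2) \<le> 4 / (norm z)\<^sup>2"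
proof (cases "z = 0")
  case False
  have "w\<^sup>2 + z\<^sup>2 = (w - \<i> * z) * (w + \<i> * z)"
    by (simp add: algebra_simps power2_eq_square)
  then have "norm (w\<^sup>2 + z\<^sup>2) = norm (w - \<i> * z) * norm (w + \<i> * z)"
    by (simp add: norm_mult)
  also have "\<dots> \<ge> (norm z / 2) * (norm z / 2)"
    by (intro mult_mono norm_kernel_ge assms) auto
  finally have "norm (w\<^sup>2 + z\<^sup>2) \<ge> (norm z)\<^sup>2 / 4" by (simp add: power2_eq_square)
  then have "1 / norm (w\<^sup>2 + z\<^sup>2) \<le> 1 / ((norm z)\<^sup>2 / 4)"
  proof (rule divide_left_mono)
    have "0 < (norm z)\<^sup>2 / 4" using False by simp
    then show "0 < norm (w\<^sup>2 + z\<^sup>2) * ((norm z)\<^sup>2 / 4)"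
      using \<open>norm (w\<^sup>2 + z\<^sup>2) \<ge> (norm z)\<^sup>2 / 4\<close> by (intro mult_pos_pos) linarith+
  qed auto
  then show ?thesis by simp
qed (use assms in auto)

text \<open>The arguments \<open>w \<plusminus> \<i>x\<close> of the logarithms in the primitive stay in the right half-plane, so the
  principal branch never jumps. Scaling out \<open>n\<close>, the increment over \<open>[-n, n]\<close> tends to
  \<open>(Ln \<i> - Ln (-\<i>)) / (\<i>w)\<close>.\<close>

lemma integral_inverse_square_plus:
  assumes w: "Re w > 0"
  shows "integrable lborel (\<lambda>x::real. 1 / (w\<^sup>2 + (of_real x)\<^sup>2))"
    and "(\<integral>x. 1 / (w\<^sup>2 + (of_real x)\<^sup>2) \<partial>lborel) = of_real pi / w"
proof -
  note nz = Re_pos_kernel_nonzero[OF w]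
  have w0: "w \<noteq> 0" using w by auto
  have cont: "continuous_on UNIV (\<lambda>x::real. 1 / (w\<^sup>2 + (of_real x)\<^sup>2))"
    using nz by (auto intro!: continuous_intros)
  show int: "integrable lborel (\<lambda>x::real. 1 / (w\<^sup>2 + (of_real x)\<^sup>2))"
    by (rule integrable_quadratic_decay[OF cont, of "2 * norm w" 4])
      (use norm_kernel_product_le[of w "of_real _"] in \<open>simp add: norm_divide\<close>)
  have slit: "w + \<i> * of_real x \<notin> \<real>\<^sub>\<le>\<^sub>0" "w - \<i> * of_real x \<notin> \<real>\<^sub>\<le>\<^sub>0" for x :: real
    using w by (auto simp: complex_nonpos_Reals_iff)
  show "(\<integral>x. 1 / (w\<^sup>2 + (of_real x)\<^sup>2) \<partial>lborel) = of_real pi / w"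
  proof (rule integral_real_line_FTC[OF int cont,
        where F = "\<lambda>x. (Ln (w + \<i> * of_real x) - Ln (w - \<i> * of_real x)) / (2 * \<i> * w)"])
    fix x :: real
    have "((\<lambda>z. (Ln (w + \<i> * z) - Ln (w - \<i> * z)) / (2 * \<i> * w)) has_field_derivative
       (\<i> / (w + \<i> * of_real x) + \<i> / (w - \<i> * of_real x)) / (2 * \<i> * w)) (at (of_real x))"
      using slit w0 by (auto intro!: derivative_eq_intros simp: divide_simps)
    moreover have "(\<i> / (w + \<i> * of_real x) + \<i> / (w - \<i> * of_real x)) / (2 * \<i> * w)
        = 1 / (w\<^sup>2 + (of_real x)\<^sup>2)"
    proof -
      have "w\<^sup>2 + (of_real x)\<^sup>2 = (w - \<i> * of_real x) * (w + \<i> * of_real x)"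
        by (simp add: algebra_simps power2_eq_square)
      moreover have "\<i> / (w + \<i> * of_real x) + \<i> / (w - \<i> * of_real x)
          = (2 * \<i> * w) / ((w - \<i> * of_real x) * (w + \<i> * of_real x))"
        by (subst add_frac_eq[OF nz(2,1)]) (simp add: algebra_simps)
      ultimately show ?thesis using w0 by simp
    qed
    ultimately show "((\<lambda>x. (Ln (w + \<i> * of_real x) - Ln (w - \<i> * of_real x)) / (2 * \<i> * w))
        has_vector_derivative 1 / (w\<^sup>2 + (of_real x)\<^sup>2)) (at x)"
      using has_vector_derivative_real_field by auto
  next
    have eq: "(Ln (w + \<i> * of_real (real n)) - Ln (w - \<i> * of_real (real n))) / (2 * \<i> * w)
        - (Ln (w + \<i> * of_real (- real n)) - Ln (w - \<i> * of_real (- real n))) / (2 * \<i> * w)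
        = (Ln (w / of_nat n + \<i>) - Ln (w / of_nat n - \<i>)) / (\<i> * w)" if n: "n > 0" for n
    proof -
      have im: "w / of_nat n + \<i> \<noteq> 0" "w / of_nat n - \<i> \<noteq> 0"
        using w n by (auto simp: complex_eq_iff Re_divide_of_nat)
      have "w + \<i> * of_real (real n) = of_real (real n) * (w / of_nat n + \<i>)"
        using n by (simp add: field_simps)
      then have "Ln (w + \<i> * of_real (real n)) = Ln (of_real (real n) * (w / of_nat n + \<i>))" by simp
      also have "\<dots> = of_real (ln (real n)) + Ln (w / of_nat n + \<i>)"
        using n im by (subst Ln_times_of_real) auto
      finally have 1: "Ln (w + \<i> * of_real (real n)) = of_real (ln (real n)) + Ln (w / of_nat n + \<i>)" .
      have "w - \<i> * of_real (real n) = of_real (real n) * (w / of_nat n - \<i>)"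
        using n by (simp add: field_simps)
      then have "Ln (w - \<i> * of_real (real n)) = Ln (of_real (real n) * (w / of_nat n - \<i>))" by simp
      also have "\<dots> = of_real (ln (real n)) + Ln (w / of_nat n - \<i>)"
        using n im by (subst Ln_times_of_real) auto
      finally have 2: "Ln (w - \<i> * of_real (real n)) = of_real (ln (real n)) + Ln (w / of_nat n - \<i>)" .
      have neg: "w + \<i> * of_real (- real n) = w - \<i> * of_real (real n)"
        "w - \<i> * of_real (- real n) = w + \<i> * of_real (real n)" by simp_all
      have alg: "(a + b - (a + c)) / (2 * \<i> * w) - (a + c - (a + b)) / (2 * \<i> * w) = (b - c) / (\<i> * w)"
        for a b c :: complex using w0 by (simp add: field_simps)
      show ?thesis unfolding neg 1 2 alg ..
    qed
    have "(\<lambda>n. w / of_nat n) \<longlonglongrightarrow> 0"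
      by (intro tendsto_divide_0[OF tendsto_const] tendsto_of_nat)
    then have "(\<lambda>n. (Ln (w / of_nat n + \<i>) - Ln (w / of_nat n - \<i>)) / (\<i> * w))
        \<longlonglongrightarrow> (Ln (0 + \<i>) - Ln (0 - \<i>)) / (\<i> * w)"
      using w0 by (intro tendsto_intros) (auto simp: complex_nonpos_Reals_iff)
    moreover have "(Ln (0 + \<i>) - Ln (0 - \<i>)) / (\<i> * w) = of_real pi / w"
      by (simp add: field_simps)
    ultimately show "(\<lambda>n. (Ln (w + \<i> * of_real (real n)) - Ln (w - \<i> * of_real (real n))) / (2 * \<i> * w)
        - (Ln (w + \<i> * of_real (- real n)) - Ln (w - \<i> * of_real (- real n))) / (2 * \<i> * w))
        \<longlonglongrightarrow> of_real pi / w"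
      using eq by (subst tendsto_cong[where g = "\<lambda>n. (Ln (w / of_nat n + \<i>) - Ln (w / of_nat n - \<i>)) / (\<i> * w)"])
        (auto intro!: eventually_mono[OF eventually_gt_at_top[of 0]])
  qed
qed

text \<open>The only zero of \<open>w\<^sup>2 + z\<^sup>2\<close> in the upper half-plane is \<open>\<i>w\<close>. Subtracting \<open>f (\<i>w)\<close> from \<open>f\<close> removes the
  singularity and leaves quadratic decay, so only the constant contributes.\<close>

lemma integral_entire_over_square_plus:
  assumes w: "Re w > 0" and hol: "f holomorphic_on UNIV"
    and bd: "\<And>z. Im z \<ge> 0 \<Longrightarrow> norm (f z) \<le> B"
  shows "integrable lborel (\<lambda>x::real. f (of_real x) / (w\<^sup>2 + (of_real x)\<^sup>2))"
    and "(\<integral>x. f (of_real x) / (w\<^sup>2 + (of_real x)\<^sup>2) \<partial>lborel) = f (\<i> * w) * of_real pi / w"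
proof -
  define g where "g = (\<lambda>z. if z = \<i> * w then deriv f (\<i> * w) else (f z - f (\<i> * w)) / (z - \<i> * w))"
  have g: "g holomorphic_on UNIV"
    unfolding g_def by (rule pole_lemma[OF hol]) auto
  have w0: "w \<noteq> 0" using w by auto
  have nz: "z + \<i> * w \<noteq> 0" if "Im z \<ge> 0" for z
    using w that by (auto simp: complex_eq_iff)
  have eqG: "g z / (z + \<i> * w) = (f z - f (\<i> * w)) / (w\<^sup>2 + z\<^sup>2)" if "z \<noteq> \<i> * w" for z
  proof -
    have "w\<^sup>2 + z\<^sup>2 = (z - \<i> * w) * (z + \<i> * w)" by (simp add: algebra_simps power2_eq_square)
    then show ?thesis using that by (simp add: g_def)
  qed
  have bdG: "norm (g z / (z + \<i> * w)) \<le> 8 * B / (norm z)\<^sup>2" if z: "Im z \<ge> 0" "norm z \<ge> 2 * norm w" for z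
  proof -
    have "z \<noteq> \<i> * w" using z w0 by (auto simp: norm_mult)
    then have "norm (g z / (z + \<i> * w)) = norm (f z - f (\<i> * w)) * (1 / norm (w\<^sup>2 + z\<^sup>2))"
      by (simp add: eqG norm_divide)
    also have "\<dots> \<le> (2 * B) * (4 / (norm z)\<^sup>2)"
      using bd[OF z(1)] bd[of "\<i> * w"] w norm_triangle_ineq4[of "f z" "f (\<i> * w)"] order_trans[OF norm_ge_zero bd[OF z(1)]]
      by (intro mult_mono norm_kernel_product_le z) auto
    finally show ?thesis by simp
  qed
  have contG: "continuous_on {z. Im z \<ge> 0} (\<lambda>z. g z / (z + \<i> * w))"
    using nz by (intro continuous_intros holomorphic_on_imp_continuous_on holomorphic_on_subset[OF g]) auto
  have holG: "(\<lambda>z. g z / (z + \<i> * w)) holomorphic_on {z. Im z > 0}"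
    using nz by (intro holomorphic_intros holomorphic_on_subset[OF g]) auto
  have G: "integrable lborel (\<lambda>x::real. g (of_real x) / (of_real x + \<i> * w))"
      "(\<integral>x. g (of_real x) / (of_real x + \<i> * w) \<partial>lborel) = 0"
    using integral_upper_half_plane_eq_0[OF contG holG bdG] by simp_all
  have eq: "f (of_real x) / (w\<^sup>2 + (of_real x)\<^sup>2) = g (of_real x) / (of_real x + \<i> * w)
      + f (\<i> * w) * (1 / (w\<^sup>2 + (of_real x)\<^sup>2))" for x :: real
  proof -
    have "of_real x \<noteq> \<i> * w" using w by (auto simp: complex_eq_iff)
    then show ?thesis by (simp add: eqG diff_divide_distrib)
  qed
  show "integrable lborel (\<lambda>x::real. f (of_real x) / (w\<^sup>2 + (of_real x)\<^sup>2))"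
    unfolding eq by (intro Bochner_Integration.integrable_add integrable_mult_right G(1) integral_inverse_square_plus w)
  show "(\<integral>x. f (of_real x) / (w\<^sup>2 + (of_real x)\<^sup>2) \<partial>lborel) = f (\<i> * w) * of_real pi / w"
    unfolding eq
    by (subst Bochner_Integration.integral_add[OF G(1) integrable_mult_right[OF integral_inverse_square_plus(1)[OF w]]],
        subst integral_mult_right_zero, subst integral_inverse_square_plus(2)[OF w], subst G(2)) simp
qed

lemma norm_exp_i_real_le:
  assumes "a \<ge> 0" "Im z \<ge> 0"
  shows "norm (exp (\<i> * of_real a * z)) \<le> 1"
  using assms by simp

lemma lborel_integral_reflect:
  fixes f :: "real \<Rightarrow> complex"
  shows "(\<integral>x. f (- x) \<partial>lborel) = (\<integral>x. f x \<partial>lborel)"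
  using lborel_integral_real_affine[of "-1" f 0] by simp

lemma fourier_simple_kernel:
  assumes w: "Re w > 0"
  shows "(\<integral>x. exp (\<i> * of_real a * of_real x) * (w / (w\<^sup>2 + (of_real x)\<^sup>2)) \<partial>lborel)
    = of_real pi * exp (- of_real \<bar>a\<bar> * w)"
proof -
  have w0: "w \<noteq> 0" using w by auto
  have pos: "(\<integral>x. exp (\<i> * of_real a * of_real x) * (w / (w\<^sup>2 + (of_real x)\<^sup>2)) \<partial>lborel)
    = of_real pi * exp (- of_real a * w)" if a: "a \<ge> 0" for a
  proof -
    have "(\<integral>x. w * (exp (\<i> * of_real a * of_real x) / (w\<^sup>2 + (of_real x)\<^sup>2)) \<partial>lborel)
        = w * (exp (\<i> * of_real a * (\<i> * w)) * of_real pi / w)"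
      by (subst integral_mult_right_zero, subst integral_entire_over_square_plus(2)[OF w, where B = 1])
        (use norm_exp_i_real_le[OF a] in \<open>auto intro!: holomorphic_intros\<close>)
    then show ?thesis using w0 by (simp add: algebra_simps)
  qed
  show ?thesis
  proof (cases "a \<ge> 0")
    case True
    then show ?thesis using pos[of a] by simp
  next
    case False
    then show ?thesis using pos[of "-a"]
      by (subst lborel_integral_reflect[symmetric]) simp
  qed
qed

lemma integrable_double_kernel:
  assumes w: "Re w > 0"
  shows "integrable lborel (\<lambda>x::real. 1 / (norm (w - \<i> * of_real x))\<^sup>2)"
    and "(\<integral>x. 1 / (norm (w - \<i> * of_real x))\<^sup>2 \<partial>lborel) = pi / Re w"
proof -
  let ?u = "complex_of_real (Re w)"
  have eq: "1 / (norm (w - \<i> * of_real (Im w + 1 * x)))\<^sup>2 = Re (1 / (?u\<^sup>2 + (of_real x)\<^sup>2))" for x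
  proof -
    have "?u\<^sup>2 + (of_real x)\<^sup>2 = of_real ((norm (w - \<i> * of_real (Im w + 1 * x)))\<^sup>2)"
      by (simp add: cmod_power2)
    then show ?thesis by (metis Re_complex_of_real of_real_1 of_real_divide)
  qed
  have I: "integrable lborel (\<lambda>x::real. 1 / (?u\<^sup>2 + (of_real x)\<^sup>2))"
    using integral_inverse_square_plus(1)[of ?u] w by simp
  have "integrable lborel (\<lambda>x::real. 1 / (norm (w - \<i> * of_real (Im w + 1 * x)))\<^sup>2)"
    unfolding eq by (intro integrable_Re I)
  then show "integrable lborel (\<lambda>x::real. 1 / (norm (w - \<i> * of_real x))\<^sup>2)"
    by (subst (asm) lborel_integrable_real_affine_iff[where f = "\<lambda>x. 1 / (norm (w - \<i> * of_real x))\<^sup>2"]) auto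
  have "(\<integral>x. 1 / (norm (w - \<i> * of_real x))\<^sup>2 \<partial>lborel)
      = (\<integral>x. 1 / (norm (w - \<i> * of_real (Im w + 1 * x)))\<^sup>2 \<partial>lborel)"
    by (subst lborel_integral_real_affine[where c = 1 and t = "Im w"]) auto
  also have "\<dots> = Re (\<integral>x. 1 / (?u\<^sup>2 + (of_real x)\<^sup>2) \<partial>lborel)"
    unfolding eq by (rule integral_Re[OF I])
  also have "\<dots> = pi / Re w"
    by (subst integral_inverse_square_plus(2)) (use w in \<open>auto simp: Re_divide_of_real\<close>)
  finally show "(\<integral>x. 1 / (norm (w - \<i> * of_real x))\<^sup>2 \<partial>lborel) = pi / Re w" .
qed

text \<open>For \<open>a \<le> 0\<close> the exponential is bounded in the upper half-plane, and the double pole \<open>-\<i>w\<close> lies below.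
  For \<open>a \<ge> 0\<close> reflect \<open>x\<close>, and split the exponential into its value at the pole and a remainder that
  vanishes there: the value gives a kernel with a primitive that vanishes at infinity, and the
  remainder has only a simple pole left, which the previous evaluation handles.\<close>

lemma fourier_double_kernel:
  assumes w: "Re w > 0"
  shows "a \<ge> 0 \<Longrightarrow> (\<integral>x. exp (- \<i> * of_real a * of_real x) * (1 / (w - \<i> * of_real x)\<^sup>2) \<partial>lborel)
      = 2 * of_real pi * of_real a * exp (- of_real a * w)"
    and "a \<le> 0 \<Longrightarrow> (\<integral>x. exp (- \<i> * of_real a * of_real x) * (1 / (w - \<i> * of_real x)\<^sup>2) \<partial>lborel) = 0"
proof -
  assume a: "a \<le> 0"
  define f where "f = (\<lambda>z. exp (\<i> * of_real (-a) * z) * (1 / (w - \<i> * z)\<^sup>2))"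
  have nz: "w - \<i> * z \<noteq> 0" if "Im z \<ge> 0" for z
    using w that by (auto simp: complex_eq_iff)
  have "(\<integral>x. f (of_real x) \<partial>lborel) = 0"
  proof (rule integral_upper_half_plane_eq_0(2)[where r = "2 * norm w" and C = 4])
    show "continuous_on {z. 0 \<le> Im z} f"
      unfolding f_def using nz by (auto intro!: continuous_intros)
    show "f holomorphic_on {z. 0 < Im z}"
      unfolding f_def using nz by (auto intro!: holomorphic_intros)
    fix z assume z: "0 \<le> Im z" "norm z \<ge> 2 * norm w"
    have z0: "norm z > 0" using z w by (smt (verit) norm_ge_zero zero_complex.sel(1) zero_less_norm_iff)
    have "norm (f z) = norm (exp (\<i> * of_real (-a) * z)) * (1 / (norm (w - \<i> * z))\<^sup>2)"
      by (simp add: f_def norm_mult norm_divide norm_power)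
    also have "\<dots> \<le> 1 * (1 / (norm z / 2)\<^sup>2)"
      using norm_kernel_ge(1)[OF z(2)] z0 a z nz[OF z(1)]
      by (intro mult_mono norm_exp_i_real_le divide_left_mono power_mono mult_pos_pos zero_less_power) auto
    finally show "norm (f z) \<le> 4 / (norm z)\<^sup>2" by (simp add: power_divide)
  qed
  then show "(\<integral>x. exp (- \<i> * of_real a * of_real x) * (1 / (w - \<i> * of_real x)\<^sup>2) \<partial>lborel) = 0"
    by (simp add: f_def)
next
  assume a: "a \<ge> 0"
  have w0: "w \<noteq> 0" using w by auto
  define e where "e = (\<lambda>z. exp (\<i> * of_real a * z))"
  have e: "e holomorphic_on UNIV" unfolding e_def by (intro holomorphic_intros)
  have de: "deriv e z = \<i> * of_real a * e z" for z
    unfolding e_def by (rule DERIV_imp_deriv) (auto intro!: derivative_eq_intros)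
  define E where "E = e (\<i> * w)"
  have E: "E = exp (- of_real a * w)" by (simp add: E_def e_def algebra_simps)
  have e1: "norm (e z) \<le> 1" if "Im z \<ge> 0" for z
    using norm_exp_i_real_le[OF a that] by (simp add: e_def)
  have E1: "norm E \<le> 1" unfolding E_def by (rule e1) (use w in auto)
  define g where "g = (\<lambda>z. if z = \<i> * w then deriv e (\<i> * w) else (e z - e (\<i> * w)) / (z - \<i> * w))"
  have g: "g holomorphic_on UNIV"
    unfolding g_def by (rule pole_lemma[OF e]) auto
  define f where "f = (\<lambda>z. g z * (w - \<i> * z) / \<i>)"
  have f: "f holomorphic_on UNIV" unfolding f_def by (intro holomorphic_intros g) auto
  have "\<exists>B. \<forall>z. Im z \<ge> 0 \<longrightarrow> norm (f z) \<le> B"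
  proof -
    have "compact (f ` cball 0 (2 * norm w))"
      by (intro compact_continuous_image holomorphic_on_imp_continuous_on holomorphic_on_subset[OF f]) auto
    then obtain B where B: "\<And>z. z \<in> cball 0 (2 * norm w) \<Longrightarrow> norm (f z) \<le> B"
      using compact_imp_bounded bounded_iff by (metis imageI)
    have "norm (f z) \<le> max B 6" if z: "Im z \<ge> 0" for z
    proof (cases "norm z \<le> 2 * norm w")
      case True then show ?thesis using B[of z] by auto
    next
      case False
      then have n: "z \<noteq> \<i> * w" using w0 by (auto simp: norm_mult)
      have z0: "norm z > 0" using False norm_ge_zero[of w] by linarith
      have "w + \<i> * z = \<i> * (z - \<i> * w)" by (simp add: algebra_simps)
      have "f z = (e z - E) * (w - \<i> * z) / (w + \<i> * z)"
        using n by (simp add: f_def g_def E_def \<open>w + \<i> * z = \<i> * (z - \<i> * w)\<close> mult.commute del: divide_i)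
      then have "norm (f z) = norm (e z - E) * norm (w - \<i> * z) / norm (w + \<i> * z)"
        by (simp add: norm_mult norm_divide)
      also have "\<dots> \<le> 2 * (3/2 * norm z) / (norm z / 2)"
        using norm_kernel_ge(2)[of w z] False e1[OF z] E1 norm_triangle_ineq4[of "e z" E]
          norm_triangle_ineq4[of w "\<i> * z"] z0
        by (intro frac_le mult_mono mult_nonneg_nonneg) (auto simp: norm_mult)
      also have "\<dots> = 6" using z0 by simp
      finally show ?thesis by simp
    qed
    then show ?thesis by blast
  qed
  then obtain B where B: "\<And>z. Im z \<ge> 0 \<Longrightarrow> norm (f z) \<le> B" by blast
  note I1 = integral_entire_over_square_plus[OF w f B]
  have fval: "f (\<i> * w) = 2 * w * of_real a * E"
  proof -
    have "g (\<i> * w) = \<i> * of_real a * E" by (simp add: g_def de E_def)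
    moreover have "w - \<i> * (\<i> * w) = 2 * w" by simp
    ultimately show ?thesis unfolding f_def by simp
  qed
  have cont2: "continuous_on UNIV (\<lambda>x::real. 1 / (w + \<i> * of_real x)\<^sup>2)"
    using Re_pos_kernel_nonzero(2)[OF w] by (auto intro!: continuous_intros)
  have int2: "integrable lborel (\<lambda>x::real. 1 / (w + \<i> * of_real x)\<^sup>2)"
  proof (rule integrable_quadratic_decay[OF cont2])
    fix x :: real assume x: "\<bar>x\<bar> \<ge> 2 * norm w"
    have x0: "\<bar>x\<bar> > 0" using x w by (smt (verit) norm_ge_zero zero_complex.sel(1) zero_less_norm_iff)
    have "1 / (norm (w + \<i> * of_real x))\<^sup>2 \<le> 1 / (\<bar>x\<bar> / 2)\<^sup>2"
      using norm_kernel_ge(2)[of w "of_real x"] x x0 Re_pos_kernel_nonzero(2)[OF w, of x]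
      by (intro divide_left_mono power_mono mult_pos_pos zero_less_power) auto
    then show "norm (1 / (w + \<i> * of_real x)\<^sup>2) \<le> 4 / x\<^sup>2"
      by (simp add: norm_divide norm_power power_divide)
  qed
  have val2: "(\<integral>x. 1 / (w + \<i> * of_real x)\<^sup>2 \<partial>lborel) = 0"
  proof (rule integral_real_line_FTC[OF int2 cont2, where F = "\<lambda>x. \<i> / (w + \<i> * of_real x)"])
    fix x :: real
    have "((\<lambda>z. \<i> / (w + \<i> * z)) has_field_derivative 1 / (w + \<i> * of_real x)\<^sup>2) (at (of_real x))"
      using Re_pos_kernel_nonzero(2)[OF w, of x]
      by (auto intro!: derivative_eq_intros simp: power2_eq_square)
    then show "((\<lambda>x. \<i> / (w + \<i> * of_real x)) has_vector_derivative 1 / (w + \<i> * of_real x)\<^sup>2) (at x)"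
      using has_vector_derivative_real_field by auto
  next
    have "filterlim (\<lambda>n. w + \<i> * of_real (real n)) at_infinity sequentially"
      "filterlim (\<lambda>n. w + \<i> * of_real (- real n)) at_infinity sequentially"
      by (intro tendsto_add_filterlim_at_infinity[OF tendsto_const] tendsto_mult_filterlim_at_infinity[OF tendsto_const];
        simp add: filterlim_at_infinity_conv_norm_at_top filterlim_real_sequentially)+
    from tendsto_diff[OF tendsto_divide_0[OF tendsto_const this(1)] tendsto_divide_0[OF tendsto_const this(2)]]
    show "(\<lambda>n. \<i> / (w + \<i> * of_real (real n)) - \<i> / (w + \<i> * of_real (- real n))) \<longlonglongrightarrow> 0"
      by simp
  qed
  have eq: "exp (- \<i> * of_real a * of_real (-x)) * (1 / (w - \<i> * of_real (-x))\<^sup>2)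
      = f (of_real x) / (w\<^sup>2 + (of_real x)\<^sup>2) + E * (1 / (w + \<i> * of_real x)\<^sup>2)" for x :: real
  proof -
    have n: "of_real x \<noteq> \<i> * w" using w by (auto simp: complex_eq_iff)
    have sq: "w\<^sup>2 + (of_real x)\<^sup>2 = (w - \<i> * of_real x) * (w + \<i> * of_real x)"
      by (simp add: algebra_simps power2_eq_square)
    have "w + \<i> * of_real x = \<i> * (of_real x - \<i> * w)" by (simp add: algebra_simps)
    then have "f (of_real x) = (e (of_real x) - E) * (w - \<i> * of_real x) / (w + \<i> * of_real x)"
      using n by (simp add: f_def g_def E_def mult.commute del: divide_i)
    then have "f (of_real x) / (w\<^sup>2 + (of_real x)\<^sup>2) = (e (of_real x) - E) / (w + \<i> * of_real x)\<^sup>2"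
      using Re_pos_kernel_nonzero[OF w, of x] unfolding sq by (simp add: power2_eq_square)
    then show ?thesis by (simp add: e_def diff_divide_distrib)
  qed
  have "(\<integral>x. exp (- \<i> * of_real a * of_real x) * (1 / (w - \<i> * of_real x)\<^sup>2) \<partial>lborel)
     = (\<integral>x. f (of_real x) / (w\<^sup>2 + (of_real x)\<^sup>2) + E * (1 / (w + \<i> * of_real x)\<^sup>2) \<partial>lborel)"
    by (subst lborel_integral_reflect[symmetric]) (simp only: eq)
  also have "\<dots> = f (\<i> * w) * of_real pi / w"
  proof -
    have "integrable lborel (\<lambda>x::real. E * (1 / (w + \<i> * of_real x)\<^sup>2))"
      by (rule integrable_mult_right[OF int2])
    moreover have "(\<integral>x. E * (1 / (w + \<i> * of_real x)\<^sup>2) \<partial>lborel) = 0"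
      by (subst integral_mult_right_zero) (simp add: val2)
    ultimately show ?thesis
      using I1 by (subst Bochner_Integration.integral_add) simp_all
  qed
  also have "\<dots> = 2 * of_real pi * of_real a * exp (- of_real a * w)"
    using w0 by (simp add: fval E)
  finally show "(\<integral>x. exp (- \<i> * of_real a * of_real x) * (1 / (w - \<i> * of_real x)\<^sup>2) \<partial>lborel)
      = 2 * of_real pi * of_real a * exp (- of_real a * w)" .
qed

section \<open>Integrals of powers of the kernel\<close>

definition kernel_transform :: "(real \<Rightarrow> complex) \<Rightarrow> (real \<Rightarrow> complex) \<Rightarrow> nat \<Rightarrow> real \<Rightarrow> complex" where
  "kernel_transform w b j x = (\<integral>t. b t / (w t - \<i> * of_real x) ^ j \<partial>lborel)"

lemma norm_kernel_ge_Re: "Re w \<le> norm (w - \<i> * of_real x)"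
  using complex_Re_le_cmod[of "w - \<i> * of_real x"] by simp

text \<open>Taylor's theorem in the half-plane \<open>Re z \<ge> Re w\<close>, which contains all the points \<open>w - \<i>x\<close>. An explicit
  quadratic error makes differentiation under the integral sign a matter of integrating a bound.\<close>

lemma kernel_power_taylor:
  assumes u: "Re w > 0"
  shows "norm (1 / (w - \<i> * of_real y) ^ j - 1 / (w - \<i> * of_real x) ^ j
      - of_real (y - x) * (\<i> * of_nat j / (w - \<i> * of_real x) ^ Suc j))
    \<le> real (j * Suc j) / Re w ^ (j + 2) * (y - x)\<^sup>2"
proof -
  define f :: "nat \<Rightarrow> complex \<Rightarrow> complex" where
    "f = (\<lambda>i z. if i = 0 then 1 / z ^ j else if i = 1 then - of_nat j / z ^ Suc j else of_nat (j * Suc j) / z ^ (j + 2))"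
  let ?S = "{z. Re z \<ge> Re w}"
  let ?a = "w - \<i> * of_real x" and ?b = "w - \<i> * of_real y"
  have "norm (f 0 ?b - (\<Sum>i\<le>1. f i ?a * (?b - ?a) ^ i / fact i))
      \<le> real (j * Suc j) / Re w ^ (j + 2) * norm (?b - ?a) ^ Suc 1 / fact 1"
  proof (rule complex_Taylor[of ?S])
    show "convex ?S" by (rule convex_halfspace_Re_ge)
    fix i z assume z: "z \<in> ?S" and i: "i \<le> (1::nat)"
    then have z0: "z \<noteq> 0" using u by auto
    have "((\<lambda>z. 1 / z ^ k) has_field_derivative - of_nat k / z ^ Suc k) (at z within ?S)" for k
    proof (cases k)
      case (Suc m)
      have "((\<lambda>z. z ^ Suc m) has_field_derivative of_nat (Suc m) * z ^ m) (at z within ?S)"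
        by (rule DERIV_cong[OF DERIV_power[OF DERIV_ident]]) simp
      from DERIV_inverse'[OF this] z0
      have "((\<lambda>z. inverse (z ^ Suc m)) has_field_derivative
          - (inverse (z ^ Suc m) * (of_nat (Suc m) * z ^ m) * inverse (z ^ Suc m))) (at z within ?S)"
        by simp
      moreover have "- (inverse (z ^ Suc m) * (of_nat (Suc m) * z ^ m) * inverse (z ^ Suc m))
          = - of_nat (Suc m) / z ^ Suc (Suc m)"
        using z0 by (simp add: divide_simps)
      ultimately show ?thesis unfolding Suc by (simp add: inverse_eq_divide)
    qed auto
    note d = this
    consider "i = 0" | "i = 1" using i by linarith
    then show "(f i has_field_derivative f (Suc i) z) (at z within ?S)"
    proof cases
      case 1
      then show ?thesis using d[of j] by (simp add: f_def)
    next
      case 2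
      have 3: "f (Suc 0) = (\<lambda>z. - of_nat j * (1 / z ^ Suc j))"
        by (simp add: f_def fun_eq_iff)
      have 4: "f (Suc (Suc 0)) z = - of_nat j * (- of_nat (Suc j) / z ^ Suc (Suc j))"
        by (simp add: f_def algebra_simps)
      show ?thesis unfolding 2 One_nat_def 3 4 by (intro DERIV_cmult d)
    qed
  next
    fix z assume z: "z \<in> ?S"
    then have "Re w \<le> norm z" using complex_Re_le_cmod[of z] by auto
    then have "real (j * Suc j) / norm z ^ (j + 2) \<le> real (j * Suc j) / Re w ^ (j + 2)"
      using u by (intro divide_left_mono power_mono mult_pos_pos zero_less_power) auto
    moreover have "f (Suc 1) z = of_nat (j * Suc j) / z ^ (j + 2)" by (simp add: f_def)
    ultimately show "norm (f (Suc 1) z) \<le> real (j * Suc j) / Re w ^ (j + 2)"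
      by (simp only: norm_divide norm_power norm_of_nat)
  qed auto
  moreover have ba: "?b - ?a = - \<i> * of_real (y - x)" by (simp add: algebra_simps)
  moreover have "norm (- \<i> * complex_of_real (y - x)) = \<bar>y - x\<bar>"
    by (simp only: norm_mult norm_minus_cancel norm_ii norm_of_real mult_1_left)
  moreover have "f 0 ?b - (\<Sum>i\<le>1. f i ?a * (?b - ?a) ^ i / fact i)
      = 1 / ?b ^ j - 1 / ?a ^ j - of_real (y - x) * (\<i> * of_nat j / ?a ^ Suc j)"
    unfolding ba by (simp add: f_def diff_diff_eq mult_ac del: of_real_diff)
  ultimately show ?thesis
    by (simp only: power2_abs power_Suc power_0 fact_1 div_by_1 mult_1_right power2_eq_square One_nat_def abs_mult_self_eq fact_Suc_0)
qed

lemma has_vector_derivative_quadratic: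
  fixes F :: "real \<Rightarrow> complex"
  assumes "\<And>y. norm (F y - F x - of_real (y - x) * D) \<le> C * (y - x)\<^sup>2"
  shows "(F has_vector_derivative D) (at x)"
  unfolding has_vector_derivative_def has_derivative_at2
proof (intro conjI bounded_linear_scaleR_left)
  have aux: "norm ((1 / norm d) *\<^sub>R v) \<le> C * \<bar>d\<bar>" if "d \<noteq> 0" "norm v \<le> C * \<bar>d\<bar>\<^sup>2" for d and v :: complex
  proof -
    have "norm ((1 / norm d) *\<^sub>R v) = norm v / \<bar>d\<bar>" by simp
    also have "\<dots> \<le> (C * \<bar>d\<bar>\<^sup>2) / \<bar>d\<bar>" by (rule divide_right_mono[OF that(2)]) simp
    also have "\<dots> = C * \<bar>d\<bar>" using that(1) by (simp add: power2_eq_square del: abs_mult_self_eq)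
    finally show ?thesis .
  qed
  show "((\<lambda>y. (1 / norm (y - x)) *\<^sub>R (F y - (F x + (y - x) *\<^sub>R D))) \<longlongrightarrow> 0) (at x)"
  proof (rule Lim_null_comparison)
    show "eventually (\<lambda>y. norm ((1 / norm (y - x)) *\<^sub>R (F y - (F x + (y - x) *\<^sub>R D))) \<le> C * \<bar>y - x\<bar>) (at x)"
      unfolding eventually_at_filter
    proof (rule always_eventually, intro allI impI)
      fix y assume y: "y \<noteq> x"
      have "norm (F y - (F x + (y - x) *\<^sub>R D)) \<le> C * \<bar>y - x\<bar>\<^sup>2"
        using assms[of y] by (simp add: scaleR_conv_of_real algebra_simps)
      then show "norm ((1 / norm (y - x)) *\<^sub>R (F y - (F x + (y - x) *\<^sub>R D))) \<le> C * \<bar>y - x\<bar>"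
        using y by (intro aux) auto
    qed
    show "((\<lambda>y. C * \<bar>y - x\<bar>) \<longlongrightarrow> 0) (at x)"
      by (auto intro!: tendsto_eq_intros)
  qed
qed

text \<open>Every derivative of \<open>(w - \<i>x)\<^sup>-\<^sup>j\<close> in \<open>x\<close> costs one more factor \<open>1 / Re w\<close>; the last assumption pays for all
  of them.\<close>

context
  fixes w b :: "real \<Rightarrow> complex"
  assumes w_meas [measurable]: "w \<in> borel_measurable borel"
    and b_meas [measurable]: "b \<in> borel_measurable borel"
    and w_pos: "\<And>t. Re (w t) > 0"
    and int: "\<And>k. integrable lborel (\<lambda>t. norm (b t) / Re (w t) ^ k)"
begin

lemma kernel_integrand_integrable: "integrable lborel (\<lambda>t. b t / (w t - \<i> * of_real x) ^ j)"
proof (rule Bochner_Integration.integrable_bound[OF int[of j]])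
  show "AE t in lborel. norm (b t / (w t - \<i> * of_real x) ^ j) \<le> norm (norm (b t) / Re (w t) ^ j)"
  proof (rule AE_I2)
    fix t
    have "norm (b t) / norm (w t - \<i> * of_real x) ^ j \<le> norm (b t) / Re (w t) ^ j"
      using w_pos[of t] norm_kernel_ge_Re[of "w t" x]
      by (intro divide_left_mono power_mono mult_pos_pos zero_less_power) auto
    then show "norm (b t / (w t - \<i> * of_real x) ^ j) \<le> norm (norm (b t) / Re (w t) ^ j)"
      using w_pos[of t] by (simp add: norm_divide norm_power)
  qed
qed measurable

lemma kernel_transform_has_derivative:
  "(kernel_transform w b j has_vector_derivative \<i> * of_nat j * kernel_transform w b (Suc j) x) (at x)"
proof (rule has_vector_derivative_quadratic)
  fix y
  let ?C = "\<integral>t. norm (b t) / Re (w t) ^ (j + 2) \<partial>lborel"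
  let ?g = "\<lambda>t. b t / (w t - \<i> * of_real y) ^ j - b t / (w t - \<i> * of_real x) ^ j
      - of_real (y - x) * (\<i> * of_nat j * (b t / (w t - \<i> * of_real x) ^ Suc j))"
  have ig: "integrable lborel ?g"
    by (intro Bochner_Integration.integrable_diff integrable_mult_right kernel_integrand_integrable)
  have eq: "kernel_transform w b j y - kernel_transform w b j x
      - of_real (y - x) * (\<i> * of_nat j * kernel_transform w b (Suc j) x) = (\<integral>t. ?g t \<partial>lborel)"
  proof -
    have "(\<integral>t. ?g t \<partial>lborel) = (\<integral>t. b t / (w t - \<i> * of_real y) ^ j - b t / (w t - \<i> * of_real x) ^ j \<partial>lborel)
        - (\<integral>t. of_real (y - x) * (\<i> * of_nat j * (b t / (w t - \<i> * of_real x) ^ Suc j)) \<partial>lborel)"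
      by (rule Bochner_Integration.integral_diff)
        (intro Bochner_Integration.integrable_diff integrable_mult_right kernel_integrand_integrable)+
    also have "(\<integral>t. b t / (w t - \<i> * of_real y) ^ j - b t / (w t - \<i> * of_real x) ^ j \<partial>lborel)
        = kernel_transform w b j y - kernel_transform w b j x"
      unfolding kernel_transform_def
      by (rule Bochner_Integration.integral_diff[OF kernel_integrand_integrable kernel_integrand_integrable])
    also have "(\<integral>t. of_real (y - x) * (\<i> * of_nat j * (b t / (w t - \<i> * of_real x) ^ Suc j)) \<partial>lborel)
        = of_real (y - x) * (\<i> * of_nat j * kernel_transform w b (Suc j) x)"
      unfolding kernel_transform_def by (simp only: integral_mult_right_zero)
    finally show ?thesis by simp
  qed
  have "norm (\<integral>t. ?g t \<partial>lborel) \<le> (\<integral>t. norm (?g t) \<partial>lborel)" by (rule integral_norm_bound)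
  also have "\<dots> \<le> (\<integral>t. (real (j * Suc j) * (y - x)\<^sup>2) * (norm (b t) / Re (w t) ^ (j + 2)) \<partial>lborel)"
  proof (rule integral_mono)
    show "integrable lborel (\<lambda>t. norm (?g t))" by (rule integrable_norm[OF ig])
    show "integrable lborel (\<lambda>t. (real (j * Suc j) * (y - x)\<^sup>2) * (norm (b t) / Re (w t) ^ (j + 2)))"
      by (intro integrable_mult_right int)
    fix t
    have "?g t = b t * (1 / (w t - \<i> * of_real y) ^ j - 1 / (w t - \<i> * of_real x) ^ j
      - of_real (y - x) * (\<i> * of_nat j / (w t - \<i> * of_real x) ^ Suc j))"
      by (simp only: right_diff_distrib divide_inverse mult_1_left mult_ac)
    then have "norm (?g t) = norm (b t) * norm (1 / (w t - \<i> * of_real y) ^ j - 1 / (w t - \<i> * of_real x) ^ j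
      - of_real (y - x) * (\<i> * of_nat j / (w t - \<i> * of_real x) ^ Suc j))"
      by (simp only: norm_mult)
    also have "\<dots> \<le> norm (b t) * (real (j * Suc j) / Re (w t) ^ (j + 2) * (y - x)\<^sup>2)"
      by (intro mult_left_mono kernel_power_taylor w_pos) auto
    finally show "norm (?g t) \<le> (real (j * Suc j) * (y - x)\<^sup>2) * (norm (b t) / Re (w t) ^ (j + 2))"
      by (simp add: mult_ac)
  qed
  also have "\<dots> = (real (j * Suc j) * (y - x)\<^sup>2) * ?C"
    by (rule integral_mult_right_zero)
  also have "\<dots> = (real (j * Suc j) * ?C) * (y - x)\<^sup>2"
    by (simp only: mult_ac)
  finally show "norm (kernel_transform w b j y - kernel_transform w b j x
      - of_real (y - x) * (\<i> * of_nat j * kernel_transform w b (Suc j) x))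
      \<le> (real (j * Suc j) * ?C) * (y - x)\<^sup>2" unfolding eq .
qed

text \<open>Each differentiation raises the exponent of the kernel by one and multiplies by a constant, and
  all exponents are available.\<close>

lemma smooth_kernel_transform: "smooth (kernel_transform w b j)"
proof -
  define D where "D = (\<lambda>k x. (\<Prod>l<k. \<i> * of_nat (j + l)) * kernel_transform w b (j + k) x)"
  have "(D k has_vector_derivative D (Suc k) x) (at x)" for k x
  proof -
    have "((\<lambda>x. (\<Prod>l<k. \<i> * of_nat (j + l)) * kernel_transform w b (j + k) x) has_vector_derivative
      (\<Prod>l<k. \<i> * of_nat (j + l)) * (\<i> * of_nat (j + k) * kernel_transform w b (Suc (j + k)) x)) (at x)"
      by (intro has_vector_derivative_mult_right kernel_transform_has_derivative)
    then show ?thesis by (simp add: D_def mult_ac)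
  qed
  moreover have "D 0 = kernel_transform w b j" by (simp add: D_def fun_eq_iff)
  ultimately show ?thesis unfolding smooth_def by blast
qed

lemma continuous_kernel_transform: "isCont (kernel_transform w b j) x"
  using kernel_transform_has_derivative has_vector_derivative_continuous by blast

end

lemma smooth_cmult: "smooth f \<Longrightarrow> smooth (\<lambda>x. c * f x)"
  unfolding smooth_def
proof (elim exE conjE)
  fix D assume D: "D 0 = f" "\<forall>k x. (D k has_vector_derivative D (Suc k) x) (at x)"
  show "\<exists>D. D 0 = (\<lambda>x. c * f x) \<and> (\<forall>k x. (D k has_vector_derivative D (Suc k) x) (at x))"
    by (intro exI[of _ "\<lambda>k x. c * D k x"]) (use D in \<open>auto intro!: has_vector_derivative_mult_right\<close>)
qed

lemma smooth_add: "smooth f \<Longrightarrow> smooth g \<Longrightarrow> smooth (\<lambda>x. f x + g x)"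
  unfolding smooth_def
proof (elim exE conjE)
  fix D D' assume D: "D 0 = f" "\<forall>k x. (D k has_vector_derivative D (Suc k) x) (at x)"
    "D' 0 = g" "\<forall>k x. (D' k has_vector_derivative D' (Suc k) x) (at x)"
  show "\<exists>D. D 0 = (\<lambda>x. f x + g x) \<and> (\<forall>k x. (D k has_vector_derivative D (Suc k) x) (at x))"
    by (intro exI[of _ "\<lambda>k x. D k x + D' k x"]) (use D in \<open>auto intro!: has_vector_derivative_add\<close>)
qed

lemma smooth_reflect: "smooth f \<Longrightarrow> smooth (\<lambda>x. f (- x))"
  unfolding smooth_def
proof (elim exE conjE)
  fix D assume D: "D 0 = f" "\<forall>k x. (D k has_vector_derivative D (Suc k) x) (at x)"
  have "((\<lambda>x. (-1) ^ k * D k (- x)) has_vector_derivative (-1) ^ Suc k * D (Suc k) (- x)) (at x)" for k x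
  proof -
    have "((D k \<circ> uminus) has_vector_derivative (-1) *\<^sub>R D (Suc k) (- x)) (at x)"
      by (rule vector_diff_chain_at) (use D in \<open>auto intro!: derivative_eq_intros\<close>)
    then have "((\<lambda>x. (-1) ^ k * (D k \<circ> uminus) x) has_vector_derivative (-1) ^ k * ((-1) *\<^sub>R D (Suc k) (- x))) (at x)"
      by (rule has_vector_derivative_mult_right)
    then show ?thesis by (simp add: o_def)
  qed
  then show "\<exists>D. D 0 = (\<lambda>x. f (- x)) \<and> (\<forall>k x. (D k has_vector_derivative D (Suc k) x) (at x))"
    by (intro exI[of _ "\<lambda>k x. (-1) ^ k * D k (- x)"]) (use D in auto)
qed

text \<open>The \<open>x\<close>-integral of the dominating kernel is \<open>2\<pi> / Re w\<close>; this is why one negative power of \<open>Re w\<close>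
  must be integrable against \<open>B\<close>.\<close>

lemma kernel_fubini:
  fixes G :: "real \<Rightarrow> real \<Rightarrow> complex"
  assumes w_meas [measurable]: "w \<in> borel_measurable borel" and w_pos: "\<And>t. Re (w t) > 0"
    and G_meas [measurable]: "(\<lambda>(t, x). G t x) \<in> borel_measurable (lborel \<Otimes>\<^sub>M lborel)"
    and e_meas [measurable]: "e \<in> borel_measurable borel" and e1: "\<And>x. norm (e x) \<le> (1::real)"
    and int: "integrable lborel (\<lambda>t. B t / Re (w t))"
    and bd: "\<And>t x. norm (G t x) \<le> B t * (1 / (norm (w t - \<i> * of_real x))\<^sup>2 + 1 / (norm (w t + \<i> * of_real x))\<^sup>2)"
  shows "integrable lborel (\<lambda>x. e x * (\<integral>t. G t x \<partial>lborel))"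
    and "(\<integral>x. e x * (\<integral>t. G t x \<partial>lborel) \<partial>lborel) = (\<integral>t. (\<integral>x. e x * G t x \<partial>lborel) \<partial>lborel)"
proof -
  have kern: "integrable lborel (\<lambda>x. 1 / (norm (w t - \<i> * of_real x))\<^sup>2 + 1 / (norm (w t + \<i> * of_real x))\<^sup>2)"
    "(\<integral>x. 1 / (norm (w t - \<i> * of_real x))\<^sup>2 + 1 / (norm (w t + \<i> * of_real x))\<^sup>2 \<partial>lborel) = 2 * pi / Re (w t)" for t
  proof -
    note 1 = integrable_double_kernel[OF w_pos[of t]]
    have 2: "integrable lborel (\<lambda>x. 1 / (norm (w t + \<i> * of_real x))\<^sup>2)"
      using lborel_integrable_real_affine[OF 1(1), of "-1" 0] by simp
    have 3: "(\<integral>x. 1 / (norm (w t + \<i> * of_real x))\<^sup>2 \<partial>lborel) = pi / Re (w t)"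
      using lborel_integral_real_affine[of "-1" "\<lambda>x. 1 / (norm (w t - \<i> * of_real x))\<^sup>2" 0] 1(2) by simp
    show "integrable lborel (\<lambda>x. 1 / (norm (w t - \<i> * of_real x))\<^sup>2 + 1 / (norm (w t + \<i> * of_real x))\<^sup>2)"
      by (intro Bochner_Integration.integrable_add 1 2)
    show "(\<integral>x. 1 / (norm (w t - \<i> * of_real x))\<^sup>2 + 1 / (norm (w t + \<i> * of_real x))\<^sup>2 \<partial>lborel) = 2 * pi / Re (w t)"
      by (subst Bochner_Integration.integral_add[OF 1(1) 2]) (simp add: 1(2) 3)
  qed
  let ?f = "\<lambda>t x. e x * G t x"
  have bd': "norm (?f t x) \<le> B t * (1 / (norm (w t - \<i> * of_real x))\<^sup>2 + 1 / (norm (w t + \<i> * of_real x))\<^sup>2)" for t x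
    using mult_mono[OF e1[of x] bd[of t x]] by (simp add: norm_mult)
  have meas_f [measurable]: "(\<lambda>(t, x). ?f t x) \<in> borel_measurable (lborel \<Otimes>\<^sub>M lborel)"
    by measurable
  have meas_t [measurable]: "(\<lambda>x. ?f t x) \<in> borel_measurable lborel" for t
    using measurable_compose[OF measurable_Pair1' meas_f, of t] by (simp add: space_pair_measure)
  have int_t: "integrable lborel (\<lambda>x. ?f t x)" for t
    by (rule Bochner_Integration.integrable_bound[OF integrable_mult_right[OF kern(1), of "B t" t] meas_t])
      (use bd' in \<open>auto intro!: AE_I2 order_trans[OF bd']\<close>)
  have "integrable (lborel \<Otimes>\<^sub>M lborel) (\<lambda>(t, x). ?f t x)"
  proof (rule lborel_pair.Fubini_integrable[OF meas_f])
    show "AE t in lborel. integrable lborel (\<lambda>x. case (t, x) of (t, x) \<Rightarrow> ?f t x)"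
      using int_t by (intro AE_I2) simp
    show "integrable lborel (\<lambda>t. \<integral>x. norm (case (t, x) of (t, x) \<Rightarrow> ?f t x) \<partial>lborel)"
    proof (rule Bochner_Integration.integrable_bound[OF integrable_mult_right[OF int, of "2 * pi"]])
      show "(\<lambda>t. \<integral>x. norm (case (t, x) of (t, x) \<Rightarrow> ?f t x) \<partial>lborel) \<in> borel_measurable lborel"
        by measurable
      show "AE t in lborel. norm (\<integral>x. norm (case (t, x) of (t, x) \<Rightarrow> ?f t x) \<partial>lborel) \<le> norm (2 * pi * (B t / Re (w t)))"
      proof (rule AE_I2)
        fix t
        have "(\<integral>x. norm (?f t x) \<partial>lborel) \<le> (\<integral>x. B t * (1 / (norm (w t - \<i> * of_real x))\<^sup>2 + 1 / (norm (w t + \<i> * of_real x))\<^sup>2) \<partial>lborel)"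
          by (rule integral_mono[OF integrable_norm[OF int_t] integrable_mult_right[OF kern(1)] bd'])
        also have "\<dots> = 2 * pi * (B t / Re (w t))"
          by (subst integral_mult_right_zero, subst kern(2)) simp
        finally show "norm (\<integral>x. norm (case (t, x) of (t, x) \<Rightarrow> ?f t x) \<partial>lborel) \<le> norm (2 * pi * (B t / Re (w t)))"
          unfolding real_norm_def prod.case
          by (intro order_trans[OF _ abs_ge_self] order_trans[OF eq_refl[OF abs_of_nonneg]] Bochner_Integration.integral_nonneg) auto
      qed
    qed
  qed
  then have I: "integrable (lborel \<Otimes>\<^sub>M lborel) (case_prod ?f)" by simp
  show "integrable lborel (\<lambda>x. e x * (\<integral>t. G t x \<partial>lborel))"
    using lborel_pair.integrable_snd[OF I] by (simp only: integral_mult_right_zero)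
  show "(\<integral>x. e x * (\<integral>t. G t x \<partial>lborel) \<partial>lborel) = (\<integral>t. (\<integral>x. e x * G t x \<partial>lborel) \<partial>lborel)"
    using lborel_pair.Fubini_integral[OF I] by (simp only: integral_mult_right_zero)
qed

section \<open>The hypergeometric function on the slit plane\<close>

abbreviation ellker :: "complex \<Rightarrow> real \<Rightarrow> complex" where
  "ellker z \<theta> \<equiv> 1 / csqrt (1 - z * of_real ((sin \<theta>)\<^sup>2))"

text \<open>\<open>F\<close> as a complete elliptic integral. The radicand avoids the branch cut of the square root for every
  \<open>z\<close> in the slit plane, so this formula is the analytic continuation.\<close>

definition ellint :: "complex \<Rightarrow> complex" where
  "ellint z = 2 / of_real pi * integral {0..pi/2} (ellker z)"

lemma slit_plane_iff: "z \<in> slit_plane \<longleftrightarrow> Im z \<noteq> 0 \<or> Re z < 1"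
  by (auto simp: slit_plane_def complex_eq_iff image_iff)

lemma mult_less_one:
  fixes a u :: real
  assumes "a < 1" "0 \<le> u" "u \<le> 1"
  shows "u * a < 1" "a * u < 1"
proof -
  show "u * a < 1"
  proof (cases "a \<le> 0")
    case True
    then have "u * a \<le> 0" using assms by (intro mult_nonneg_nonpos) auto
    then show ?thesis by simp
  next
    case False
    then have "u * a \<le> a" using assms by (intro mult_left_le_one_le) auto
    then show ?thesis using assms by simp
  qed
  then show "a * u < 1" by (simp add: mult.commute)
qed

lemma open_slit_plane: "open slit_plane"
proof -
  have eq: "slit_plane = - ({z. Im z = 0} \<inter> {z. Re z \<ge> 1})"
    by (auto simp: slit_plane_iff)
  have "closed ({z. Im z = 0} \<inter> {z. Re z \<ge> 1})"
    by (intro closed_Int closed_Collect_eq closed_Collect_le continuous_intros)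
  then show ?thesis unfolding eq by (rule open_Compl)
qed

lemma starlike_slit_plane: "\<And>z. z \<in> slit_plane \<Longrightarrow> closed_segment 0 z \<subseteq> slit_plane"
proof
  fix z x assume z: "z \<in> slit_plane" and x: "x \<in> closed_segment 0 z"
  then obtain u where u: "0 \<le> u" "u \<le> 1" "x = u *\<^sub>R z" by (auto simp: in_segment)
  show "x \<in> slit_plane" using z u mult_less_one(1)[of "Re z" u] by (auto simp: slit_plane_iff)
qed

lemma zero_in_slit_plane: "0 \<in> slit_plane" by (simp add: slit_plane_iff)

lemma starlike_slit_plane': "starlike slit_plane"
  unfolding starlike_def using starlike_slit_plane zero_in_slit_plane by blast

lemma connected_slit_plane: "connected slit_plane"
  by (rule starlike_imp_connected[OF starlike_slit_plane'])

lemma ball_subset_slit_plane: "ball 0 1 \<subseteq> slit_plane"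
proof
  fix z :: complex assume "z \<in> ball 0 1"
  then have "norm z < 1" by simp
  then show "z \<in> slit_plane" using complex_Re_le_cmod[of z] by (auto simp: slit_plane_iff)
qed

lemma radicand_not_nonpos:
  assumes "z \<in> slit_plane" "0 \<le> s" "s \<le> 1"
  shows "1 - z * of_real s \<notin> \<real>\<^sub>\<le>\<^sub>0"
proof
  assume "1 - z * of_real s \<in> \<real>\<^sub>\<le>\<^sub>0"
  then have *: "1 \<le> Re z * s" "Im z * s = 0" by (auto simp: complex_nonpos_Reals_iff)
  then have "s \<noteq> 0" by auto
  with * assms have "Re z < 1" by (auto simp: slit_plane_iff)
  then have "Re z * s < 1" using assms(2,3) by (rule mult_less_one(2))
  then show False using * by simp
qed

lemma sin_square_bounds: "0 \<le> (sin \<theta>)\<^sup>2" "(sin \<theta> :: real)\<^sup>2 \<le> 1"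
  by (simp_all add: abs_square_le_1)

lemma continuous_on_ellint_integrand:
  "continuous_on (slit_plane \<times> UNIV) (\<lambda>(z, \<theta>). ellker z \<theta>)"
proof -
  have nz: "1 - z * of_real ((sin \<theta>)\<^sup>2) \<notin> \<real>\<^sub>\<le>\<^sub>0" if "z \<in> slit_plane" for z \<theta>
    by (rule radicand_not_nonpos[OF that sin_square_bounds])
  have "continuous_on (slit_plane \<times> UNIV) (\<lambda>p. csqrt (1 - fst p * of_real ((sin (snd p))\<^sup>2)))"
    by (rule continuous_on_compose2[OF continuous_on_csqrt]) (use nz in \<open>auto intro!: continuous_intros\<close>)
  moreover have "csqrt (1 - fst p * of_real ((sin (snd p))\<^sup>2)) \<noteq> 0" if "p \<in> slit_plane \<times> UNIV" for p
    using nz[of "fst p" "snd p"] that by auto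
  ultimately show ?thesis
    unfolding split_beta by (intro continuous_on_divide continuous_on_const) auto
qed

lemma ellint_integrable:
  assumes "z \<in> slit_plane"
  shows "(ellker z) integrable_on {0..pi/2}"
proof (rule integrable_continuous_real)
  have "continuous_on {0..pi/2} (\<lambda>\<theta>. case (z, \<theta>) of (z, \<theta>) \<Rightarrow> ellker z \<theta>)"
    by (rule continuous_on_compose2[OF continuous_on_ellint_integrand]) (use assms in \<open>auto intro!: continuous_intros\<close>)
  then show "continuous_on {0..pi/2} (ellker z)" by simp
qed

lemma ellint_holomorphic: "ellint holomorphic_on slit_plane"
proof -
  have "ellint holomorphic_on ball z r" if r: "ball z r \<subseteq> slit_plane" for z r
  proof -
    have "(\<lambda>z. integral (cbox 0 (pi/2)) (ellker z)) holomorphic_on ball z r"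
    proof (rule leibniz_rule_holomorphic)
      fix x \<theta> assume x: "x \<in> ball z r"
      then have nz: "1 - x * of_real ((sin \<theta>)\<^sup>2) \<notin> \<real>\<^sub>\<le>\<^sub>0"
        using r by (intro radicand_not_nonpos sin_square_bounds) auto
      then have nz': "csqrt (1 - x * of_real ((sin \<theta>)\<^sup>2)) \<noteq> 0" by auto
      show "((\<lambda>z. ellker z \<theta>) has_field_derivative
          of_real ((sin \<theta>)\<^sup>2) / 2 * (ellker x \<theta>) ^ 3) (at x within ball z r)"
        by (rule derivative_eq_intros refl nz nz' | simp)+
          (simp add: field_simps eval_nat_numeral nz')
    next
      fix x assume "x \<in> ball z r"
      then show "(ellker x) integrable_on cbox 0 (pi/2)"
        using ellint_integrable r by auto
    next
      have "continuous_on (ball z r \<times> cbox 0 (pi/2)) (\<lambda>p. 1 / csqrt (1 - fst p * of_real ((sin (snd p))\<^sup>2)))"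
        using r by (intro continuous_on_subset[OF continuous_on_ellint_integrand[unfolded split_beta]]) auto
      then show "continuous_on (ball z r \<times> cbox 0 (pi/2))
          (\<lambda>(x, \<theta>). of_real ((sin \<theta>)\<^sup>2) / 2 * (ellker x \<theta>) ^ 3)"
        unfolding split_beta
        by (intro continuous_on_mult[OF _ continuous_on_power]) (auto intro!: continuous_intros)
    qed auto
    then show ?thesis unfolding ellint_def by (intro holomorphic_intros) auto
  qed
  then show ?thesis
    unfolding holomorphic_on_open[OF open_slit_plane]
    by (metis (no_types, lifting) open_slit_plane centre_in_ball holomorphic_on_open open_ball open_contains_ball)
qed

subsection \<open>Taylor coefficients\<close>

text \<open>These are \<open>(2n choose n) / 4\<^sup>n\<close>; their squares are the Taylor coefficients of \<open>F\<close>.\<close>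

definition half_binom :: "nat \<Rightarrow> real" where
  "half_binom n = pochhammer (1/2) n / fact n"

lemma half_binom_Suc: "half_binom (Suc n) = half_binom n * ((2 * real n + 1) / (2 * real n + 2))"
  by (simp add: half_binom_def pochhammer_Suc field_simps)

lemma half_binom_0 [simp]: "half_binom 0 = 1"
  by (simp add: half_binom_def)

lemma half_binom_bounds: "0 < half_binom n" "half_binom n \<le> 1"
proof -
  show 0: "0 < half_binom n" for n by (simp add: half_binom_def pochhammer_pos)
  show "half_binom n \<le> 1"
  proof (induction n)
    case (Suc n)
    have "half_binom n * ((2 * real n + 1) / (2 * real n + 2)) \<le> 1 * 1"
      using Suc 0[of n] by (intro mult_mono) auto
    then show ?case by (simp add: half_binom_Suc)
  qed auto
qed

text \<open>Wallis' recursion, from the derivative of \<open>- cos \<theta> sin\<^sup>2\<^sup>n\<^sup>+\<^sup>1 \<theta>\<close>.\<close>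

lemma integral_sin_power: "((\<lambda>\<theta>. (sin \<theta>) ^ (2 * n)) has_integral pi / 2 * half_binom n) {0..pi/2}"
proof (induction n)
  case 0
  show ?case using has_integral_const_real[of "1::real" 0 "pi/2"] by simp
next
  case (Suc n)
  let ?F = "\<lambda>\<theta>::real. - cos \<theta> * (sin \<theta>) ^ (2 * n + 1)"
  have "((\<lambda>\<theta>. (2 * real n + 2) * (sin \<theta>) ^ (2 * Suc n) - (2 * real n + 1) * (sin \<theta>) ^ (2 * n))
      has_integral ?F (pi/2) - ?F 0) {0..pi/2}"
  proof (rule fundamental_theorem_of_calculus)
    fix x :: real
    have "((\<lambda>\<theta>. - cos \<theta> * (sin \<theta>) ^ (2 * n + 1)) has_real_derivative
        sin x * (sin x) ^ (2 * n + 1) + (- cos x) * (real (2 * n + 1) * (cos x * (sin x) ^ (2 * n)))) (at x)"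
      by (rule DERIV_cong[OF DERIV_mult[OF DERIV_minus[OF DERIV_cos] DERIV_power[OF DERIV_sin]]]) simp
    moreover have "sin x * (sin x) ^ (2 * n + 1) + (- cos x) * (real (2 * n + 1) * (cos x * (sin x) ^ (2 * n)))
        = (2 * real n + 2) * (sin x) ^ (2 * Suc n) - (2 * real n + 1) * (sin x) ^ (2 * n)"
    proof -
      have c: "cos x * cos x = 1 - sin x * sin x"
        using sin_cos_squared_add[of x] by (simp add: power2_eq_square algebra_simps)
      have "(- cos x) * (real (2 * n + 1) * (cos x * (sin x) ^ (2 * n))) = - ((cos x * cos x) * (real (2 * n + 1) * (sin x) ^ (2 * n)))"
        by simp
      also have "\<dots> = - ((1 - sin x * sin x) * (real (2 * n + 1) * (sin x) ^ (2 * n)))"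
        unfolding c ..
      finally have 1: "(- cos x) * (real (2 * n + 1) * (cos x * (sin x) ^ (2 * n)))
          = - ((1 - sin x * sin x) * (real (2 * n + 1) * (sin x) ^ (2 * n)))" .
      have 2: "s * (s * p) + - ((1 - s * s) * ((2 * m + 1) * p)) = (2 * m + 2) * (s * (s * p)) - (2 * m + 1) * p"
        for s p m :: real by (simp add: algebra_simps)
      show ?thesis unfolding 1 using 2[of "sin x" "(sin x) ^ (2 * n)" "real n"] by (simp add: add.commute)
    qed
    ultimately show "(?F has_vector_derivative (2 * real n + 2) * (sin x) ^ (2 * Suc n) - (2 * real n + 1) * (sin x) ^ (2 * n)) (at x within {0..pi/2})"
      by (auto simp: has_real_derivative_iff_has_vector_derivative intro: has_vector_derivative_at_within)
  qed simp
  then have "((\<lambda>\<theta>. (2 * real n + 2) * (sin \<theta>) ^ (2 * Suc n) - (2 * real n + 1) * (sin \<theta>) ^ (2 * n)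
      + (2 * real n + 1) * (sin \<theta>) ^ (2 * n)) has_integral 0 + (2 * real n + 1) * (pi / 2 * half_binom n)) {0..pi/2}"
    by (intro has_integral_add has_integral_mult_right Suc) simp
  then have "((\<lambda>\<theta>. (1 / (2 * real n + 2)) * ((2 * real n + 2) * (sin \<theta>) ^ (2 * Suc n)))
      has_integral (1 / (2 * real n + 2)) * ((2 * real n + 1) * (pi / 2 * half_binom n))) {0..pi/2}"
    by (intro has_integral_mult_right) simp
  then show ?case by (simp add: half_binom_Suc mult_ac add_pos_nonneg)
qed

lemma inverse_csqrt_sums:
  assumes "norm z < 1"
  shows "(\<lambda>n. of_real (half_binom n) * z ^ n) sums (1 / csqrt (1 - z))"
proof -
  have "(\<lambda>n. ((-1/2) gchoose n) * (-z) ^ n) sums (1 + - z) powr (-1/2)"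
    using assms by (intro gen_binomial_complex) simp
  moreover have "((-1/2) gchoose n) * (-z) ^ n = of_real (half_binom n) * z ^ n" for n
  proof -
    have "((-1/2 :: complex) gchoose n) = (-1) ^ n * of_real (half_binom n)"
      by (simp add: gbinomial_pochhammer half_binom_def pochhammer_of_real[symmetric])
    then show ?thesis unfolding power_minus[of z] by simp
  qed
  moreover have "(1 + - z) powr (-1/2) = 1 / csqrt (1 - z)"
    using powr_minus[of "1 - z" "1/2"] by (simp add: csqrt_conv_powr inverse_eq_divide)
  ultimately show ?thesis by simp
qed

text \<open>Binomial series under the integral sign; its coefficients are at most 1, so the convergence is
  uniform in the angle.\<close>

lemma ellint_sums:
  assumes z: "norm z < 1"
  shows "(\<lambda>n. of_real ((half_binom n)\<^sup>2) * z ^ n) sums ellint z"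
proof -
  let ?f = "\<lambda>n \<theta>. of_real (half_binom n) * (z * of_real ((sin \<theta>)\<^sup>2)) ^ n"
  have unif: "uniform_limit {0..pi/2} (\<lambda>N \<theta>. \<Sum>n<N. ?f n \<theta>) (ellker z) sequentially"
  proof -
    have bd: "norm (?f n \<theta>) \<le> norm z ^ n" for n \<theta>
    proof -
      have "norm (?f n \<theta>) = half_binom n * (norm z ^ n * ((sin \<theta>)\<^sup>2) ^ n)"
        using half_binom_bounds(1)[of n] by (simp add: norm_mult norm_power power_mult_distrib)
      also have "\<dots> \<le> 1 * (norm z ^ n * 1)"
        using half_binom_bounds[of n] by (intro mult_mono power_le_one sin_square_bounds) auto
      finally show ?thesis by simp
    qed
    have "uniform_limit {0..pi/2} (\<lambda>N \<theta>. \<Sum>n<N. ?f n \<theta>) (\<lambda>\<theta>. suminf (\<lambda>n. ?f n \<theta>)) sequentially"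
      by (rule Weierstrass_m_test[OF bd]) (use z in \<open>auto intro: summable_geometric\<close>)
    moreover have "suminf (\<lambda>n. ?f n \<theta>) = ellker z \<theta>" for \<theta>
    proof -
      have "norm (z * of_real ((sin \<theta>)\<^sup>2)) \<le> norm z * 1"
        using sin_square_bounds[of \<theta>] by (subst norm_mult, intro mult_left_mono) (auto simp: norm_power)
      then show ?thesis
        using z by (intro sums_unique[symmetric] inverse_csqrt_sums) auto
    qed
    ultimately show ?thesis by simp
  qed
  have fint: "(?f n has_integral of_real (half_binom n) * z ^ n * of_real (pi / 2 * half_binom n)) {0..pi/2}" for n
  proof -
    have "((\<lambda>\<theta>. of_real (half_binom n) * z ^ n * of_real ((sin \<theta>) ^ (2 * n))) has_integral
        of_real (half_binom n) * z ^ n * of_real (pi / 2 * half_binom n)) {0..pi/2}"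
      by (intro has_integral_mult_right has_integral_of_real integral_sin_power)
    moreover have "of_real (half_binom n) * z ^ n * of_real ((sin \<theta>) ^ (2 * n)) = ?f n \<theta>" for \<theta>
      by (simp add: power_mult_distrib power_mult)
    ultimately show ?thesis by (simp only:)
  qed
  obtain I J where IJ: "\<And>N. ((\<lambda>\<theta>. \<Sum>n<N. ?f n \<theta>) has_integral I N) {0..pi/2}"
      "((ellker z) has_integral J) {0..pi/2}" "I \<longlonglongrightarrow> J"
    by (rule uniform_limit_integral[OF unif]) (auto intro!: continuous_intros)
  have "(\<lambda>N. integral {0..pi/2} (\<lambda>\<theta>. \<Sum>n<N. ?f n \<theta>)) \<longlonglongrightarrow> integral {0..pi/2} (ellker z)"
    unfolding integral_unique[OF IJ(1)] integral_unique[OF IJ(2)] by (rule IJ(3))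
  then have "(\<lambda>n. integral {0..pi/2} (?f n)) sums integral {0..pi/2} (ellker z)"
    unfolding sums_def using fint by (subst (asm) integral_sum) (auto simp: integrable_on_def)
  then have "(\<lambda>n. 2 / of_real pi * integral {0..pi/2} (?f n)) sums ellint z"
    unfolding ellint_def by (rule sums_mult)
  moreover have "2 / of_real pi * integral {0..pi/2} (?f n) = of_real ((half_binom n)\<^sup>2) * z ^ n" for n
    unfolding integral_unique[OF fint] by (simp add: power2_eq_square)
  ultimately show ?thesis by simp
qed

lemma half_binom_Gamma: "(Gamma (real n + 1/2))\<^sup>2 / (fact n)\<^sup>2 = pi * (half_binom n)\<^sup>2"
proof -
  have "pochhammer (1/2 :: real) n = Gamma (1/2 + real n) / Gamma (1/2)"
  proof (rule pochhammer_Gamma)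
    show "(1/2 :: real) \<notin> \<int>\<^sub>\<le>\<^sub>0"
    proof
      assume "(1/2 :: real) \<in> \<int>\<^sub>\<le>\<^sub>0"
      then obtain n :: int where "n \<le> 0" "1/2 = real_of_int n" by (elim nonpos_Ints_cases) auto
      then have "1/2 \<le> (0 :: real)" by (metis of_int_le_0_iff)
      then show False by simp
    qed
  qed
  then have "Gamma (real n + 1/2) = pochhammer (1/2) n * sqrt pi"
    by (simp add: Gamma_one_half_real add.commute)
  then show ?thesis by (simp add: half_binom_def power_mult_distrib power_divide)
qed

lemma ellint_eq_hyp_series:
  assumes z: "norm z < 1"
  shows "ellint z = hyp_series z"
proof -
  have "(\<lambda>k. of_real ((half_binom (Suc k))\<^sup>2) * z ^ Suc k) sums (ellint z - 1)"
    using ellint_sums[OF z] by (subst sums_Suc_iff) simp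
  then have "(\<lambda>k. of_real pi * (of_real ((half_binom (Suc k))\<^sup>2) * z ^ Suc k)) sums (of_real pi * (ellint z - 1))"
    by (rule sums_mult)
  moreover have "of_real pi * (of_real ((half_binom (Suc k))\<^sup>2) * z ^ Suc k)
      = of_real ((Gamma (real (Suc k) + 1/2))\<^sup>2 / (fact (Suc k))\<^sup>2) * z ^ Suc k" for k
    unfolding half_binom_Gamma by simp
  ultimately have "(\<lambda>k. of_real ((Gamma (real (Suc k) + 1/2))\<^sup>2 / (fact (Suc k))\<^sup>2) * z ^ Suc k) sums (of_real pi * (ellint z - 1))"
    by (simp only:)
  from sums_unique[OF this] show ?thesis
    unfolding hyp_series_def by (metis (no_types) add_diff_cancel_left' nonzero_mult_div_cancel_left of_real_eq_0_iff pi_neq_zero times_divide_eq_left mult_1 diff_add_cancel add.commute)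
qed

text \<open>The elliptic integral witnesses the existence of the continuation, and the identity theorem makes
  the choice in the definition of \<open>hypF\<close> irrelevant on the slit plane.\<close>

lemma hypF_eq_ellint:
  assumes "z \<in> slit_plane"
  shows "hypF z = ellint z"
proof -
  have "\<exists>f. f holomorphic_on slit_plane \<and> (\<forall>z\<in>ball 0 1. f z = hyp_series z)"
    using ellint_holomorphic ellint_eq_hyp_series by (intro exI[of _ ellint]) auto
  from someI_ex[OF this] have h: "hypF holomorphic_on slit_plane" "\<And>z. z \<in> ball 0 1 \<Longrightarrow> hypF z = hyp_series z"
    unfolding hypF_def by auto
  show ?thesis
  proof (rule analytic_continuation_open[of "ball 0 1" slit_plane hypF ellint])
    show "ball 0 1 \<noteq> ({} :: complex set)" by simp
    show "hypF w = ellint w" if "w \<in> ball 0 1" for w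
      using h(2)[OF that] ellint_eq_hyp_series[of w] that by simp
  qed (fact open_ball open_slit_plane connected_slit_plane ball_subset_slit_plane h(1) ellint_holomorphic assms)+
qed

lemma hypF_holomorphic: "hypF holomorphic_on slit_plane"
  by (rule holomorphic_transform[OF ellint_holomorphic]) (simp add: hypF_eq_ellint)

lemma hypF_sums: "norm z < 1 \<Longrightarrow> (\<lambda>n. of_real ((half_binom n)\<^sup>2) * z ^ n) sums hypF z"
  using ellint_sums[of z] hypF_eq_ellint[of z] ball_subset_slit_plane by (auto simp: subset_iff)

lemma hypF_0 [simp]: "hypF 0 = 1"
  using sums_unique2[OF hypF_sums[of 0] powser_sums_zero[of "\<lambda>n. of_real ((half_binom n)\<^sup>2) :: complex"]]
  by simp

lemma hypF_cnj:
  assumes "z \<in> slit_plane"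
  shows "hypF (cnj z) = cnj (hypF z)"
proof -
  have z': "cnj z \<in> slit_plane" using assms by (simp add: slit_plane_iff)
  have "cnj (integral {0..pi/2} (ellker z))
      = integral {0..pi/2} (\<lambda>\<theta>. cnj (ellker z \<theta>))"
    using integral_linear[OF ellint_integrable[OF assms] bounded_linear_cnj] by (simp add: o_def)
  also have "\<dots> = integral {0..pi/2} (ellker (cnj z))"
  proof (rule integral_cong)
    fix \<theta> :: real
    show "cnj (ellker z \<theta>) = ellker (cnj z) \<theta>"
      using cnj_csqrt[OF radicand_not_nonpos[OF assms sin_square_bounds[of \<theta>]]] by simp
  qed
  finally show ?thesis
    using hypF_eq_ellint[OF assms] hypF_eq_ellint[OF z'] by (simp add: ellint_def)
qed

section \<open>Positivity\<close>

text \<open>Positivity passes through an integral against a fixed complex factor. Applied in each of two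
  variables in turn, it gives positivity of a product of two integrals.\<close>

lemma integral_Re_mult_pos:
  fixes f :: "real \<Rightarrow> complex"
  assumes f: "continuous_on {a..b} f" and ab: "a < b"
    and pos: "\<And>x. x \<in> {a..b} \<Longrightarrow> Re (f x * c) > 0"
  shows "Re (integral {a..b} f * c) > 0"
proof -
  have cont: "continuous_on {a..b} (\<lambda>x. Re (f x * c))" by (intro continuous_intros f)
  obtain x0 where x0: "x0 \<in> {a..b}" "\<And>x. x \<in> {a..b} \<Longrightarrow> Re (f x0 * c) \<le> Re (f x * c)"
    using continuous_attains_inf[of "{a..b}" "\<lambda>x. Re (f x * c)"] cont ab by auto
  have fi: "(f has_integral integral {a..b} f) {a..b}"
    using integrable_continuous_real[OF f] by (rule integrable_integral)
  have "((\<lambda>x. Re (f x * c)) has_integral Re (integral {a..b} f * c)) {a..b}"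
    using has_integral_Re[OF has_integral_mult_left[OF fi]] by simp
  moreover have "((\<lambda>x. Re (f x0 * c)) has_integral (b - a) *\<^sub>R Re (f x0 * c)) {a..b}"
    using has_integral_const_real[of "Re (f x0 * c)" a b] ab by simp
  ultimately have "(b - a) *\<^sub>R Re (f x0 * c) \<le> Re (integral {a..b} f * c)"
    using x0(2) has_integral_le by blast
  moreover have "0 < (b - a) *\<^sub>R Re (f x0 * c)" using pos[OF x0(1)] ab by simp
  ultimately show ?thesis by linarith
qed

lemma hypF_integral: "z \<in> slit_plane \<Longrightarrow> hypF z = of_real (2 / pi) * integral {0..pi/2} (ellker z)"
  by (simp add: hypF_eq_ellint ellint_def)

lemma continuous_on_ellker:
  assumes "z \<in> slit_plane"
  shows "continuous_on A (ellker z)"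
proof -
  have "continuous_on A (\<lambda>\<theta>. case (z, \<theta>) of (z, \<theta>) \<Rightarrow> ellker z \<theta>)"
    by (rule continuous_on_compose2[OF continuous_on_ellint_integrand]) (use assms in \<open>auto intro!: continuous_intros\<close>)
  then show ?thesis by simp
qed

lemma Re_csqrt_pos:
  assumes "z \<notin> \<real>\<^sub>\<le>\<^sub>0"
  shows "Re (csqrt z) > 0"
proof (rule ccontr)
  assume "\<not> Re (csqrt z) > 0"
  then have 0: "Re (csqrt z) = 0" using csqrt_principal[of z] by blast
  define c where "c = csqrt z"
  have c: "c\<^sup>2 = z" "Re c = 0" using 0 by (simp_all only: c_def power2_csqrt)
  then have "z = - of_real ((Im c)\<^sup>2)" by (auto simp: complex_eq_iff power2_eq_square)
  then have "Re z \<le> 0" "Im z = 0" by simp_all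
  then show False using assms by (simp add: complex_nonpos_Reals_iff)
qed

lemma Re_times_of_real: "Re (x * of_real c) = Re x * c"
  by simp

lemma Re_mult_cnj_swap: "Re (x * cnj y) = Re (y * cnj x)"
  by simp

lemma Re_inverse_pos: "Re z > 0 \<Longrightarrow> Re (1 / z) > 0"
  by (auto simp: Re_divide intro!: divide_pos_pos add_pos_nonneg)

lemma Re_hypF_pos:
  assumes z: "z \<in> slit_plane"
  shows "Re (hypF z) > 0"
proof -
  have "Re (integral {0..pi/2} (ellker z) * of_real (2 / pi)) > 0"
  proof (rule integral_Re_mult_pos[OF continuous_on_ellker[OF z]])
    fix \<theta> :: real
    have "Re (ellker z \<theta>) > 0"
      by (intro Re_inverse_pos Re_csqrt_pos radicand_not_nonpos[OF z] sin_square_bounds)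
    then show "Re (ellker z \<theta> * of_real (2 / pi)) > 0"
      unfolding Re_times_of_real by (intro mult_pos_pos) auto
  qed simp
  then show ?thesis using hypF_integral[OF z] by (simp add: mult.commute)
qed

lemma hypF_nonzero: "z \<in> slit_plane \<Longrightarrow> hypF z \<noteq> 0"
  using Re_hypF_pos[of z] by auto

definition double_slit :: "complex set" where
  "double_slit = {z. Im z \<noteq> 0 \<or> (0 < Re z \<and> Re z < 1)}"

lemma double_slitD: "z \<in> double_slit \<Longrightarrow> z \<in> slit_plane" "z \<in> double_slit \<Longrightarrow> 1 - z \<in> slit_plane"
  "z \<in> double_slit \<Longrightarrow> 1 - z \<in> double_slit" "z \<in> double_slit \<Longrightarrow> z \<noteq> 0" "z \<in> double_slit \<Longrightarrow> z \<noteq> 1"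
  "z \<in> double_slit \<Longrightarrow> z \<notin> \<real>\<^sub>\<le>\<^sub>0"
  by (auto simp: double_slit_def slit_plane_iff complex_nonpos_Reals_iff)

text \<open>The radicands are \<open>A = (1 - s) + s z\<close> and \<open>B = (1 - r) + r (1 - z)\<close>, points on the segments from 1 to \<open>z\<close>
  and from 1 to \<open>1 - z\<close>. The angles of the triangle \<open>0, 1, z\<close> at 0 and at 1 have sum less than \<open>\<pi>\<close>, so
  \<open>arg A - arg B\<close> lies in \<open>[0, \<pi>)\<close> and half of it in \<open>[0, \<pi>/2)\<close>. Without arguments: \<open>P = \<surd>A cnj (\<surd>B)\<close> has
  nonnegative imaginary part, and so has \<open>P\<^sup>2\<close>.\<close>

lemma Re_ellker_mult_pos:
  assumes z: "z \<in> double_slit" and y: "Im z \<ge> 0"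
  shows "Re (ellker (1 - z) \<theta> * cnj (ellker z \<phi>)) > 0"
proof -
  define s r where "s = (sin \<theta>)\<^sup>2" and "r = (sin \<phi>)\<^sup>2"
  have s: "0 \<le> s" "s \<le> 1" and r: "0 \<le> r" "r \<le> 1"
    unfolding s_def r_def by (rule sin_square_bounds)+
  define A where "A = 1 - (1 - z) * of_real s"
  define B where "B = 1 - z * of_real r"
  define a where "a = csqrt A"
  define b where "b = csqrt B"
  have An: "A \<notin> \<real>\<^sub>\<le>\<^sub>0" and Bn: "B \<notin> \<real>\<^sub>\<le>\<^sub>0"
    unfolding A_def B_def using radicand_not_nonpos double_slitD[OF z] s r by blast+
  have apos: "Re a > 0" and bpos: "Re b > 0"
    unfolding a_def b_def by (rule Re_csqrt_pos[OF An], rule Re_csqrt_pos[OF Bn])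
  have a2: "a\<^sup>2 = A" and b2: "b\<^sup>2 = B" by (simp_all add: a_def b_def)
  have ImA: "2 * Re a * Im a = Im z * s"
    using arg_cong[OF a2, of Im] by (simp add: A_def power2_eq_square algebra_simps)
  then have "Im a \<ge> 0"
  proof -
    have "2 * Re a * Im a \<ge> 0" using ImA y s by simp
    then show ?thesis using apos by (simp add: zero_le_mult_iff)
  qed
  have ImB: "2 * Re b * Im b = - (Im z * r)"
    using arg_cong[OF b2, of Im] by (simp add: B_def power2_eq_square algebra_simps)
  have "Im b \<le> 0"
  proof (rule ccontr)
    assume "\<not> Im b \<le> 0"
    then have "2 * Re b * Im b > 0" using bpos by simp
    moreover have "Im z * r \<ge> 0" using y r by simp
    ultimately show False using ImB by linarith
  qed
  define P where "P = a * cnj b"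
  have ImP: "Im P \<ge> 0"
  proof -
    have "Im P = Im a * Re b + Re a * (- Im b)" by (simp add: P_def)
    moreover have "Im a * Re b \<ge> 0" "Re a * (- Im b) \<ge> 0"
      using \<open>Im a \<ge> 0\<close> \<open>Im b \<le> 0\<close> apos bpos by (auto intro: mult_nonneg_nonneg mult_nonneg_nonpos)
    ultimately show ?thesis by linarith
  qed
  have "P\<^sup>2 = a\<^sup>2 * cnj (b\<^sup>2)" by (simp only: P_def power_mult_distrib complex_cnj_power)
  then have "P\<^sup>2 = A * cnj B" unfolding a2 b2 .
  then have "2 * Re P * Im P = Im (A * cnj B)"
    using Im_power2[of P] by (simp only:)
  also have "\<dots> = Im z * (s + r * (1 - s))"
    by (simp add: A_def B_def algebra_simps)
  finally have PP: "2 * Re P * Im P = Im z * (s + r * (1 - s))" .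
  have RP: "Re P > 0"
  proof (cases "Im z * (s + r * (1 - s)) = 0")
    case False
    then have "Im z * (s + r * (1 - s)) > 0"
    proof -
      have "Im z * (s + r * (1 - s)) \<ge> 0" using y s r by (intro mult_nonneg_nonneg add_nonneg_nonneg) auto
      then show ?thesis using False by linarith
    qed
    then have "Re P * Im P > 0" using PP by linarith
    then show ?thesis using ImP by (auto simp: zero_less_mult_iff)
  next
    case True
    then have "Im z * s = 0 \<and> Im z * r = 0"
    proof (cases "Im z = 0")
      case False
      then have 1: "s + r * (1 - s) = 0" using True by simp
      moreover have "r * (1 - s) \<ge> 0" using s r by simp
      ultimately have "s = 0" using s by linarith
      then show ?thesis using 1 by simp
    qed simp
    then have "Im a = 0" "Im b = 0" using ImA ImB apos bpos by auto
    then show ?thesis using apos bpos by (simp add: P_def)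
  qed
  have "ellker (1 - z) \<theta> * cnj (ellker z \<phi>) = 1 / (a * cnj b)"
    by (simp only: a_def b_def A_def B_def s_def r_def complex_cnj_divide complex_cnj_one times_divide_times_eq mult_1_left)
  then show ?thesis using Re_inverse_pos[OF RP] by (simp only: P_def)
qed

text \<open>The product is a double integral of a kernel with positive real part; conjugation carries the
  upper half-plane to the lower one. Dividing by \<open>|F(z)|\<^sup>2\<close>, this says that \<open>exp (-\<pi> F(1 - z) / F(z))\<close> has
  modulus less than 1.\<close>

lemma Re_hypF_mult_pos:
  assumes z: "z \<in> double_slit"
  shows "Re (hypF (1 - z) * cnj (hypF z)) > 0"
proof -
  have *: "Re (hypF (1 - z) * cnj (hypF z)) > 0" if z: "z \<in> double_slit" and y: "Im z \<ge> 0" for z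
  proof -
    note s = double_slitD(1,2)[OF z]
    let ?I = "integral {0..pi/2} (ellker (1 - z))" and ?J = "integral {0..pi/2} (ellker z)"
    have "Re (?J * cnj ?I) > 0"
    proof (rule integral_Re_mult_pos[OF continuous_on_ellker[OF s(1)]])
      fix \<phi> :: real
      have "Re (?I * cnj (ellker z \<phi>)) > 0"
        by (rule integral_Re_mult_pos[OF continuous_on_ellker[OF s(2)]])
          (use Re_ellker_mult_pos[OF z y] in auto)
      then show "Re (ellker z \<phi> * cnj ?I) > 0"
        by (subst Re_mult_cnj_swap)
    qed simp
    then have 1: "Re (?I * cnj ?J) > 0"
      by (subst Re_mult_cnj_swap)
    have "hypF (1 - z) * cnj (hypF z) = of_real ((2 / pi)\<^sup>2) * (?I * cnj ?J)"
      unfolding hypF_integral[OF s(1)] hypF_integral[OF s(2)]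
      by (simp only: complex_cnj_mult complex_cnj_complex_of_real power2_eq_square of_real_mult mult_ac)
    then have "Re (hypF (1 - z) * cnj (hypF z)) = Re (?I * cnj ?J) * (2 / pi)\<^sup>2"
      by (simp only: mult.commute[of "of_real _"] Re_times_of_real)
    then show ?thesis using mult_pos_pos[OF 1, of "(2 / pi)\<^sup>2"] by simp
  qed
  show ?thesis
  proof (cases "Im z \<ge> 0")
    case True then show ?thesis using * z by blast
  next
    case False
    then have "Re (hypF (1 - cnj z) * cnj (hypF (cnj z))) > 0"
      using z by (intro *) (auto simp: double_slit_def)
    moreover have "hypF (1 - cnj z) = cnj (hypF (1 - z))" "hypF (cnj z) = cnj (hypF z)"
      using hypF_cnj[of z] hypF_cnj[of "1 - z"] double_slitD[OF z] by auto
    ultimately show ?thesis by simp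
  qed
qed

lemma Re_hypF_quotient_pos:
  assumes z: "z \<in> double_slit"
  shows "Re (hypF (1 - z) / hypF z) > 0"
proof -
  have "hypF z \<noteq> 0" using hypF_nonzero double_slitD z by blast
  then have "Re (hypF (1 - z) / hypF z) = Re (hypF (1 - z) * cnj (hypF z)) / (cmod (hypF z))\<^sup>2"
    by (subst complex_div_cnj) (simp only: Re_divide_of_real flip: of_real_power)
  then show ?thesis using Re_hypF_mult_pos[OF z] \<open>hypF z \<noteq> 0\<close> by simp
qed

section \<open>The hypergeometric equation and the Wronskian\<close>

lemma hypF_has_fps_expansion: "hypF has_fps_expansion Abs_fps (\<lambda>n. of_real ((half_binom n)\<^sup>2))"
proof (rule has_fps_expansionI)
  have "eventually (\<lambda>z::complex. z \<in> ball 0 1) (nhds 0)"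
    by (rule eventually_nhds_in_open) auto
  then show "eventually (\<lambda>u. (\<lambda>n. fps_nth (Abs_fps (\<lambda>n. of_real ((half_binom n)\<^sup>2))) n * u ^ n) sums hypF u) (nhds 0)"
    by eventually_elim (use hypF_sums in auto)
qed

lemma half_binom_square_recurrence:
  "(real n + 1)\<^sup>2 * (half_binom (Suc n))\<^sup>2 = (real n + 1/2)\<^sup>2 * (half_binom n)\<^sup>2"
proof -
  have "(real n + 1) * half_binom (Suc n) = (real n + 1/2) * half_binom n"
    by (simp add: half_binom_Suc field_simps)
  then show ?thesis by (metis power_mult_distrib)
qed

text \<open>In terms of this function the hypergeometric equation reads \<open>hypF_flux' = F/4\<close>.\<close>

definition hypF_flux :: "complex \<Rightarrow> complex" where
  "hypF_flux z = z * (1 - z) * deriv hypF z"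

lemma hypF_deriv: "z \<in> slit_plane \<Longrightarrow> (hypF has_field_derivative deriv hypF z) (at z)"
  using holomorphic_derivI[OF hypF_holomorphic open_slit_plane] by blast

lemma hypF_flux_holomorphic: "hypF_flux holomorphic_on slit_plane"
  unfolding hypF_flux_def[abs_def]
  by (intro holomorphic_intros holomorphic_deriv hypF_holomorphic open_slit_plane)

text \<open>The hypergeometric equation in divergence form. It holds for the coefficients of the power series
  at 0, and extends by the identity theorem.\<close>

lemma hypF_flux_deriv:
  assumes z: "z \<in> slit_plane"
  shows "(hypF_flux has_field_derivative hypF z / 4) (at z)"
proof -
  let ?A = "Abs_fps (\<lambda>n. of_real ((half_binom n)\<^sup>2)) :: complex fps"
  have "(\<lambda>z. deriv hypF_flux z - 1/4 * hypF z) has_fps_expansion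
      (fps_deriv (fps_X * (1 - fps_X) * fps_deriv ?A) - fps_const (1/4) * ?A)"
    unfolding hypF_flux_def[abs_def] by (intro fps_expansion_intros hypF_has_fps_expansion)
  moreover have "fps_deriv (fps_X * (1 - fps_X) * fps_deriv ?A) - fps_const (1/4) * ?A = 0"
  proof (rule fps_ext)
    fix n
    have rec: "of_nat (Suc n) * of_nat (Suc n) * of_real ((half_binom (Suc n))\<^sup>2)
        = (of_nat n + 1/2) * (of_nat n + 1/2) * (of_real ((half_binom n)\<^sup>2) :: complex)"
      using arg_cong[OF half_binom_square_recurrence[of n], of complex_of_real]
      by (simp add: power2_eq_square add.commute)
    have d: "fps_nth (fps_deriv (fps_X * (1 - fps_X) * fps_deriv ?A)) n
        = of_nat (Suc n) * (of_nat (Suc n) * of_real ((half_binom (Suc n))\<^sup>2) - of_nat n * of_real ((half_binom n)\<^sup>2))"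
    proof -
      have e: "fps_X * (1 - fps_X) * fps_deriv ?A = fps_X * (fps_deriv ?A - fps_X * fps_deriv ?A)"
        by (simp add: algebra_simps)
      have "fps_nth (fps_deriv ?A - fps_X * fps_deriv ?A) n
          = of_nat (Suc n) * of_real ((half_binom (Suc n))\<^sup>2) - of_nat n * of_real ((half_binom n)\<^sup>2)"
        by (cases n) simp_all
      moreover have "fps_nth (fps_deriv (fps_X * h)) n = of_nat (Suc n) * fps_nth h n" for h :: "complex fps"
        by (simp add: algebra_simps)
      ultimately show ?thesis unfolding e by (simp only:)
    qed
    have d': "fps_nth (fps_const (1/4) * ?A) n = 1/4 * of_real ((half_binom n)\<^sup>2)" by simp
    have alg: "m * (m * x - k * y) - 1/4 * y = 0" if "m * m * x = (k + 1/2) * (k + 1/2) * y" "m = k + 1"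
      for m k x y :: complex
      using that by (simp add: algebra_simps)
    show "fps_nth (fps_deriv (fps_X * (1 - fps_X) * fps_deriv ?A) - fps_const (1/4) * ?A) n = fps_nth 0 n"
      unfolding fps_sub_nth d d' fps_zero_nth by (rule alg[OF rec]) simp
  qed
  ultimately have "(\<lambda>z. deriv hypF_flux z - 1/4 * hypF z) has_fps_expansion 0" by simp
  then have "deriv hypF_flux z - 1/4 * hypF z = 0"
    by (rule has_fps_expansion_0_analytic_continuation[OF _ _ open_slit_plane connected_slit_plane zero_in_slit_plane z])
      (intro holomorphic_intros holomorphic_deriv hypF_flux_holomorphic hypF_holomorphic open_slit_plane)
  then have "deriv hypF_flux z = hypF z / 4" by simp
  then show ?thesis
    using holomorphic_derivI[OF hypF_flux_holomorphic open_slit_plane z, of UNIV] by (simp only:)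
qed

lemma open_double_slit: "open double_slit"
proof -
  have "double_slit = slit_plane \<inter> (\<lambda>z. 1 - z) -` slit_plane"
    by (auto simp: double_slit_def slit_plane_iff)
  then show ?thesis
    using open_Int[OF open_slit_plane open_vimage[OF open_slit_plane, of "\<lambda>z. 1 - z"]]
    by (simp add: continuous_intros)
qed

lemma connected_double_slit: "connected double_slit"
proof (rule starlike_imp_connected)
  show "starlike double_slit"
    unfolding starlike_def
  proof (intro bexI ballI subsetI)
    show "1/2 \<in> double_slit" by (simp add: double_slit_def)
    fix z x assume z: "z \<in> double_slit" and "x \<in> closed_segment (1/2) z"
    then obtain u where u: "0 \<le> u" "u \<le> 1" "x = (1 - u) *\<^sub>R (1/2) + u *\<^sub>R z" by (auto simp: in_segment)
    show "x \<in> double_slit"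
    proof (cases "u = 0 \<or> Im z = 0")
      case False
      then show ?thesis by (simp add: u double_slit_def)
    next
      case True
      have "0 < (1 - u) * (1/2) + u * Re z \<and> (1 - u) * (1/2) + u * Re z < 1" if "0 < Re z" "Re z < 1"
      proof (cases "u = 0")
        case False
        then have "0 < u * Re z" "u * Re z < u * 1" using that u by (auto intro!: mult_pos_pos mult_strict_left_mono)
        moreover have "0 < (1 - u) * (1/2) + v \<and> (1 - u) * (1/2) + v < 1" if "0 < v" "v < u" for v
          using that u(2) by (auto simp: field_simps)
        ultimately show ?thesis by simp
      qed auto
      then show ?thesis using True z u by (auto simp: double_slit_def)
    qed
  qed
qed

text \<open>This is \<open>z (1 - z)\<close> times the Wronskian of the solutions \<open>F(1 - z)\<close> and \<open>F(z)\<close>.\<close>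

definition wronskian :: "complex \<Rightarrow> complex" where
  "wronskian z = hypF z * hypF_flux (1 - z) + hypF_flux z * hypF (1 - z)"

lemma hypF_reflect_deriv:
  assumes "1 - z \<in> slit_plane"
  shows "((\<lambda>z. hypF (1 - z)) has_field_derivative - deriv hypF (1 - z)) (at z)"
  by (rule DERIV_cong[OF DERIV_chain2[where f = hypF and g = "\<lambda>z. 1 - z" and x = z and Db = "-1", OF hypF_deriv[OF assms]]])
    (auto intro!: derivative_eq_intros)

text \<open>With the equation in divergence form the terms with \<open>F(z) F(1 - z)\<close> and those with
  \<open>F'(z) F'(1 - z)\<close> cancel separately.\<close>

lemma wronskian_constant: "\<exists>c. \<forall>z\<in>double_slit. wronskian z = c"
proof -
  have "wronskian constant_on double_slit"
  proof (rule has_field_derivative_0_imp_constant_on[OF _ connected_double_slit open_double_slit])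
    fix z assume z: "z \<in> double_slit"
    note s = double_slitD(1,2)[OF z]
    have "((\<lambda>z. hypF_flux (1 - z)) has_field_derivative - (hypF (1 - z) / 4)) (at z)"
      by (rule DERIV_cong[OF DERIV_chain2[where f = hypF_flux and g = "\<lambda>z. 1 - z" and x = z and Db = "-1",
            OF hypF_flux_deriv[OF s(2)]]]) (auto intro!: derivative_eq_intros)
    from DERIV_add[OF DERIV_mult[OF hypF_deriv[OF s(1)] this]
        DERIV_mult[OF hypF_flux_deriv[OF s(1)] hypF_reflect_deriv[OF s(2)]]]
    show "(wronskian has_field_derivative 0) (at z)"
      unfolding wronskian_def[abs_def] by (rule DERIV_cong) (simp add: hypF_flux_def algebra_simps)
  qed
  then show ?thesis by (auto simp: constant_on_def)
qed

text \<open>An Abelian theorem: \<open>(1 - x) \<Sum> a\<^sub>n x\<^sup>n\<close> is a weighted mean of the \<open>a\<^sub>n\<close> whose weights escape to infinity as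
  \<open>x\<close> tends to 1.\<close>

lemma abel_mean:
  fixes a :: "nat \<Rightarrow> complex"
  assumes lim: "a \<longlonglongrightarrow> L" and s_sums: "\<And>x::real. 0 < x \<Longrightarrow> x < 1 \<Longrightarrow> (\<lambda>n. a n * of_real x ^ n) sums s x"
  shows "((\<lambda>x. of_real (1 - x) * s x) \<longlongrightarrow> L) (at_left 1)"
proof (rule tendstoI)
  fix e :: real assume e: "e > 0"
  have "(\<lambda>n. a n - L) \<longlonglongrightarrow> 0" using lim by (simp add: LIM_zero)
  then obtain B where B: "B > 0" "\<And>n. norm (a n - L) \<le> B"
    using convergent_imp_Bseq[of "\<lambda>n. a n - L"] by (auto simp: convergent_def Bseq_def)
  obtain N where N: "\<And>n. n \<ge> N \<Longrightarrow> norm (a n - L) < e / 2"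
    using lim e by (metis LIMSEQ_iff half_gt_zero)
  \<comment> \<open>The first \<open>N\<close> terms contribute at most \<open>(1 - x) N B\<close>; adding 1 keeps the denominator positive if \<open>N = 0\<close>.\<close>
  define d where "d = min 1 (e / (2 * (real N * B + 1)))"
  have NB: "real N * B + 1 > 0" using B by (simp add: add_nonneg_pos)
  have d: "d > 0" "d \<le> 1" "d * (real N * B) < e / 2"
  proof -
    show d0: "d > 0" "d \<le> 1" using e NB by (auto simp: d_def)
    have "d * (real N * B) < d * (real N * B + 1)" using d0 by simp
    also have "\<dots> \<le> (e / (2 * (real N * B + 1))) * (real N * B + 1)"
      using NB by (intro mult_right_mono) (auto simp: d_def)
    also have "\<dots> = e / 2" using NB by (simp add: field_simps)
    finally show "d * (real N * B) < e / 2" .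
  qed
  have "dist (of_real (1 - x) * s x) L < e" if x: "1 - d < x" "x < 1" for x
  proof -
    have x01: "0 < x" "x < 1" using x d by auto
    have geo: "(\<lambda>n. x ^ n) sums (1 / (1 - x))" using x01 by (intro geometric_sums) auto
    have geoC: "(\<lambda>n. of_real x ^ n :: complex) sums (1 / (1 - of_real x))"
      using x01 by (intro geometric_sums) auto
    have s1: "(\<lambda>n. (a n - L) * of_real x ^ n) sums (s x - L * (1 / (1 - of_real x)))"
      using sums_diff[OF s_sums[OF x01] sums_mult[OF geoC, of L]] by (simp add: left_diff_distrib)
    have fin: "(\<lambda>n. if n \<in> {..<N} then B else 0) sums (\<Sum>n\<in>{..<N}. B)"
      by (rule sums_If_finite_set) auto
    have s2: "(\<lambda>n. (if n \<in> {..<N} then B else 0) + e / 2 * x ^ n) sums (real N * B + e / 2 * (1 / (1 - x)))"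
      using sums_add[OF fin sums_mult[OF geo, of "e / 2"]] by simp
    have bd: "norm ((a n - L) * of_real x ^ n) \<le> (if n \<in> {..<N} then B else 0) + e / 2 * x ^ n" for n
    proof -
      have n: "norm ((a n - L) * of_real x ^ n) = norm (a n - L) * x ^ n"
        using x01 by (simp add: norm_mult norm_power)
      show ?thesis
      proof (cases "n < N")
        case True
        have "norm (a n - L) * x ^ n \<le> B * 1"
          using x01 B by (intro mult_mono power_le_one) auto
        moreover have "e / 2 * x ^ n \<ge> 0" using e x01 by simp
        ultimately show ?thesis using True unfolding n by simp
      next
        case False
        have "norm (a n - L) * x ^ n \<le> e / 2 * x ^ n"
          using x01 N[of n] False by (intro mult_right_mono) auto
        then show ?thesis using False unfolding n by simp
      qed
    qed
    have "norm (s x - L * (1 / (1 - of_real x))) \<le> real N * B + e / 2 * (1 / (1 - x))"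
      by (rule norm_sums_le[OF s1 s2 bd])
    then have "(1 - x) * norm (s x - L * (1 / (1 - of_real x))) \<le> (1 - x) * (real N * B + e / 2 * (1 / (1 - x)))"
      using x01 by (intro mult_left_mono) auto
    also have "\<dots> = (1 - x) * (real N * B) + e / 2" using x01 by (simp add: field_simps)
    also have "\<dots> < e"
    proof -
      have "(1 - x) * (real N * B) \<le> d * (real N * B)" using x B by (intro mult_right_mono) auto
      then show ?thesis using d by linarith
    qed
    finally have "norm (of_real (1 - x) * (s x - L * (1 / (1 - of_real x)))) < e"
      using x01 by (simp only: norm_mult norm_of_real)
    moreover have "of_real (1 - x) * (s x - L * (1 / (1 - of_real x))) = of_real (1 - x) * s x - L"
    proof -
      have "(1 - complex_of_real x) \<noteq> 0" using x01 by (metis eq_iff_diff_eq_0 of_real_eq_1_iff order_less_irrefl)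
      then show ?thesis by (simp add: right_diff_distrib)
    qed
    ultimately show ?thesis by (simp add: dist_norm)
  qed
  then show "eventually (\<lambda>x. dist (of_real (1 - x) * s x) L < e) (at_left 1)"
    unfolding eventually_at_left_field using d by (intro exI[of _ "1 - d"]) auto
qed

text \<open>Gauss' limit formula for \<open>Gamma (1/2) = \<surd>\<pi>\<close>, squared.\<close>

lemma half_binom_asymptotics: "(\<lambda>n. real (Suc n) * (half_binom (Suc n))\<^sup>2) \<longlonglongrightarrow> 1 / pi"
proof -
  have "Gamma_series (1/2 :: real) \<longlonglongrightarrow> sqrt pi"
    using Gamma_series_LIMSEQ[of "1/2 :: real"] by (simp add: Gamma_one_half_real)
  then have "(\<lambda>n. inverse ((Gamma_series (1/2 :: real) n)\<^sup>2)) \<longlonglongrightarrow> inverse ((sqrt pi)\<^sup>2)"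
    by (intro tendsto_intros) auto
  then have "(\<lambda>n. inverse ((Gamma_series (1/2 :: real) n)\<^sup>2) * (real n / real (Suc n))) \<longlonglongrightarrow> inverse ((sqrt pi)\<^sup>2) * 1"
    by (intro tendsto_mult LIMSEQ_n_over_Suc_n)
  moreover have "eventually (\<lambda>n. inverse ((Gamma_series (1/2 :: real) n)\<^sup>2) * (real n / real (Suc n)) = real (Suc n) * (half_binom (Suc n))\<^sup>2) sequentially"
    using eventually_gt_at_top[of 0]
  proof eventually_elim
    case (elim n)
    have e: "(exp (1/2 * ln (real n)))\<^sup>2 = real n"
      using elim by (simp flip: exp_double)
    have "pochhammer (1/2 :: real) (Suc n) = half_binom (Suc n) * (real (Suc n) * fact n)"
      by (simp add: half_binom_def)
    then have "inverse (Gamma_series (1/2 :: real) n) = half_binom (Suc n) * real (Suc n) / exp (1/2 * ln (real n))"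
      by (simp add: Gamma_series_def field_simps)
    then have "inverse ((Gamma_series (1/2 :: real) n)\<^sup>2) = (half_binom (Suc n))\<^sup>2 * (real (Suc n))\<^sup>2 / real n"
      by (simp only: power_inverse[symmetric] power_divide power_mult_distrib e)
    then show ?case using elim by (simp add: power2_eq_square)
  qed
  ultimately show ?thesis
    by (subst (asm) tendsto_cong) (auto simp: inverse_eq_divide)
qed

text \<open>The constant is read off as \<open>x\<close> tends to 1 from below: the Taylor coefficients of \<open>F\<close> tend to 0 and those
  of \<open>F'\<close> to \<open>1/\<pi>\<close>, so \<open>(1 - x) F(x)\<close> tends to 0 and \<open>(1 - x) F'(x)\<close> to \<open>1/\<pi>\<close>.\<close>

lemma wronskian_eq:
  assumes z: "z \<in> double_slit"
  shows "wronskian z = 1 / of_real pi"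
proof -
  obtain c where c: "\<And>z. z \<in> double_slit \<Longrightarrow> wronskian z = c" using wronskian_constant by blast
  let ?a = "\<lambda>n. complex_of_real ((half_binom n)\<^sup>2)"
  have s1: "(\<lambda>n. ?a n * of_real x ^ n) sums hypF (of_real x)" if "0 < x" "x < 1" for x
    using hypF_sums[of "of_real x"] that by simp
  have s2: "(\<lambda>n. of_real (real (Suc n) * (half_binom (Suc n))\<^sup>2) * of_real x ^ n) sums deriv hypF (of_real x)"
    if "0 < x" "x < 1" for x
  proof -
    have "(\<lambda>n. fps_nth (fps_deriv (Abs_fps ?a)) n * of_real x ^ n) sums deriv hypF (of_real x)"
    proof (rule has_fps_expansion_imp_sums_complex[where r = 1])
      show "deriv hypF has_fps_expansion fps_deriv (Abs_fps ?a)"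
        by (intro fps_expansion_intros hypF_has_fps_expansion)
      show "deriv hypF holomorphic_on eball 0 1"
        using holomorphic_on_subset[OF holomorphic_deriv[OF hypF_holomorphic open_slit_plane] ball_subset_slit_plane]
        by (simp add: one_ereal_def)
    qed (use that in auto)
    then show ?thesis by simp
  qed
  have l2: "(\<lambda>n. complex_of_real (real (Suc n) * (half_binom (Suc n))\<^sup>2)) \<longlonglongrightarrow> of_real (1 / pi)"
    by (intro tendsto_of_real half_binom_asymptotics)
  have l1: "?a \<longlonglongrightarrow> 0"
  proof -
    have "(\<lambda>n. real (Suc n) * (half_binom (Suc n))\<^sup>2 * inverse (real (Suc n))) \<longlonglongrightarrow> 1 / pi * 0"
      by (intro tendsto_mult half_binom_asymptotics LIMSEQ_inverse_real_of_nat)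
    moreover have "real (Suc n) * (half_binom (Suc n))\<^sup>2 * inverse (real (Suc n)) = (half_binom (Suc n))\<^sup>2" for n
      by (simp del: of_nat_Suc)
    ultimately have "(\<lambda>n. (half_binom (Suc n))\<^sup>2) \<longlonglongrightarrow> 0" by (simp only: mult_zero_right)
    then have "(\<lambda>n. (half_binom n)\<^sup>2) \<longlonglongrightarrow> 0" by (rule LIMSEQ_imp_Suc)
    from tendsto_of_real[OF this, where 'a = complex] show ?thesis by simp
  qed
  have t1: "((\<lambda>x. of_real (1 - x) * hypF (of_real x)) \<longlongrightarrow> 0) (at_left 1)"
    by (rule abel_mean[OF l1 s1])
  have t2: "((\<lambda>x. of_real (1 - x) * deriv hypF (of_real x)) \<longlongrightarrow> of_real (1 / pi)) (at_left 1)"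
    by (rule abel_mean[OF l2 s2])
  have cont: "isCont hypF 0" "isCont (deriv hypF) 0"
    using hypF_holomorphic holomorphic_deriv[OF hypF_holomorphic open_slit_plane] zero_in_slit_plane open_slit_plane
    by (meson continuous_on_eq_continuous_at holomorphic_on_imp_continuous_on)+
  have to0: "((\<lambda>x. 1 - complex_of_real x) \<longlongrightarrow> 0) (at_left 1)"
    by (auto intro!: tendsto_eq_intros)
  have t3: "((\<lambda>x. hypF (1 - of_real x)) \<longlongrightarrow> hypF 0) (at_left 1)"
    "((\<lambda>x. deriv hypF (1 - of_real x)) \<longlongrightarrow> deriv hypF 0) (at_left 1)"
    using isCont_tendsto_compose[OF cont(1) to0] isCont_tendsto_compose[OF cont(2) to0] by auto
  have "((\<lambda>x. of_real x * (of_real (1 - x) * hypF (of_real x) * deriv hypF (1 - of_real x)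
      + of_real (1 - x) * deriv hypF (of_real x) * hypF (1 - of_real x))) \<longlongrightarrow> of_real 1 * (0 * deriv hypF 0 + of_real (1 / pi) * hypF 0)) (at_left 1)"
    by (intro tendsto_intros t1 t2 t3)
  moreover have "eventually (\<lambda>x. of_real x * (of_real (1 - x) * hypF (of_real x) * deriv hypF (1 - of_real x)
      + of_real (1 - x) * deriv hypF (of_real x) * hypF (1 - of_real x)) = c) (at_left 1)"
    unfolding eventually_at_left_field
  proof (intro exI[of _ 0] conjI allI impI)
    fix x :: real assume x: "0 < x" "x < 1"
    then have "complex_of_real x \<in> double_slit" by (simp add: double_slit_def)
    moreover have "of_real x * (of_real (1 - x) * hypF (of_real x) * deriv hypF (1 - of_real x)
      + of_real (1 - x) * deriv hypF (of_real x) * hypF (1 - of_real x)) = wronskian (of_real x)"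
      by (simp add: wronskian_def hypF_flux_def algebra_simps)
    ultimately show "of_real x * (of_real (1 - x) * hypF (of_real x) * deriv hypF (1 - of_real x)
      + of_real (1 - x) * deriv hypF (of_real x) * hypF (1 - of_real x)) = c"
      using c by simp
  qed simp
  ultimately have "((\<lambda>x::real. c) \<longlongrightarrow> of_real (1 / pi)) (at_left 1)"
    by (subst (asm) tendsto_cong) auto
  then have "c = of_real (1 / pi)" by (simp add: tendsto_const_iff)
  then show ?thesis using c[OF z] by simp
qed

lemma hypF_quotient_deriv:
  assumes z: "z \<in> double_slit"
  shows "((\<lambda>z. hypF (1 - z) / hypF z) has_field_derivative - 1 / (of_real pi * (z * (1 - z) * (hypF z)\<^sup>2))) (at z)"
proof -
  note s = double_slitD(1,2)[OF z]
  have nz: "z \<noteq> 0" "1 - z \<noteq> 0" "hypF z \<noteq> 0" using double_slitD[OF z] hypF_nonzero by auto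
  have "z * (1 - z) * (hypF z * deriv hypF (1 - z) + deriv hypF z * hypF (1 - z)) = 1 / of_real pi"
    using wronskian_eq[OF z] by (simp add: wronskian_def hypF_flux_def algebra_simps)
  then have w: "- deriv hypF (1 - z) * hypF z - hypF (1 - z) * deriv hypF z = - (1 / (of_real pi * (z * (1 - z))))"
    using nz by (simp add: field_simps) 
  have "((\<lambda>z. hypF (1 - z) / hypF z) has_field_derivative
      (- deriv hypF (1 - z) * hypF z - hypF (1 - z) * deriv hypF z) / (hypF z * hypF z)) (at z)"
    by (rule DERIV_divide[OF hypF_reflect_deriv[OF s(2)] hypF_deriv[OF s(1)] nz(3)])
  then show ?thesis unfolding w by (simp add: power2_eq_square mult_ac)
qed

section \<open>The nome as a holomorphic function on the slit plane\<close>

text \<open>By the Wronskian, \<open>exp (-\<pi> F(1 - z) / F(z))\<close> has the logarithmic derivative \<open>1 / (z (1 - z) F(z)\<^sup>2)\<close>.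
  This formula makes sense on the whole slit plane, where its only singularity is a simple pole at 0
  with residue 1. The slit plane is starlike about 0, so the remainder after subtracting \<open>1/z\<close> has a
  primitive \<open>\<kappa>\<close> there. Thus the exponential continues across the negative axis as \<open>z exp (\<kappa> z)\<close>, with a
  simple zero at 0, and no jump of \<open>F\<close> across its cut has to be computed.\<close>

lemma log_nome_exists:
  "\<exists>\<kappa>. (\<forall>z\<in>slit_plane. \<exists>d. (\<kappa> has_field_derivative d) (at z) \<and> 1 + z * d = 1 / ((1 - z) * (hypF z)\<^sup>2)) \<and>
    (\<forall>z\<in>double_slit. exp (- (of_real pi * (hypF (1 - z) / hypF z))) = z * exp (\<kappa> z))"
proof -
  define m where "m = (\<lambda>z. 1 / ((1 - z) * (hypF z)\<^sup>2))"
  have one: "1 - z \<noteq> 0" if "z \<in> slit_plane" for z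
    using that by (auto simp: slit_plane_iff)
  have m: "m holomorphic_on slit_plane"
    unfolding m_def using one hypF_nonzero by (intro holomorphic_intros hypF_holomorphic) auto
  have m0: "m 0 = 1" by (simp add: m_def)
  \<comment> \<open>\<open>k\<close> is \<open>(m - 1) / z\<close>, so that \<open>1/z + k\<close> is the logarithmic derivative \<open>m/z\<close>.\<close>
  define k where "k = (\<lambda>z. if z = 0 then deriv m 0 else (m z - m 0) / (z - 0))"
  have k: "k holomorphic_on slit_plane"
    unfolding k_def using zero_in_slit_plane open_slit_plane
    by (intro pole_lemma m) (simp add: interior_open)
  have kz: "1 + z * k z = m z" for z
    by (simp add: k_def m0)
  have "\<exists>g. \<forall>x\<in>slit_plane. (g has_field_derivative k x) (at x)"
    using k open_slit_plane
    by (intro holomorphic_starlike_primitive[where k = "{}"] starlike_slit_plane')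
      (auto intro: holomorphic_on_imp_continuous_on holomorphic_on_imp_differentiable_at)
  then obtain g where g: "\<And>x. x \<in> slit_plane \<Longrightarrow> (g has_field_derivative k x) (at x)" by blast
  define h where "h = (\<lambda>z. of_real pi * (hypF (1 - z) / hypF z) + (Ln z + g z))"
  have "h constant_on double_slit"
  proof (rule has_field_derivative_0_imp_constant_on[OF _ connected_double_slit open_double_slit])
    fix z assume z: "z \<in> double_slit"
    have nz: "z \<noteq> 0" using double_slitD z by blast
    have "(h has_field_derivative
        of_real pi * (- 1 / (of_real pi * (z * (1 - z) * (hypF z)\<^sup>2))) + (inverse z + k z)) (at z)"
      unfolding h_def using double_slitD[OF z]
      by (intro DERIV_add DERIV_cmult hypF_quotient_deriv[OF z] has_field_derivative_Ln g)
    moreover have "k z = m z / z - 1 / z" using nz by (simp add: k_def m0 diff_divide_distrib)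
    moreover have "of_real pi * (- 1 / (of_real pi * (z * (1 - z) * (hypF z)\<^sup>2))) = - (m z / z)"
      by (simp add: m_def mult_ac)
    ultimately show "(h has_field_derivative 0) (at z)" by (simp add: inverse_eq_divide)
  qed
  then obtain c where c: "\<And>z. z \<in> double_slit \<Longrightarrow> h z = c" by (auto simp: constant_on_def)
  have "exp (- (of_real pi * (hypF (1 - z) / hypF z))) = z * exp (g z - c)" if z: "z \<in> double_slit" for z
  proof -
    have "- (of_real pi * (hypF (1 - z) / hypF z)) = Ln z + (g z - c)"
      using c[OF z] by (simp add: h_def algebra_simps)
    then show ?thesis by (simp only: exp_add exp_Ln[OF double_slitD(4)[OF z]])
  qed
  moreover have "((\<lambda>z. g z - c) has_field_derivative k z) (at z)" if "z \<in> slit_plane" for z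
    using DERIV_diff[OF g[OF that] DERIV_const] by simp
  ultimately show ?thesis
    using kz by (intro exI[of _ "\<lambda>z. g z - c"]) (auto simp: m_def)
qed

definition log_nome :: "complex \<Rightarrow> complex" where
  "log_nome = (SOME \<kappa>. (\<forall>z\<in>slit_plane. \<exists>d. (\<kappa> has_field_derivative d) (at z) \<and> 1 + z * d = 1 / ((1 - z) * (hypF z)\<^sup>2)) \<and>
    (\<forall>z\<in>double_slit. exp (- (of_real pi * (hypF (1 - z) / hypF z))) = z * exp (\<kappa> z)))"

text \<open>The continuation of \<open>exp (-\<pi> F(1 - z) / F(z))\<close>, the elliptic nome \<open>exp (\<i>\<pi>\<tau>)\<close> as a function of the parameter
  \<open>z = \<lambda>(\<tau>)\<close>.\<close>

definition nome :: "complex \<Rightarrow> complex" where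
  "nome z = z * exp (log_nome z)"

lemma log_nome:
  shows "z \<in> slit_plane \<Longrightarrow> \<exists>d. (log_nome has_field_derivative d) (at z) \<and> 1 + z * d = 1 / ((1 - z) * (hypF z)\<^sup>2)"
    and nome_eq: "z \<in> double_slit \<Longrightarrow> nome z = exp (- (of_real pi * (hypF (1 - z) / hypF z)))"
  using someI_ex[OF log_nome_exists] unfolding log_nome_def[symmetric] nome_def by auto

lemma log_nome_holomorphic: "log_nome holomorphic_on slit_plane"
  unfolding holomorphic_on_open[OF open_slit_plane] using log_nome by blast

lemma nome_holomorphic: "nome holomorphic_on slit_plane"
  unfolding nome_def[abs_def] by (intro holomorphic_intros log_nome_holomorphic)

lemma nome_eq_0_iff [simp]: "nome z = 0 \<longleftrightarrow> z = 0"
  by (simp add: nome_def)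

lemma nome_deriv:
  assumes z: "z \<in> slit_plane" "z \<noteq> 0"
  shows "(nome has_field_derivative nome z / (z * (1 - z) * (hypF z)\<^sup>2)) (at z)"
proof -
  obtain d where d: "(log_nome has_field_derivative d) (at z)" "1 + z * d = 1 / ((1 - z) * (hypF z)\<^sup>2)"
    using log_nome z by blast
  have "(nome has_field_derivative 1 * exp (log_nome z) + exp (log_nome z) * d * z) (at z)"
    unfolding nome_def[abs_def]
    by (rule DERIV_mult[OF DERIV_ident DERIV_fun_exp[OF d(1)]])
  moreover have "1 * exp (log_nome z) + exp (log_nome z) * d * z = exp (log_nome z) * (1 + z * d)"
    by (simp add: algebra_simps)
  moreover have "\<dots> = nome z / (z * (1 - z) * (hypF z)\<^sup>2)"
    unfolding d(2) using z by (simp add: nome_def)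
  ultimately show ?thesis by simp
qed

text \<open>Off the cuts this is the positivity of \<open>Re (F(1 - z) / F(z))\<close>; the negative axis is approached from
  above.\<close>

lemma norm_nome_le:
  assumes z: "z \<in> slit_plane"
  shows "norm (nome z) \<le> 1"
proof -
  have *: "norm (nome z) \<le> 1" if "z \<in> double_slit" for z
  proof -
    have "Re (- (of_real pi * (hypF (1 - z) / hypF z))) = - (Re (hypF (1 - z) / hypF z) * pi)"
      by (simp only: uminus_complex.sel mult.commute[of "of_real pi"] Re_times_of_real)
    also have "\<dots> \<le> 0" using Re_hypF_quotient_pos[OF that] by simp
    finally show ?thesis unfolding nome_eq[OF that] norm_exp_eq_Re by simp
  qed
  have lim: "(\<lambda>n. z + \<i> * of_real (inverse (real (Suc n)))) \<longlonglongrightarrow> z"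
    using tendsto_add[OF tendsto_const[of z] tendsto_mult[OF tendsto_const[of \<i>]
        tendsto_of_real[OF LIMSEQ_inverse_real_of_nat, where 'a = complex]]] by simp
  show ?thesis
  proof (cases "z \<in> double_slit")
    case False
    then have "Im z = 0" by (auto simp: double_slit_def)
    have "isCont nome z"
      using nome_holomorphic z open_slit_plane
      by (meson continuous_on_eq_continuous_at holomorphic_on_imp_continuous_on)
    then have "(\<lambda>n. nome (z + \<i> * of_real (inverse (real (Suc n))))) \<longlonglongrightarrow> nome z"
      using lim by (rule isCont_tendsto_compose)
    then have "(\<lambda>n. norm (nome (z + \<i> * of_real (inverse (real (Suc n)))))) \<longlonglongrightarrow> norm (nome z)"
      by (rule tendsto_norm)
    moreover have "norm (nome (z + \<i> * of_real (inverse (real (Suc n))))) \<le> 1" for n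
      by (rule *) (simp add: double_slit_def \<open>Im z = 0\<close> del: of_nat_Suc)
    ultimately show ?thesis
      by (intro LIMSEQ_le_const2[of _ "norm (nome z)" 1]) auto
  qed (rule *)
qed

section \<open>The polynomials \<open>S\<^sub>n\<close>\<close>

text \<open>Taylor coefficients are split off one at a time. Dividing by \<open>z\<close> shifts the polynomial in \<open>1/z\<close> and
  turns the value \<open>g 0\<close> into its new linear coefficient. Real values on \<open>(0, 1)\<close> are all that has to be
  carried along, since \<open>g 0\<close> is a limit of such values.\<close>

lemma principal_part_exists:
  assumes h: "h holomorphic_on ball 0 1" and real: "\<And>x. 0 < x \<Longrightarrow> x < 1 \<Longrightarrow> h (of_real x) \<in> \<real>"
  shows "\<exists>P g. degree P \<le> n \<and> coeff P 0 = 0 \<and> (\<forall>i. coeff P i \<in> \<real>) \<and> (n > 0 \<longrightarrow> coeff P n = h 0)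
    \<and> g holomorphic_on ball 0 1 \<and> (\<forall>x. 0 < x \<and> x < 1 \<longrightarrow> g (of_real x) \<in> \<real>) \<and> (n = 0 \<longrightarrow> g = h)
    \<and> (\<forall>z\<in>ball 0 1 - {0}. h z / z ^ n = poly P (1 / z) + g z)"
proof (induction n)
  case 0
  show ?case by (intro exI[of _ 0] exI[of _ h]) (use h real in auto)
next
  case (Suc n)
  then obtain P g where P: "degree P \<le> n" "coeff P 0 = 0" "\<And>i. coeff P i \<in> \<real>" "n > 0 \<Longrightarrow> coeff P n = h 0"
    and g: "g holomorphic_on ball 0 1" "\<And>x. 0 < x \<Longrightarrow> x < 1 \<Longrightarrow> g (of_real x) \<in> \<real>" "n = 0 \<Longrightarrow> g = h"
    and eq: "\<And>z. z \<in> ball 0 1 - {0} \<Longrightarrow> h z / z ^ n = poly P (1 / z) + g z"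
    by blast
  define g1 where "g1 = (\<lambda>z. if z = 0 then deriv g 0 else (g z - g 0) / (z - 0))"
  have g1: "g1 holomorphic_on ball 0 1"
    unfolding g1_def by (intro pole_lemma g(1)) simp
  have g0: "g 0 \<in> \<real>"
  proof -
    have "isCont g 0"
      using g(1) by (meson centre_in_ball continuous_on_eq_continuous_at holomorphic_on_imp_continuous_on open_ball zero_less_one)
    moreover have "(\<lambda>n. complex_of_real (inverse (real (Suc (Suc n))))) \<longlonglongrightarrow> 0"
      using tendsto_of_real[OF LIMSEQ_Suc[OF LIMSEQ_inverse_real_of_nat], where 'a = complex] by simp
    ultimately have "(\<lambda>n. g (of_real (inverse (real (Suc (Suc n)))))) \<longlonglongrightarrow> g 0"
      by (rule isCont_tendsto_compose)
    moreover have "g (of_real (inverse (real (Suc (Suc n))))) \<in> \<real>" for n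
      by (rule g(2)) (auto simp: field_simps)
    ultimately show ?thesis
      by (rule Lim_in_closed_set[OF closed_complex_Reals always_eventually[OF allI] sequentially_bot, rotated])
  qed
  define P1 where "P1 = pCons 0 P + [:0, g 0:]"
  have c1: "coeff P1 i = (case i of 0 \<Rightarrow> 0 | Suc j \<Rightarrow> coeff P j + (if j = 0 then g 0 else 0))" for i
    by (auto simp: P1_def coeff_pCons split: nat.splits)
  show ?case
  proof (intro exI[of _ P1] exI[of _ g1] conjI allI impI ballI)
    show "degree P1 \<le> Suc n"
      unfolding P1_def using P(1) by (intro degree_add_le) (auto simp: degree_pCons_eq_if)
    show "coeff P1 0 = 0" by (simp add: c1)
    show "coeff P1 i \<in> \<real>" for i using P(3) g0 by (auto simp: c1 split: nat.splits)
    show "coeff P1 (Suc n) = h 0" using P(2,4) g(3) by (auto simp: c1)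
    show "g1 holomorphic_on ball 0 1" by (rule g1)
    show "g1 (of_real x) \<in> \<real>" if "0 < x \<and> x < 1" for x
      using that g(2)[of x] g0 by (auto simp: g1_def intro!: Reals_divide Reals_diff)
    show "g1 = h" if "Suc n = 0" using that by simp
    fix z assume z: "z \<in> ball (0::complex) 1 - {0}"
    have "h z / z ^ Suc n = (h z / z ^ n) / z" by (simp add: mult.commute)
    also have "\<dots> = (poly P (1 / z) + g z) / z" by (simp only: eq[OF z])
    also have "\<dots> = poly P1 (1 / z) + g1 z"
      using z by (simp add: P1_def g1_def field_simps)
    finally show "h z / z ^ Suc n = poly P1 (1 / z) + g1 z" .
  qed
qed

lemma hypF_real: "x < 1 \<Longrightarrow> hypF (of_real x) \<in> \<real>"
  using hypF_cnj[of "of_real x"] by (simp add: slit_plane_iff Reals_cnj_iff)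

lemma in_ball_double_slit: "z \<in> ball 0 1 - \<real>\<^sub>\<le>\<^sub>0 \<Longrightarrow> z \<in> double_slit"
  using complex_Re_le_cmod[of z] by (auto simp: double_slit_def complex_nonpos_Reals_iff)

lemma exp_eq_inverse_nome_power:
  assumes "z \<in> double_slit"
  shows "exp (of_nat n * of_real pi * hypF (1 - z) / hypF z) = 1 / nome z ^ n"
proof -
  have "nome z ^ n = exp (of_nat n * (- (of_real pi * (hypF (1 - z) / hypF z))))"
    unfolding nome_eq[OF assms] by (rule exp_of_nat_mult[symmetric])
  also have "\<dots> = inverse (exp (of_nat n * of_real pi * hypF (1 - z) / hypF z))"
    by (subst exp_minus[symmetric]) (simp add: mult_ac)
  finally show ?thesis by (simp add: inverse_eq_divide)
qed

text \<open>The nome has a simple zero at 0 and no other, so \<open>nome\<^sup>-\<^sup>n\<close> is \<open>z\<^sup>-\<^sup>n\<close> times a holomorphic function whose value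
  at 0 does not vanish; the latter makes the degree exactly \<open>n\<close>.\<close>

lemma S_exists:
  assumes n: "n > 0"
  shows "\<exists>P g. is_S n P \<and> g holomorphic_on ball 0 1 \<and> (\<forall>z\<in>ball 0 1 - {0}. 1 / nome z ^ n = poly P (1 / z) + g z)"
proof -
  define h where "h = (\<lambda>z. 1 / exp (log_nome z) ^ n)"
  have hol: "h holomorphic_on ball 0 1"
    unfolding h_def
    by (intro holomorphic_intros holomorphic_on_subset[OF log_nome_holomorphic ball_subset_slit_plane]) auto
  have real: "h (of_real x) \<in> \<real>" if x: "0 < x" "x < 1" for x
  proof -
    have d: "of_real x \<in> double_slit" using x by (simp add: double_slit_def)
    have "hypF (1 - of_real x) \<in> \<real>" using hypF_real[of "1 - x"] x by simp
    then have "nome (of_real x) \<in> \<real>"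
      unfolding nome_eq[OF d] using hypF_real[of x] x
      by (intro exp_in_Reals Reals_minus Reals_mult Reals_divide) auto
    then have "nome (of_real x) / of_real x \<in> \<real>" by (intro Reals_divide) auto
    moreover have "nome (of_real x) / of_real x = exp (log_nome (of_real x))"
      using x by (simp add: nome_def)
    ultimately show ?thesis unfolding h_def by (intro Reals_divide Reals_power) auto
  qed
  obtain P g where P: "degree P \<le> n" "coeff P 0 = 0" "\<forall>i. coeff P i \<in> \<real>" "n > 0 \<longrightarrow> coeff P n = h 0"
      "g holomorphic_on ball 0 1" and eq: "\<forall>z\<in>ball 0 1 - {0}. h z / z ^ n = poly P (1 / z) + g z"
    using principal_part_exists[OF hol real, of n] by blast
  have eq': "1 / nome z ^ n = poly P (1 / z) + g z" if "z \<in> ball 0 1 - {0}" for z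
    using eq[rule_format, OF that] by (simp add: h_def nome_def power_mult_distrib mult.commute)
  have "coeff P n \<noteq> 0" using P(4) n by (simp add: h_def)
  then have "degree P = n" using P(1) le_degree[of P n] by simp
  moreover have "exp (of_nat n * of_real pi * hypF (1 - z) / hypF z) - poly P (1 / z) = g z"
    if z: "z \<in> ball 0 1 - \<real>\<^sub>\<le>\<^sub>0" for z
  proof -
    have "z \<in> ball 0 1 - {0}" using z by auto
    from eq'[OF this] show ?thesis
      using exp_eq_inverse_nome_power[OF in_ball_double_slit[OF z]] by simp
  qed
  ultimately have "is_S n P"
    unfolding is_S_def using P by (auto simp: poly_0_coeff_0)
  then show ?thesis using P(5) eq' by blast
qed

text \<open>The difference of two candidates is a polynomial without constant term that stays bounded at
  infinity, because \<open>1/z\<close> tends to infinity as \<open>z\<close> tends to 0 along the positive axis.\<close>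

lemma is_S_unique:
  assumes p: "is_S n p" and q: "is_S n q"
  shows "p = q"
proof (rule ccontr)
  assume ne: "p \<noteq> q"
  obtain g1 where g1: "g1 holomorphic_on ball 0 1" "\<And>z. z \<in> ball 0 1 - \<real>\<^sub>\<le>\<^sub>0 \<Longrightarrow>
      exp (of_nat n * of_real pi * hypF (1 - z) / hypF z) - poly p (1 / z) = g1 z"
    using p unfolding is_S_def by blast
  obtain g2 where g2: "g2 holomorphic_on ball 0 1" "\<And>z. z \<in> ball 0 1 - \<real>\<^sub>\<le>\<^sub>0 \<Longrightarrow>
      exp (of_nat n * of_real pi * hypF (1 - z) / hypF z) - poly q (1 / z) = g2 z"
    using q unfolding is_S_def by blast
  define d where "d = p - q"
  have d: "poly d (1 / z) = g2 z - g1 z" if "z \<in> ball 0 1 - \<real>\<^sub>\<le>\<^sub>0" for z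
    using g1(2)[OF that] g2(2)[OF that] by (simp add: d_def algebra_simps)
  have "poly d 0 = 0" using p q by (simp add: d_def is_S_def)
  then obtain d' where d': "d = pCons 0 d'" by (cases d) auto
  have "d' \<noteq> 0" using ne d' by (auto simp: d_def)
  have "compact ((\<lambda>z. g2 z - g1 z) ` cball 0 (1/2))"
    by (intro compact_continuous_image continuous_intros holomorphic_on_imp_continuous_on
        holomorphic_on_subset[OF g1(1)] holomorphic_on_subset[OF g2(1)]) auto
  then have "bounded ((\<lambda>z. g2 z - g1 z) ` cball 0 (1/2))" by (rule compact_imp_bounded)
  then obtain B where B: "\<And>z. z \<in> cball 0 (1/2) \<Longrightarrow> norm (g2 z - g1 z) \<le> B"
    unfolding bounded_iff by blast
  obtain r where r: "\<And>z. r \<le> norm z \<Longrightarrow> B + 1 \<le> norm (poly d z)"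
    using poly_infinity[OF \<open>d' \<noteq> 0\<close>, of "B + 1" 0] d' by blast
  \<comment> \<open>Large enough for \<open>1/x\<close> to lie in the disk of radius \<open>1/2\<close>, where the bound \<open>B\<close> holds.\<close>
  define x where "x = max r 2"
  have x: "x \<ge> 2" "x \<ge> r" by (auto simp: x_def)
  have "norm (1 / complex_of_real x) \<le> 1/2" using x by (simp add: norm_divide)
  moreover have "1 / complex_of_real x \<notin> \<real>\<^sub>\<le>\<^sub>0"
    using x by (simp add: complex_nonpos_Reals_iff)
  ultimately have "norm (poly d (1 / (1 / complex_of_real x))) \<le> B"
    using B[of "1 / complex_of_real x"] by (subst d) auto
  moreover have "B + 1 \<le> norm (poly d (of_real x))" using x by (intro r) auto
  ultimately show False by simp
qed

lemma S_principal_part: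
  assumes n: "n > 0"
  shows "poly (S n) 0 = 0"
    and "\<exists>g. g holomorphic_on ball 0 1 \<and> (\<forall>z\<in>ball 0 1 - {0}. 1 / nome z ^ n = poly (S n) (1 / z) + g z)"
proof -
  obtain P g where P: "is_S n P" "g holomorphic_on ball 0 1" "\<forall>z\<in>ball 0 1 - {0}. 1 / nome z ^ n = poly P (1 / z) + g z"
    using S_exists[OF n] by blast
  have "S n = P" unfolding S_def using P(1) is_S_unique by blast
  then show "poly (S n) 0 = 0"
    "\<exists>g. g holomorphic_on ball 0 1 \<and> (\<forall>z\<in>ball 0 1 - {0}. 1 / nome z ^ n = poly (S n) (1 / z) + g z)"
    using P by (auto simp: is_S_def)
qed

section \<open>Estimates on the critical line\<close>

definition line :: "real \<Rightarrow> complex" where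
  "line t = Complex (1/2) t"

definition line_quot :: "real \<Rightarrow> complex" where
  "line_quot t = hypF (1 - line t) / hypF (line t)"

lemma line_simps [simp]: "Re (line t) = 1/2" "Im (line t) = t" "1 - line t = line (- t)" "cnj (line t) = line (- t)"
  by (simp_all add: line_def complex_eq_iff)

lemma line_in_double_slit: "line t \<in> double_slit"
  by (simp add: double_slit_def)

lemma line_in_slit: "line t \<in> slit_plane"
  by (simp add: slit_plane_iff)

lemma hypF_line_reflect: "hypF (line (- t)) = cnj (hypF (line t))"
  using hypF_cnj[OF line_in_slit[of t]] by simp

lemma line_nonzero: "line t \<noteq> 0" "hypF (line t) \<noteq> 0"
  using double_slitD(4)[OF line_in_double_slit] hypF_nonzero[OF line_in_slit] by auto

lemma line_mult_reflect: "line t * (1 - line t) = of_real (t\<^sup>2 + 1/4)"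
  by (simp add: complex_eq_iff power2_eq_square)

lemma continuous_line: "continuous_on A line"
  unfolding line_def Complex_eq by (intro continuous_intros)

lemma continuous_hypF_line: "continuous_on A (\<lambda>t. hypF (line t))"
  by (rule continuous_on_compose2[OF holomorphic_on_imp_continuous_on[OF hypF_holomorphic] continuous_line])
    (auto simp: line_in_slit)

lemma Re_line_quot_pos: "Re (line_quot t) > 0"
  unfolding line_quot_def by (rule Re_hypF_quotient_pos[OF line_in_double_slit])

lemma line_quot_reflect: "line_quot (- t) = cnj (line_quot t)"
  unfolding line_quot_def line_simps by (simp add: hypF_line_reflect)

lemma norm_line_quot: "norm (line_quot t) = 1"
  unfolding line_quot_def line_simps hypF_line_reflect using line_nonzero(2)[of t] by (simp add: norm_divide)

lemma line_quot_mult_cnj: "line_quot t * cnj (line_quot t) = 1"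
  using complex_norm_square[of "line_quot t"] norm_line_quot[of t] by simp

lemma Re_line_quot: "Re (line_quot t) = Re ((hypF (line t))\<^sup>2) / (norm (hypF (line t)))\<^sup>2"
proof -
  have "line_quot t = cnj ((hypF (line t))\<^sup>2) / of_real ((norm (hypF (line t)))\<^sup>2)"
    unfolding line_quot_def line_simps hypF_line_reflect of_real_power
    by (subst complex_div_cnj) (simp add: power2_eq_square)
  then show ?thesis by (simp only: Re_divide_of_real cnj.sel)
qed

text \<open>Apply \<open>y cos y \<le> sin y\<close> at \<open>y = x/2\<close> and use the double-angle formulas.\<close>

lemma sin_ge_half:
  fixes x :: real
  assumes "0 \<le> x" "x \<le> pi / 2"
  shows "x / 2 \<le> sin x"
proof -
  have *: "y * cos y \<le> sin y" if y: "0 \<le> y" "y \<le> pi" for y :: real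
  proof -
    have "sin 0 - 0 * cos (0::real) \<le> sin y - y * cos y"
    proof (rule DERIV_nonneg_imp_nondecreasing[OF y(1)])
      fix x assume x: "0 \<le> x" "x \<le> y"
      have "((\<lambda>x. sin x - x * cos x) has_real_derivative x * sin x) (at x)"
        by (auto intro!: derivative_eq_intros)
      moreover have "0 \<le> x * sin x" using x y by (intro mult_nonneg_nonneg sin_ge_zero) auto
      ultimately show "\<exists>d. ((\<lambda>x. sin x - x * cos x) has_real_derivative d) (at x) \<and> 0 \<le> d" by blast
    qed
    then show ?thesis by simp
  qed
  have c: "0 \<le> cos x" "0 \<le> cos (x / 2)" using assms by (auto intro!: cos_ge_zero)
  have "x / 2 \<le> x / 2 * (1 + cos x)" using assms c mult_left_mono[of 1 "1 + cos x" "x / 2"] by simp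
  also have "\<dots> = x / 2 * (2 * (cos (x / 2))\<^sup>2)"
    using cos_double_cos[of "x / 2"] by simp
  also have "\<dots> = 2 * (x / 2 * cos (x / 2)) * cos (x / 2)"
    by (simp add: power2_eq_square)
  also have "\<dots> \<le> 2 * sin (x / 2) * cos (x / 2)"
    using *[of "x / 2"] assms c by (intro mult_right_mono) auto
  also have "\<dots> = sin x" using sin_double[of "x / 2"] by simp
  finally show ?thesis .
qed

text \<open>On the line the radicand \<open>B\<close> has real part in \<open>[1/2, 1]\<close> and imaginary part \<open>-t sin\<^sup>2 \<theta>\<close>, so \<open>1/\<surd>B\<close> has
  its argument in \<open>[0, \<pi>/4)\<close>, and is bounded away from the direction \<open>\<pi>/4\<close> while \<open>t \<theta>\<^sup>2\<close> is bounded. Its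
  modulus is at most of order \<open>1 / (1 + \<theta> \<surd>t)\<close>.\<close>

lemma ellker_line_bounds:
  fixes t \<theta> :: real
  assumes t: "t \<ge> 0" and \<theta>: "0 \<le> \<theta>" "\<theta> \<le> pi / 2"
  defines "f \<equiv> ellker (line t) \<theta>"
  shows "Re f - Im f \<ge> 0" "Im f \<ge> 0"
    and "\<theta>\<^sup>2 * (1 + t) \<le> 1 \<Longrightarrow> Re f - Im f \<ge> 1/16"
    and "norm f \<le> 4 / (1 + sqrt (1 + t) / 2 * \<theta>)"
proof -
  define s where "s = (sin \<theta>)\<^sup>2"
  have s: "0 \<le> s" "s \<le> 1" unfolding s_def by (rule sin_square_bounds)+
  define B where "B = 1 - line t * of_real s"
  have B: "Re B = 1 - s / 2" "Im B = - (t * s)" by (simp_all add: B_def)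
  have ts: "t * s \<ge> 0" using t s by simp
  define r where "r = csqrt B"
  have Bn: "B \<notin> \<real>\<^sub>\<le>\<^sub>0" unfolding B_def by (rule radicand_not_nonpos[OF line_in_slit s])
  have rpos: "Re r > 0" unfolding r_def by (rule Re_csqrt_pos[OF Bn])
  have r2: "r\<^sup>2 = B" by (simp add: r_def)
  have nr: "(norm r)\<^sup>2 = norm B" using r2 by (metis norm_power)
  have nB: "norm B > 0" using Bn by auto
  have ReB: "(Re r)\<^sup>2 - (Im r)\<^sup>2 = 1 - s / 2" using arg_cong[OF r2, of Re] B by (simp add: Re_power2)
  have ImB: "2 * Re r * Im r = - (t * s)" using arg_cong[OF r2, of Im] B by (simp add: Im_power2)
  have rneg: "Im r \<le> 0"
  proof (rule ccontr)
    assume "\<not> Im r \<le> 0"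
    then have "2 * Re r * Im r > 0" using rpos by simp
    then show False using ImB ts by linarith
  qed
  have f: "f = 1 / r" by (simp only: f_def r_def B_def s_def)
  have Ref: "Re f = Re r / norm B" and Imf: "Im f = - Im r / norm B"
    unfolding f nr[symmetric] by (simp_all add: Re_divide Im_divide cmod_power2)
  show "Im f \<ge> 0" unfolding Imf using rneg nB by (intro divide_nonneg_pos) auto
  define \<alpha> \<beta> where "\<alpha> = Re r" and "\<beta> = - Im r"
  have ab: "\<alpha> > 0" "\<beta> \<ge> 0" using rpos rneg by (auto simp: \<alpha>_def \<beta>_def)
  have prod: "(\<alpha> - \<beta>) * (\<alpha> + \<beta>) \<ge> 1/2"
    using ReB s by (simp add: \<alpha>_def \<beta>_def power2_eq_square algebra_simps)
  have diff: "Re f - Im f = (\<alpha> - \<beta>) / norm B"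
    unfolding Ref Imf \<alpha>_def \<beta>_def diff_divide_distrib ..
  have dpos: "\<alpha> - \<beta> > 0"
  proof (rule ccontr)
    assume "\<not> \<alpha> - \<beta> > 0"
    then have "(\<alpha> - \<beta>) * (\<alpha> + \<beta>) \<le> 0" using ab by (intro mult_nonpos_nonneg) auto
    then show False using prod by linarith
  qed
  show "Re f - Im f \<ge> 0" unfolding diff using dpos nB by simp
  show "Re f - Im f \<ge> 1/16" if small: "\<theta>\<^sup>2 * (1 + t) \<le> 1"
  proof -
    have "s \<le> \<theta>\<^sup>2"
      unfolding s_def using sin_x_le_x[OF \<theta>(1)] sin_ge_zero[of \<theta>] \<theta> by (intro power_mono) auto
    then have "t * s \<le> t * \<theta>\<^sup>2" using t by (rule mult_left_mono)
    also have "\<dots> \<le> \<theta>\<^sup>2 * (1 + t)" by (simp add: algebra_simps)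
    finally have ts1: "t * s \<le> 1" using small by linarith
    have "norm B \<le> \<bar>Re B\<bar> + \<bar>Im B\<bar>" by (rule cmod_le)
    also have "\<dots> \<le> 2" unfolding B using s ts ts1 by simp
    finally have nB2: "norm B \<le> 2" .
    have nr2: "norm r \<le> 2"
    proof (rule power2_le_imp_le)
      have "norm B \<le> 2 * 2" using nB2 by linarith
      then show "(norm r)\<^sup>2 \<le> 2\<^sup>2" unfolding nr power2_eq_square[of 2] .
    qed simp
    have "\<alpha> + \<beta> \<le> 4"
      using abs_Re_le_cmod[of r] abs_Im_le_cmod[of r] nr2 unfolding \<alpha>_def \<beta>_def by linarith
    then have "1/2 \<le> (\<alpha> - \<beta>) * 4"
      using prod dpos mult_left_mono[of "\<alpha> + \<beta>" 4 "\<alpha> - \<beta>"] by linarith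
    then have "1/8 \<le> \<alpha> - \<beta>" by simp
    then have "(1/8) / 2 \<le> (\<alpha> - \<beta>) / norm B" using nB nB2 by (intro frac_le) auto
    then show ?thesis unfolding diff by simp
  qed
  show "norm f \<le> 4 / (1 + sqrt (1 + t) / 2 * \<theta>)"
  proof -
    define T where "T = sqrt (1 + t) / 2 * \<theta>"
    have T0: "T \<ge> 0" using t \<theta> by (simp add: T_def)
    have "\<theta>\<^sup>2 / 4 \<le> s"
      using power_mono[OF sin_ge_half[OF \<theta>], of 2] \<theta> by (simp add: s_def power_divide)
    then have "T\<^sup>2 \<le> (1 + t) * s"
      using t mult_left_mono[of "\<theta>\<^sup>2 / 4" s "1 + t"] by (simp add: T_def power_mult_distrib power_divide)
    moreover have "(1 + T)\<^sup>2 \<le> 2 * (1 + T\<^sup>2)"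
      using zero_le_power2[of "1 - T"] by (simp add: power2_eq_square algebra_simps)
    moreover have "norm B \<ge> \<bar>Re B\<bar>" "norm B \<ge> \<bar>Im B\<bar>" by (rule abs_Re_le_cmod, rule abs_Im_le_cmod)
    then have "2 * norm B \<ge> (1 - s / 2) + t * s" using s ts unfolding B by linarith
    ultimately have "(1 + T)\<^sup>2 \<le> 16 * norm B" using s ts by (simp add: algebra_simps)
    then have "(1 + T)\<^sup>2 \<le> (4 * norm r)\<^sup>2" using nr by (simp add: power_mult_distrib)
    then have "1 + T \<le> 4 * norm r" by (rule power2_le_imp_le) auto
    then have "1 / norm r \<le> 4 / (1 + T)"
      using T0 rpos by (auto simp: divide_simps)
    then show ?thesis unfolding f T_def by (simp add: norm_divide)
  qed
qed

lemma ellker_line_has_integral: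
  "(ellker (line t) has_integral integral {0..pi/2} (ellker (line t))) {0..pi/2}"
  by (rule integrable_integral) (rule integrable_continuous_real[OF continuous_on_ellker[OF line_in_slit]])

text \<open>All of the integrand has \<open>Re \<ge> Im \<ge> 0\<close>, and angles up to \<open>1/\<surd>(1 + t)\<close> alone contribute the stated bound.\<close>

lemma hypF_line_lower:
  assumes t: "t \<ge> 0"
  shows "Im (hypF (line t)) \<ge> 0" "Re (hypF (line t)) - Im (hypF (line t)) \<ge> 1 / (8 * pi * sqrt (1 + t))"
proof -
  let ?I = "integral {0..pi/2} (ellker (line t))"
  have hr: "((\<lambda>\<theta>. Re (ellker (line t) \<theta>)) has_integral Re ?I) {0..pi/2}"
    and hi: "((\<lambda>\<theta>. Im (ellker (line t) \<theta>)) has_integral Im ?I) {0..pi/2}"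
    using has_integral_Re[OF ellker_line_has_integral] has_integral_Im[OF ellker_line_has_integral] by auto
  have L: "hypF (line t) = of_real (2 / pi) * ?I" by (rule hypF_integral[OF line_in_slit])
  have "Im ?I \<ge> 0"
    by (rule has_integral_nonneg[OF hi]) (use ellker_line_bounds(2)[OF t] in auto)
  moreover have imL: "Im (hypF (line t)) = 2 / pi * Im ?I" "Re (hypF (line t)) = 2 / pi * Re ?I"
    unfolding L by simp_all
  ultimately show "Im (hypF (line t)) \<ge> 0" by simp
  define g where "g = (\<lambda>\<theta>. Re (ellker (line t) \<theta>) - Im (ellker (line t) \<theta>))"
  define b where "b = 1 / sqrt (1 + t)"
  have b: "0 < b" "b \<le> 1" using t by (auto simp: b_def)
  have bpi: "b \<le> pi / 2" using b pi_gt3 by linarith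
  have gI: "(g has_integral (Re ?I - Im ?I)) {0..pi/2}" unfolding g_def by (rule has_integral_diff[OF hr hi])
  have gb: "g integrable_on {0..b}"
    by (rule integrable_subinterval_real[OF has_integral_integrable[OF gI]]) (use bpi in auto)
  have "b * (1/16) \<le> integral {0..b} g"
  proof -
    have c: "((\<lambda>\<theta>. 1/16 :: real) has_integral (b - 0) *\<^sub>R (1/16)) {0..b}"
      using has_integral_const_real[of "1/16 :: real" 0 b] b by simp
    have "(b - 0) *\<^sub>R (1/16) \<le> integral {0..b} g"
    proof (rule has_integral_le[OF c integrable_integral[OF gb]])
      fix \<theta> assume \<theta>: "\<theta> \<in> {0..b}"
      have "\<theta>\<^sup>2 * (1 + t) \<le> b\<^sup>2 * (1 + t)" using \<theta> t by (intro mult_right_mono power_mono) auto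
      also have "\<dots> = 1" using t by (simp add: b_def power_divide)
      finally show "1/16 \<le> g \<theta>"
        unfolding g_def using \<theta> bpi by (intro ellker_line_bounds(3)[OF t]) auto
    qed
    then show ?thesis by simp
  qed
  also have "\<dots> \<le> integral {0..pi/2} g"
    by (rule integral_subset_le) (use gb gI bpi ellker_line_bounds(1)[OF t] in \<open>auto simp: g_def\<close>)
  also have "\<dots> = Re ?I - Im ?I" using gI by (rule integral_unique)
  finally have "2 / pi * (b * (1/16)) \<le> 2 / pi * (Re ?I - Im ?I)"
    by (intro mult_left_mono) auto
  also have "\<dots> = Re (hypF (line t)) - Im (hypF (line t))"
    unfolding imL by (simp only: right_diff_distrib)
  finally show "Re (hypF (line t)) - Im (hypF (line t)) \<ge> 1 / (8 * pi * sqrt (1 + t))"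
    by (simp add: b_def)
qed

lemma hypF_line_upper:
  assumes t: "t \<ge> 0"
  shows "norm (hypF (line t)) \<le> 8 * ln (1 + sqrt (1 + t)) / sqrt (1 + t)"
proof -
  let ?I = "integral {0..pi/2} (ellker (line t))"
  define a where "a = sqrt (1 + t) / 2"
  have a: "a > 0" using t by (simp add: a_def)
  have h: "((\<lambda>\<theta>. 4 / (1 + a * \<theta>)) has_integral 4 / a * ln (1 + a * (pi/2)) - 4 / a * ln (1 + a * 0)) {0..pi/2}"
  proof (rule fundamental_theorem_of_calculus)
    fix x assume x: "x \<in> {0..pi/2}"
    then have p: "1 + a * x > 0" using a by (auto intro: add_pos_nonneg)
    have "((\<lambda>\<theta>. 4 / a * ln (1 + a * \<theta>)) has_real_derivative 4 / a * (a / (1 + a * x))) (at x)"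
      using p by (auto intro!: derivative_eq_intros)
    then show "((\<lambda>\<theta>. 4 / a * ln (1 + a * \<theta>)) has_vector_derivative 4 / (1 + a * x)) (at x within {0..pi/2})"
      using a by (auto simp: has_real_derivative_iff_has_vector_derivative intro: has_vector_derivative_at_within)
  qed simp
  have "norm ?I \<le> integral {0..pi/2} (\<lambda>\<theta>. 4 / (1 + a * \<theta>))"
    by (rule integral_norm_bound_integral)
      (use h ellker_line_has_integral ellker_line_bounds(4)[OF t] in \<open>auto simp: a_def has_integral_integrable\<close>)
  also have "\<dots> = 4 / a * ln (1 + a * (pi/2))" using integral_unique[OF h] by simp
  also have "\<dots> \<le> 4 / a * ln (1 + sqrt (1 + t))"
  proof (rule mult_left_mono)
    have "sqrt (1 + t) * pi \<le> sqrt (1 + t) * 4" using pi_less_4 t by (intro mult_left_mono) auto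
    then have "a * (pi/2) \<le> sqrt (1 + t)" by (simp add: a_def)
    then show "ln (1 + a * (pi/2)) \<le> ln (1 + sqrt (1 + t))" using a by (intro ln_mono add_pos_nonneg) auto
  qed (use a in auto)
  finally have I: "norm ?I \<le> 4 / a * ln (1 + sqrt (1 + t))" .
  have "norm (hypF (line t)) = 2 / pi * norm ?I"
    unfolding hypF_integral[OF line_in_slit] norm_mult norm_of_real by simp
  also have "\<dots> \<le> 1 * norm ?I" using pi_gt3 by (intro mult_right_mono) auto
  also have "\<dots> \<le> 4 / a * ln (1 + sqrt (1 + t))" using I by simp
  also have "\<dots> = 8 * ln (1 + sqrt (1 + t)) / sqrt (1 + t)" by (simp add: a_def)
  finally show ?thesis .
qed

text \<open>\<open>Re (F\<^sup>2) = (Re F - Im F) (Re F + Im F)\<close>, and for \<open>t \<ge> 0\<close> both factors are at least of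
  order \<open>(1 + t)\<^sup>-\<^sup>1\<^sup>/\<^sup>2\<close>; the other half of the line follows by conjugation.\<close>

lemma hypF_line_square_lower: "Re ((hypF (line t))\<^sup>2) \<ge> (1 / (8 * pi))\<^sup>2 / (1 + \<bar>t\<bar>)"
proof -
  have *: "Re ((hypF (line t))\<^sup>2) \<ge> (1 / (8 * pi))\<^sup>2 / (1 + t)" if t: "t \<ge> 0" for t
  proof -
    define d where "d = 1 / (8 * pi * sqrt (1 + t))"
    have d: "d \<ge> 0" using t by (simp add: d_def)
    have 1: "Re (hypF (line t)) - Im (hypF (line t)) \<ge> d" unfolding d_def by (rule hypF_line_lower(2)[OF t])
    then have 2: "Re (hypF (line t)) + Im (hypF (line t)) \<ge> d" using hypF_line_lower(1)[OF t] by linarith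
    have "d * d \<le> (Re (hypF (line t)) - Im (hypF (line t))) * (Re (hypF (line t)) + Im (hypF (line t)))"
      using d 1 2 by (intro mult_mono) auto
    also have "\<dots> = Re ((hypF (line t))\<^sup>2)" by (simp add: Re_power2 power2_eq_square algebra_simps)
    finally have "d\<^sup>2 \<le> Re ((hypF (line t))\<^sup>2)" by (simp only: power2_eq_square)
    moreover have "d\<^sup>2 = (1 / (8 * pi))\<^sup>2 / (1 + t)"
      using t by (simp add: d_def power_divide power_mult_distrib)
    ultimately show ?thesis by (simp only:)
  qed
  show ?thesis
  proof (cases "t \<ge> 0")
    case True then show ?thesis using *[of t] by simp
  next
    case False
    then show ?thesis using *[of "- t"] by (simp add: hypF_line_reflect Re_power2)
  qed
qed

lemma hypF_line_norm_upper: "norm (hypF (line t)) \<le> 8 * ln (1 + sqrt (1 + \<bar>t\<bar>)) / sqrt (1 + \<bar>t\<bar>)"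
proof (cases "t \<ge> 0")
  case True then show ?thesis using hypF_line_upper[of t] by simp
next
  case False then show ?thesis using hypF_line_upper[of "- t"] by (simp add: hypF_line_reflect)
qed

lemma inverse_hypF_line_square: "\<exists>C. \<forall>t. 1 / (norm (hypF (line t)))\<^sup>2 \<le> C * (1 + \<bar>t\<bar>)"
proof (intro exI[of _ "1 / (1 / (8 * pi))\<^sup>2"] allI)
  fix t
  let ?c = "(1 / (8 * pi))\<^sup>2"
  have "?c / (1 + \<bar>t\<bar>) \<le> (norm (hypF (line t)))\<^sup>2"
    using hypF_line_square_lower[of t] complex_Re_le_cmod[of "(hypF (line t))\<^sup>2"] by (simp add: norm_power)
  moreover have "?c / (1 + \<bar>t\<bar>) > 0" by (simp add: add_pos_nonneg)
  ultimately have "1 / (norm (hypF (line t)))\<^sup>2 \<le> 1 / (?c / (1 + \<bar>t\<bar>))"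
    by (intro divide_left_mono mult_pos_pos) (assumption | linarith)+
  then show "1 / (norm (hypF (line t)))\<^sup>2 \<le> 1 / ?c * (1 + \<bar>t\<bar>)" by simp
qed

text \<open>\<open>Re w = Re (F\<^sup>2) / |F|\<^sup>2\<close> is bounded below by a multiple of \<open>(ln (1 + \<surd>(1 + |t|)))\<^sup>-\<^sup>2\<close>, and every power of
  the logarithm is dominated by a square root.\<close>

lemma inverse_Re_line_quot_power: "\<exists>C. \<forall>t. 1 / Re (line_quot t) ^ k \<le> C * (1 + \<bar>t\<bar>) powr (1/2)"
proof -
  define K where "K = 64 / (1 / (8 * pi))\<^sup>2"
  have K: "K > 0" by (simp add: K_def)
  have log: "1 / Re (line_quot t) \<le> K * (ln (1 + sqrt (1 + \<bar>t\<bar>)))\<^sup>2" for t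
  proof -
    define c where "c = (1 / (8 * pi))\<^sup>2"
    define l where "l = ln (1 + sqrt (1 + \<bar>t\<bar>))"
    define N where "N = norm (hypF (line t))"
    define R where "R = Re ((hypF (line t))\<^sup>2)"
    have c: "c > 0" by (simp add: c_def)
    have T: "1 + \<bar>t\<bar> > 0" by simp
    have R: "R \<ge> c / (1 + \<bar>t\<bar>)" unfolding R_def c_def by (rule hypF_line_square_lower)
    then have R0: "R > 0" using c T by (smt (verit) divide_pos_pos)
    have "N\<^sup>2 \<le> (8 * l / sqrt (1 + \<bar>t\<bar>))\<^sup>2"
      unfolding N_def l_def by (intro power_mono hypF_line_norm_upper) auto
    also have "\<dots> = 64 * l\<^sup>2 / (1 + \<bar>t\<bar>)" by (simp add: power_divide power_mult_distrib)
    finally have N: "N\<^sup>2 \<le> 64 * l\<^sup>2 / (1 + \<bar>t\<bar>)" .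
    have "1 / Re (line_quot t) = N\<^sup>2 / R" unfolding Re_line_quot N_def R_def by simp
    also have "\<dots> \<le> (64 * l\<^sup>2 / (1 + \<bar>t\<bar>)) / (c / (1 + \<bar>t\<bar>))"
      using N R c T by (intro frac_le) auto
    also have "\<dots> = K * l\<^sup>2" using T by (simp add: K_def c_def)
    finally show ?thesis by (simp add: l_def)
  qed
  show ?thesis
  proof (cases "k = 0")
    case True
    then show ?thesis by (intro exI[of _ 1]) (auto intro: ge_one_powr_ge_zero)
  next
    case False
    \<comment> \<open>With this exponent \<open>(x powr a)\<^sup>2\<^sup>k = x\<close>.\<close>
    define a where "a = 1 / (2 * real k)"
    have a: "a > 0" using False by (simp add: a_def)
    show ?thesis
    proof (intro exI[of _ "K ^ k * (2 / a ^ (2 * k))"] allI)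
      fix t
      define x where "x = 1 + sqrt (1 + \<bar>t\<bar>)"
      have s1: "sqrt (1 + \<bar>t\<bar>) \<ge> 1" by simp
      then have x: "x \<ge> 1" "x \<le> 2 * sqrt (1 + \<bar>t\<bar>)" by (auto simp: x_def)
      have "(ln x) ^ (2 * k) \<le> (x powr a / a) ^ (2 * k)"
        using x a by (intro power_mono ln_powr_bound ln_ge_zero) auto
      also have "\<dots> = (x powr a) ^ (2 * k) / a ^ (2 * k)" by (rule power_divide)
      also have "(x powr a) ^ (2 * k) = x"
        using x False by (simp add: powr_power a_def)
      also have "x / a ^ (2 * k) \<le> 2 * sqrt (1 + \<bar>t\<bar>) / a ^ (2 * k)"
        using x a by (intro divide_right_mono) auto
      finally have lx: "(ln x) ^ (2 * k) \<le> 2 * sqrt (1 + \<bar>t\<bar>) / a ^ (2 * k)" .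
      have "1 / Re (line_quot t) ^ k = (1 / Re (line_quot t)) ^ k" by (simp add: power_one_over)
      also have "\<dots> \<le> (K * (ln x)\<^sup>2) ^ k"
        unfolding x_def using Re_line_quot_pos[of t] by (intro power_mono log) auto
      also have "\<dots> = K ^ k * (ln x) ^ (2 * k)" by (simp add: power_mult_distrib power_mult)
      also have "\<dots> \<le> K ^ k * (2 * sqrt (1 + \<bar>t\<bar>) / a ^ (2 * k))"
        using K lx by (intro mult_left_mono) auto
      finally show "1 / Re (line_quot t) ^ k \<le> K ^ k * (2 / a ^ (2 * k)) * (1 + \<bar>t\<bar>) powr (1/2)"
        by (simp add: powr_half_sqrt)
    qed
  qed
qed

section \<open>The inversion \<open>x \<mapsto> -1/x\<close>\<close>

lemma integral_inversion:
  fixes f :: "real \<Rightarrow> complex"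
  assumes f: "integrable lborel f"
  shows "integrable lborel (\<lambda>x. f (- 1 / x) / (of_real x)\<^sup>2)"
    and "(\<integral>x. f (- 1 / x) / (of_real x)\<^sup>2 \<partial>lborel) = (\<integral>x. f x \<partial>lborel)"
proof -
  let ?S = "- {0 :: real}"
  let ?g = "\<lambda>x::real. - 1 / x" and ?h = "\<lambda>x::real. 1 / x\<^sup>2"
  have [measurable]: "f \<in> borel_measurable borel" using f by auto
  have S: "?S \<in> sets lebesgue" "?S \<in> sets borel" by auto
  have der: "(?g has_field_derivative ?h x) (at x within ?S)" if "x \<in> ?S" for x
    using that by (auto intro!: derivative_eq_intros simp: power2_eq_square)
  have inj: "inj_on ?g ?S" by (auto simp: inj_on_def)
  have img: "?g ` ?S = ?S"
  proof
    show "?S \<subseteq> ?g ` ?S"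
    proof
      fix y :: real assume "y \<in> ?S"
      then show "y \<in> ?g ` ?S" by (intro image_eqI[of _ _ "- 1 / y"]) auto
    qed
  qed auto
  have restrict: "set_integrable lebesgue ?S k \<longleftrightarrow> integrable lborel k"
      "(LINT x:?S|lebesgue. k x) = (\<integral>x. k x \<partial>lborel)"
    if [measurable]: "k \<in> borel_measurable borel" for k :: "real \<Rightarrow> complex"
  proof -
    have ae: "AE x in lborel. indicator ?S x *\<^sub>R k x = k x"
      using AE_lborel_singleton[of "0 :: real"] by eventually_elim auto
    show "set_integrable lebesgue ?S k \<longleftrightarrow> integrable lborel k"
      unfolding set_integrable_def
      by (subst integrable_completion) (use integrable_cong_AE[OF _ _ ae] in auto)
    show "(LINT x:?S|lebesgue. k x) = (\<integral>x. k x \<partial>lborel)"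
      unfolding set_lebesgue_integral_def
      by (subst integral_completion) (use integral_cong_AE[OF _ _ ae] in auto)
  qed
  have scale: "(\<lambda>x. \<bar>?h x\<bar> *\<^sub>R f (?g x)) = (\<lambda>x. f (- 1 / x) / (of_real x)\<^sup>2)"
    by (auto simp: fun_eq_iff scaleR_conv_of_real)
  have meas: "(\<lambda>x. f (- 1 / x) / (of_real x)\<^sup>2) \<in> borel_measurable borel" by measurable
  have fS: "f absolutely_integrable_on ?S" using f by (simp add: restrict(1))
  have *: "(\<lambda>x. \<bar>?h x\<bar> *\<^sub>R f (?g x)) absolutely_integrable_on ?S \<and>
      integral ?S (\<lambda>x. \<bar>?h x\<bar> *\<^sub>R f (?g x)) = integral ?S f"
    using has_absolute_integral_change_of_variables_real[OF S(1) der inj, of f "integral ?S f"] fS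
    unfolding img by blast
  then show "integrable lborel (\<lambda>x. f (- 1 / x) / (of_real x)\<^sup>2)"
    unfolding scale using restrict(1)[OF meas] by blast
  have "(\<integral>x. f (- 1 / x) / (of_real x)\<^sup>2 \<partial>lborel) = (LINT x:?S|lebesgue. f (- 1 / x) / (of_real x)\<^sup>2)"
    by (rule restrict(2)[OF meas, symmetric])
  also have "\<dots> = integral ?S (\<lambda>x. f (- 1 / x) / (of_real x)\<^sup>2)"
    by (rule set_lebesgue_integral_eq_integral(2)) (use * scale in simp)
  also have "\<dots> = integral ?S f" using * scale by simp
  also have "\<dots> = (LINT x:?S|lebesgue. f x)"
    by (rule set_lebesgue_integral_eq_integral(2)[symmetric, OF fS])
  also have "\<dots> = (\<integral>x. f x \<partial>lborel)" by (rule restrict(2)) simp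
  finally show "(\<integral>x. f (- 1 / x) / (of_real x)\<^sup>2 \<partial>lborel) = (\<integral>x. f x \<partial>lborel)" .
qed

section \<open>Integrals over the critical line\<close>

text \<open>The substitution \<open>z = 1/2 + \<i>\<zeta>\<close> turns the half-plane to the left of the line into the upper half-plane.
  The functions to be integrated are built from \<open>1/z\<close>, hence are undefined at 0; \<open>h\<close> describes their
  holomorphic extension.\<close>

lemma integral_line_eq_0:
  assumes f: "f holomorphic_on {z. Re z < 1} - {0}" and h: "h holomorphic_on ball 0 1"
    and eq: "\<And>z. z \<in> ball 0 1 - {0} \<Longrightarrow> f z = h z"
    and bd: "\<And>z. Re z \<le> 1/2 \<Longrightarrow> norm z \<ge> 1/2 \<Longrightarrow> norm (f z) \<le> C / (norm z)\<^sup>2"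
  shows "integrable lborel (\<lambda>t. f (line t))" "(\<integral>t. f (line t) \<partial>lborel) = 0"
proof -
  define F where "F = (\<lambda>z. if z = 0 then h 0 else f z)"
  have "F holomorphic_on ({z. Re z < 1} - {0}) \<union> ball 0 1"
  proof (rule holomorphic_on_Un)
    show "F holomorphic_on {z. Re z < 1} - {0}"
      by (rule holomorphic_transform[OF f]) (auto simp: F_def)
    show "F holomorphic_on ball 0 1"
      by (rule holomorphic_transform[OF h]) (use eq in \<open>auto simp: F_def\<close>)
    show "open ({z. Re z < 1} - {0})" by (intro open_Diff open_halfspace_Re_lt) auto
  qed auto
  then have F: "F holomorphic_on {z. Re z < 1}" by (rule holomorphic_on_subset) auto
  let ?m = "\<lambda>\<zeta>. 1/2 + \<i> * \<zeta>"
  have Fm: "(\<lambda>\<zeta>. F (?m \<zeta>)) holomorphic_on {z. Im z > -1/2}"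
  proof -
    have "?m holomorphic_on {z. Im z > -1/2}" by (intro holomorphic_intros)
    moreover have "?m ` {z. Im z > -1/2} \<subseteq> {z. Re z < 1}" by auto
    ultimately show ?thesis using holomorphic_on_compose_gen[OF _ F, of ?m "{z. Im z > -1/2}"] by (simp add: o_def)
  qed
  have line: "?m (of_real t) = line t" for t by (simp add: complex_eq_iff)
  have Fl: "F (line t) = f (line t)" for t using line_nonzero(1)[of t] by (simp add: F_def)
  have I: "integrable lborel (\<lambda>x::real. F (?m (of_real x)))" "(\<integral>x. F (?m (of_real x)) \<partial>lborel) = 0"
  proof -
    have c: "continuous_on {z. 0 \<le> Im z} (\<lambda>\<zeta>. F (?m \<zeta>))"
      by (rule holomorphic_on_imp_continuous_on[OF holomorphic_on_subset[OF Fm]]) auto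
    have d: "(\<lambda>\<zeta>. F (?m \<zeta>)) holomorphic_on {z. 0 < Im z}"
      by (rule holomorphic_on_subset[OF Fm]) auto
    have e: "norm (F (?m z)) \<le> (4 * C) / (norm z)\<^sup>2" if z: "0 \<le> Im z" "1 \<le> norm z" for z
    proof -
      have n: "norm (?m z) \<ge> norm z / 2"
        using norm_triangle_ineq2[of "\<i> * z" "- 1/2"] z by (simp add: norm_mult add.commute)
      then have n2: "norm (?m z) \<ge> 1/2" using z by linarith
      then have "?m z \<noteq> 0" by auto
      then have "norm (F (?m z)) \<le> C / (norm (?m z))\<^sup>2"
        unfolding F_def using bd[of "?m z"] z n2 by simp
      also have "\<dots> \<le> C / (norm z / 2)\<^sup>2"
      proof (rule divide_left_mono)
        show "(norm z / 2)\<^sup>2 \<le> (norm (?m z))\<^sup>2" using n by (intro power_mono) auto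
        have "0 \<le> C / (norm (?m z))\<^sup>2"
          using bd[of "?m z"] z n2 norm_ge_zero[of "f (?m z)"] by (simp del: norm_ge_zero)
        then show "0 \<le> C" using n2 by (auto simp: zero_le_divide_iff)
        show "0 < (norm (?m z))\<^sup>2 * (norm z / 2)\<^sup>2" using z n2 by (intro mult_pos_pos zero_less_power) auto
      qed
      finally show ?thesis by (simp add: power_divide mult.commute)
    qed
    show "integrable lborel (\<lambda>x::real. F (?m (of_real x)))" "(\<integral>x. F (?m (of_real x)) \<partial>lborel) = 0"
      by (rule integral_upper_half_plane_eq_0[OF c d e]; assumption)+
  qed
  show "integrable lborel (\<lambda>t. f (line t))" "(\<integral>t. f (line t) \<partial>lborel) = 0"
    using I unfolding line Fl by auto
qed

lemma line_has_derivative: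
  assumes "(G has_field_derivative d) (at (line t))"
  shows "((\<lambda>t. G (line t)) has_vector_derivative \<i> * d) (at t)"
proof -
  have "(line has_vector_derivative \<i>) (at t)"
    unfolding line_def Complex_eq
    by (auto intro!: derivative_eq_intros has_vector_derivative_real_field[of "\<lambda>z. 1/2 + \<i> * z", simplified])
  then show ?thesis
    using field_vector_diff_chain_at[of line \<i> t G d] assms by (simp add: o_def)
qed

lemma norm_line_ge: "norm (line t) \<ge> 1/2" "norm (line t) \<ge> (1 + \<bar>t\<bar>) / 4" "norm (line t) \<ge> \<bar>t\<bar>"
  using abs_Re_le_cmod[of "line t"] abs_Im_le_cmod[of "line t"] by auto

lemma integral_line_total_derivative:
  assumes G: "\<And>t. (G has_field_derivative g (line t)) (at (line t))"
    and cont: "continuous_on UNIV (\<lambda>t. g (line t))" and int: "integrable lborel (\<lambda>t. g (line t))"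
    and bd: "\<And>t. norm (G (line t)) \<le> C / norm (line t)"
  shows "(\<integral>t. g (line t) \<partial>lborel) = 0"
proof (rule integral_real_line_FTC[OF int cont, where F = "\<lambda>t. G (line t) / \<i>"])
  fix t
  have "((\<lambda>t. G (line t) * (1 / \<i>)) has_vector_derivative (\<i> * g (line t)) * (1 / \<i>)) (at t)"
    by (intro has_vector_derivative_mult_left line_has_derivative G)
  moreover have "(\<lambda>t. G (line t) * (1 / \<i>)) = (\<lambda>t. G (line t) / \<i>)" "(\<i> * g (line t)) * (1 / \<i>) = g (line t)"
    by (simp_all add: fun_eq_iff mult.commute)
  ultimately show "((\<lambda>t. G (line t) / \<i>) has_vector_derivative g (line t)) (at t)" by (simp only:)
next
  have C: "C \<ge> 0"
    using bd[of 0] norm_line_ge(1)[of 0] order_trans[OF norm_ge_zero bd[of 0]] by (auto simp: zero_le_divide_iff)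
  have lim: "(\<lambda>n. G (line (s * real n))) \<longlonglongrightarrow> 0" if s: "\<bar>s\<bar> = 1" for s
  proof (rule Lim_null_comparison)
    show "eventually (\<lambda>n. norm (G (line (s * real n))) \<le> C / real n) sequentially"
      using eventually_gt_at_top[of 0]
    proof eventually_elim
      case (elim n)
      have "norm (G (line (s * real n))) \<le> C / norm (line (s * real n))" by (rule bd)
      also have "\<dots> \<le> C / real n"
        using norm_line_ge(3)[of "s * real n"] s elim C norm_line_ge(1)[of "s * real n"]
        by (intro divide_left_mono mult_pos_pos) (auto simp: abs_mult)
      finally show ?case .
    qed
    show "(\<lambda>n. C / real n) \<longlonglongrightarrow> 0"
      by (rule tendsto_divide_0[OF tendsto_const filterlim_at_top_imp_at_infinity[OF filterlim_real_sequentially]])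
  qed
  have "(\<lambda>n. G (line (1 * real n)) / \<i> - G (line (-1 * real n)) / \<i>) \<longlonglongrightarrow> 0 / \<i> - 0 / \<i>"
    by (intro tendsto_intros lim) auto
  then show "(\<lambda>n. G (line (real n)) / \<i> - G (line (- real n)) / \<i>) \<longlonglongrightarrow> 0" by simp
qed

lemma continuous_line_quot: "continuous_on A line_quot"
  unfolding line_quot_def[abs_def] line_simps hypF_line_reflect
  by (intro continuous_intros continuous_hypF_line) (simp add: line_nonzero)

lemma line_quot_measurable [measurable]: "line_quot \<in> borel_measurable borel"
  by (rule borel_measurable_continuous_onI[OF continuous_line_quot])

text \<open>Quadratic decay leaves room for every power of \<open>1 / Re w\<close>, because each of these grows at most like
  the square root.\<close>

lemma line_decay_integrable:
  fixes g :: "real \<Rightarrow> complex"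
  assumes [measurable]: "g \<in> borel_measurable borel" and bd: "\<And>t. norm (g t) \<le> C / (1 + \<bar>t\<bar>)\<^sup>2"
  shows "integrable lborel (\<lambda>t. norm (g t) / Re (line_quot t) ^ k)"
proof -
  obtain D where D: "\<And>t. 1 / Re (line_quot t) ^ k \<le> D * (1 + \<bar>t\<bar>) powr (1/2)"
    using inverse_Re_line_quot_power by blast
  have "integrable lborel (\<lambda>t. complex_of_real (norm (g t) / Re (line_quot t) ^ k))"
  proof (rule integrable_powr_decay_bound)
    fix t
    have p: "Re (line_quot t) ^ k > 0" using Re_line_quot_pos[of t] by simp
    have "norm (complex_of_real (norm (g t) / Re (line_quot t) ^ k)) = norm (g t) * (1 / Re (line_quot t) ^ k)"
      using Re_line_quot_pos[of t] by (simp add: norm_divide norm_power abs_of_pos)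
    also have "\<dots> \<le> (C / (1 + \<bar>t\<bar>)\<^sup>2) * (D * (1 + \<bar>t\<bar>) powr (1/2))"
      using p bd[of t] order_trans[OF norm_ge_zero bd[of t]] by (intro mult_mono D) auto
    also have "\<dots> = (C * D) * ((1 + \<bar>t\<bar>) powr (1/2) / (1 + \<bar>t\<bar>) powr 2)"
      by (simp add: powr_numeral)
    also have "(1 + \<bar>t\<bar>) powr (1/2) / (1 + \<bar>t\<bar>) powr 2 = (1 + \<bar>t\<bar>) powr (-3/2)"
      by (subst powr_diff[symmetric]) simp
    finally show "norm (complex_of_real (norm (g t) / Re (line_quot t) ^ k)) \<le> (C * D) * (1 + \<bar>t\<bar>) powr (-3/2)" .
  qed measurable
  then show ?thesis by (simp only: complex_of_real_integrable_eq)
qed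

lemma nome_line: "nome (line t) ^ m = exp (- of_real (pi * real m) * line_quot t)"
  unfolding nome_eq[OF line_in_double_slit] line_quot_def exp_of_nat_mult[symmetric]
  by (simp add: mult_ac)

lemma one_plus_abs_square_le: "1 / ((t::real)\<^sup>2 + 1/4) \<le> 8 / (1 + \<bar>t\<bar>)\<^sup>2"
proof -
  have "(1 + \<bar>t\<bar>)\<^sup>2 \<le> 8 * (t\<^sup>2 + 1/4)"
  proof -
    have "0 \<le> (1 - \<bar>t\<bar>)\<^sup>2 + 6 * t\<^sup>2" by simp
    then show ?thesis by (simp add: power2_eq_square algebra_simps)
  qed
  then have "1 / (t\<^sup>2 + 1/4) \<le> 1 / ((1 + \<bar>t\<bar>)\<^sup>2 / 8)"
    by (intro divide_left_mono mult_pos_pos) (auto simp: add_nonneg_pos)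
  then show ?thesis by simp
qed

section \<open>Transforms of weights on the critical line\<close>

lemma line_decay_integrable_self:
  fixes g :: "real \<Rightarrow> complex"
  assumes meas: "g \<in> borel_measurable borel" and bd: "\<And>t. norm (g t) \<le> C / (1 + \<bar>t\<bar>)\<^sup>2"
  shows "integrable lborel g"
proof -
  have "integrable lborel (\<lambda>t. norm (g t))"
    using line_decay_integrable[OF meas bd, of 0] by (simp only: power_0 div_by_1)
  moreover have "g \<in> borel_measurable lborel" using meas by simp
  ultimately show ?thesis by (simp only: integrable_norm_iff)
qed

text \<open>The denominator is \<open>nome / nome'\<close>: multiplying by \<open>m nome\<^sup>m\<close> turns the weight into \<open>R (nome\<^sup>m)'\<close>.\<close>

definition line_weight :: "(complex \<Rightarrow> complex) \<Rightarrow> real \<Rightarrow> complex" where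
  "line_weight R t = R (line t) / (line t * (1 - line t) * (hypF (line t))\<^sup>2)"

definition line_transform :: "(complex \<Rightarrow> complex) \<Rightarrow> real \<Rightarrow> complex" where
  "line_transform R = kernel_transform line_quot (line_weight R) 2"

lemma norm_inverse_line_le: "1 / norm (line t) \<le> 4 / (1 + \<bar>t\<bar>)"
proof -
  have "1 / norm (line t) \<le> 1 / ((1 + \<bar>t\<bar>) / 4)"
  proof (rule divide_left_mono)
    show "(1 + \<bar>t\<bar>) / 4 \<le> norm (line t)" by (rule norm_line_ge(2))
    have "0 < norm (line t)" using norm_line_ge(1)[of t] by linarith
    moreover have "0 < (1 + \<bar>t\<bar>) / 4" by (rule divide_pos_pos) auto
    ultimately show "0 < norm (line t) * ((1 + \<bar>t\<bar>) / 4)" by (rule mult_pos_pos)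
  qed simp
  then show ?thesis by simp
qed

lemma norm_nome_line_le: "norm (nome (line t) ^ m) \<le> 1"
  unfolding norm_power by (intro power_le_one norm_nome_le line_in_slit) auto

lemma continuous_nome_line: "continuous_on A (\<lambda>t. nome (line t))"
  by (rule continuous_on_compose2[OF holomorphic_on_imp_continuous_on[OF nome_holomorphic] continuous_line])
    (auto simp: line_in_slit)

context
  fixes R R' :: "complex \<Rightarrow> complex" and C :: real
  assumes R: "\<And>t. (R has_field_derivative R' (line t)) (at (line t))"
    and R'_cont: "continuous_on UNIV (\<lambda>t. R' (line t))"
    and R_bd: "\<And>t. norm (R (line t)) \<le> C / norm (line t)"
    and R'_bd: "\<And>t. norm (R' (line t)) \<le> C / (norm (line t))\<^sup>2"
begin

lemma C_nonneg: "C \<ge> 0"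
  using order_trans[OF norm_ge_zero R_bd[of 0]] norm_line_ge(1)[of 0] by (auto simp: zero_le_divide_iff)

lemma continuous_R_line: "continuous_on A (\<lambda>t. R (line t))"
  using line_has_derivative[OF R] has_vector_derivative_continuous continuous_at_imp_continuous_on by blast

lemma continuous_line_weight: "continuous_on A (line_weight R)"
proof -
  have "line t * (1 - line t) * (hypF (line t))\<^sup>2 \<noteq> 0" for t
    using line_nonzero[of t] line_nonzero(1)[of "- t"] by simp
  then show ?thesis
    unfolding line_weight_def[abs_def]
    by (intro continuous_intros continuous_R_line continuous_line continuous_hypF_line) auto
qed

lemma line_weight_measurable [measurable]: "line_weight R \<in> borel_measurable borel"
  by (rule borel_measurable_continuous_onI[OF continuous_line_weight])

lemma line_weight_bound: "\<exists>D. \<forall>t. norm (line_weight R t) \<le> D / (1 + \<bar>t\<bar>)\<^sup>2"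
proof -
  obtain D where D: "\<And>t. 1 / (norm (hypF (line t)))\<^sup>2 \<le> D * (1 + \<bar>t\<bar>)"
    using inverse_hypF_line_square by blast
  have "norm (line_weight R t) \<le> (32 * C * D) / (1 + \<bar>t\<bar>)\<^sup>2" for t
  proof -
    have q: "norm (complex_of_real (t\<^sup>2 + 1/4)) = t\<^sup>2 + 1/4"
      by (simp only: norm_of_real) (simp add: add_nonneg_pos abs_of_pos)
    have R1: "norm (R (line t)) \<le> C * (4 / (1 + \<bar>t\<bar>))"
      using R_bd[of t] mult_left_mono[OF norm_inverse_line_le[of t] C_nonneg] by simp
    have "norm (line_weight R t) = norm (R (line t)) * (1 / (t\<^sup>2 + 1/4)) * (1 / (norm (hypF (line t)))\<^sup>2)"
      unfolding line_weight_def line_mult_reflect norm_divide norm_mult norm_power q by simp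
    also have "\<dots> \<le> (C * (4 / (1 + \<bar>t\<bar>))) * (8 / (1 + \<bar>t\<bar>)\<^sup>2) * (D * (1 + \<bar>t\<bar>))"
      using C_nonneg by (intro mult_mono R1 one_plus_abs_square_le D mult_nonneg_nonneg) (auto simp: add_nonneg_pos)
    also have "\<dots> = (32 * C * D) / (1 + \<bar>t\<bar>)\<^sup>2"
    proof -
      have "1 + \<bar>t\<bar> \<noteq> 0" by linarith
      then show ?thesis by simp
    qed
    finally show ?thesis .
  qed
  then show ?thesis by blast
qed

lemma line_weight_integrable: "integrable lborel (\<lambda>t. norm (line_weight R t) / Re (line_quot t) ^ k)"
proof -
  obtain D where D: "\<And>t. norm (line_weight R t) \<le> D / (1 + \<bar>t\<bar>)\<^sup>2"
    using line_weight_bound by blast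
  show ?thesis by (rule line_decay_integrable[OF line_weight_measurable D])
qed

lemma smooth_line_transform: "smooth (line_transform R)"
  unfolding line_transform_def
  by (rule smooth_kernel_transform[OF line_quot_measurable line_weight_measurable Re_line_quot_pos line_weight_integrable])

lemma continuous_line_transform: "isCont (line_transform R) x"
  unfolding line_transform_def
  by (rule continuous_kernel_transform[OF line_quot_measurable line_weight_measurable Re_line_quot_pos line_weight_integrable])

lemma line_transform_fubini:
  shows "integrable lborel (\<lambda>x. exp (- \<i> * of_real a * of_real x) * line_transform R x)"
    and "(\<integral>x. exp (- \<i> * of_real a * of_real x) * line_transform R x \<partial>lborel)
      = (\<integral>t. line_weight R t * (\<integral>x. exp (- \<i> * of_real a * of_real x) * (1 / (line_quot t - \<i> * of_real x)\<^sup>2) \<partial>lborel) \<partial>lborel)"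
proof -
  let ?G = "\<lambda>t x. line_weight R t / (line_quot t - \<i> * of_real x)\<^sup>2"
  let ?e = "\<lambda>x::real. exp (- \<i> * of_real a * of_real x)"
  have meas: "(\<lambda>(t, x). ?G t x) \<in> borel_measurable (lborel \<Otimes>\<^sub>M lborel)" by measurable
  have e: "?e \<in> borel_measurable borel" by measurable
  have e1: "norm (?e x) \<le> 1" for x by simp
  have int: "integrable lborel (\<lambda>t. norm (line_weight R t) / Re (line_quot t))"
    using line_weight_integrable[of 1] by simp
  have bd: "norm (?G t x) \<le> norm (line_weight R t) * (1 / (norm (line_quot t - \<i> * of_real x))\<^sup>2
      + 1 / (norm (line_quot t + \<i> * of_real x))\<^sup>2)" for t x
  proof -
    have "norm (?G t x) = norm (line_weight R t) * (1 / (norm (line_quot t - \<i> * of_real x))\<^sup>2)"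
      by (simp add: norm_divide norm_power)
    also have "\<dots> \<le> norm (line_weight R t) * (1 / (norm (line_quot t - \<i> * of_real x))\<^sup>2
      + 1 / (norm (line_quot t + \<i> * of_real x))\<^sup>2)"
      by (intro mult_left_mono) auto
    finally show ?thesis .
  qed
  note F = kernel_fubini[OF line_quot_measurable Re_line_quot_pos meas e e1 int bd]
  show "integrable lborel (\<lambda>x. ?e x * line_transform R x)"
    unfolding line_transform_def kernel_transform_def by (rule F(1))
  have "(\<integral>x. ?e x * line_transform R x \<partial>lborel) = (\<integral>t. (\<integral>x. ?e x * ?G t x \<partial>lborel) \<partial>lborel)"
    unfolding line_transform_def kernel_transform_def by (rule F(2))
  also have "\<dots> = (\<integral>t. line_weight R t * (\<integral>x. ?e x * (1 / (line_quot t - \<i> * of_real x)\<^sup>2) \<partial>lborel) \<partial>lborel)"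
  proof (rule Bochner_Integration.integral_cong[OF refl])
    fix t
    have "(\<integral>x. ?e x * ?G t x \<partial>lborel) = (\<integral>x. line_weight R t * (?e x * (1 / (line_quot t - \<i> * of_real x)\<^sup>2)) \<partial>lborel)"
      by (rule Bochner_Integration.integral_cong[OF refl]) simp
    also have "\<dots> = line_weight R t * (\<integral>x. ?e x * (1 / (line_quot t - \<i> * of_real x)\<^sup>2) \<partial>lborel)"
      by (rule integral_mult_right_zero)
    finally show "(\<integral>x. ?e x * ?G t x \<partial>lborel) = line_weight R t * (\<integral>x. ?e x * (1 / (line_quot t - \<i> * of_real x)\<^sup>2) \<partial>lborel)" .
  qed
  finally show "(\<integral>x. ?e x * line_transform R x \<partial>lborel)
      = (\<integral>t. line_weight R t * (\<integral>x. ?e x * (1 / (line_quot t - \<i> * of_real x)\<^sup>2) \<partial>lborel) \<partial>lborel)" .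
qed

lemma line_transform_integrable: "integrable lborel (line_transform R)"
  using line_transform_fubini(1)[of 0] by simp

lemma line_transform_fourier_nonpos:
  assumes "a \<le> 0"
  shows "(\<integral>x. exp (- \<i> * of_real a * of_real x) * line_transform R x \<partial>lborel) = 0"
  unfolding line_transform_fubini(2) fourier_double_kernel(2)[OF Re_line_quot_pos assms] by simp

text \<open>Integration by parts: the weight is \<open>R nome' / nome\<close>, so the left-hand side integrates
  \<open>R (nome\<^sup>m)'\<close>. The derivative is moved to \<open>R\<close>, since off the line only the bound \<open>|nome| \<le> 1\<close>
  is known, and none for its derivative.\<close>

lemma line_parts:
  assumes m: "m > 0"
  shows "(\<integral>t. line_weight R t * (of_nat m * nome (line t) ^ m) \<partial>lborel) = - (\<integral>t. R' (line t) * nome (line t) ^ m \<partial>lborel)"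
proof -
  let ?g = "\<lambda>z. R' z * nome z ^ m + of_nat m * nome z ^ m / (z * (1 - z) * (hypF z)\<^sup>2) * R z"
  have w: "of_nat m * nome (line t) ^ m / (line t * (1 - line t) * (hypF (line t))\<^sup>2) * R (line t)
      = line_weight R t * (of_nat m * nome (line t) ^ m)" for t
    by (simp add: line_weight_def del: line_simps)
  have meas1: "(\<lambda>t. R' (line t) * nome (line t) ^ m) \<in> borel_measurable borel"
    by (rule borel_measurable_continuous_onI) (intro continuous_intros R'_cont continuous_nome_line)
  have meas2: "(\<lambda>t. line_weight R t * (of_nat m * nome (line t) ^ m)) \<in> borel_measurable borel"
    by (rule borel_measurable_continuous_onI) (intro continuous_intros continuous_line_weight continuous_nome_line)
  have bd1: "norm (R' (line t) * nome (line t) ^ m) \<le> (16 * C) / (1 + \<bar>t\<bar>)\<^sup>2" for t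
  proof -
    have "norm (R' (line t) * nome (line t) ^ m) \<le> (C / (norm (line t))\<^sup>2) * 1"
      unfolding norm_mult using C_nonneg by (intro mult_mono R'_bd norm_nome_line_le) auto
    also have "\<dots> = C * (1 / norm (line t))\<^sup>2" by (simp add: power_divide)
    also have "\<dots> \<le> C * (4 / (1 + \<bar>t\<bar>))\<^sup>2"
      using C_nonneg by (intro mult_left_mono power_mono norm_inverse_line_le) auto
    finally show ?thesis by (simp add: power_divide mult.commute)
  qed
  have int1: "integrable lborel (\<lambda>t. R' (line t) * nome (line t) ^ m)"
    by (rule line_decay_integrable_self[OF meas1 bd1])
  obtain D where D: "\<And>t. norm (line_weight R t) \<le> D / (1 + \<bar>t\<bar>)\<^sup>2"
    using line_weight_bound by blast
  have bd2: "norm (line_weight R t * (of_nat m * nome (line t) ^ m)) \<le> (D * real m) / (1 + \<bar>t\<bar>)\<^sup>2" for t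
  proof -
    have "norm (line_weight R t * (of_nat m * nome (line t) ^ m)) \<le> (D / (1 + \<bar>t\<bar>)\<^sup>2) * (real m * 1)"
      unfolding norm_mult norm_of_nat
      using order_trans[OF norm_ge_zero D[of t]] by (intro mult_mono D mult_left_mono norm_nome_line_le) auto
    then show ?thesis by simp
  qed
  have int2: "integrable lborel (\<lambda>t. line_weight R t * (of_nat m * nome (line t) ^ m))"
    by (rule line_decay_integrable_self[OF meas2 bd2])
  have "(\<integral>t. ?g (line t) \<partial>lborel) = 0"
  proof (rule integral_line_total_derivative[where G = "\<lambda>z. R z * nome z ^ m" and C = C])
    fix t
    have "((\<lambda>z. nome z ^ m) has_field_derivative of_nat m * nome (line t) ^ (m - 1)
        * (nome (line t) / (line t * (1 - line t) * (hypF (line t))\<^sup>2))) (at (line t))"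
      using DERIV_power[OF nome_deriv[OF line_in_slit line_nonzero(1)], of m]
      by (simp add: mult_ac del: line_simps)
    moreover have "of_nat m * nome (line t) ^ (m - 1) * (nome (line t) / (line t * (1 - line t) * (hypF (line t))\<^sup>2))
        = of_nat m * nome (line t) ^ m / (line t * (1 - line t) * (hypF (line t))\<^sup>2)"
      using m by (cases m) (simp_all add: mult_ac del: line_simps)
    ultimately have d: "((\<lambda>z. nome z ^ m) has_field_derivative
        of_nat m * nome (line t) ^ m / (line t * (1 - line t) * (hypF (line t))\<^sup>2)) (at (line t))"
      by (simp only:)
    show "((\<lambda>z. R z * nome z ^ m) has_field_derivative ?g (line t)) (at (line t))"
      by (rule DERIV_mult[OF R d])
    show "norm (R (line t) * nome (line t) ^ m) \<le> C / norm (line t)"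
      unfolding norm_mult using mult_mono[OF R_bd[of t] norm_nome_line_le[of t m]] C_nonneg by simp
  next
    show "continuous_on UNIV (\<lambda>t. ?g (line t))"
      unfolding w by (intro continuous_intros R'_cont continuous_line_weight continuous_nome_line)
    show "integrable lborel (\<lambda>t. ?g (line t))"
      unfolding w by (intro Bochner_Integration.integrable_add int1 int2)
  qed
  then show ?thesis
    unfolding w using Bochner_Integration.integral_add[OF int1 int2] by (simp add: add_eq_0_iff2)
qed

lemma line_transform_fourier_pos:
  assumes m: "m > 0"
  shows "(\<integral>x. exp (- \<i> * of_real (pi * real m) * of_real x) * line_transform R x \<partial>lborel)
    = - (2 * (of_real pi)\<^sup>2) * (\<integral>t. R' (line t) * nome (line t) ^ m \<partial>lborel)"
proof -
  have "pi * real m \<ge> 0" by simp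
  note K = fourier_double_kernel(1)[OF Re_line_quot_pos this]
  have "(\<integral>x. exp (- \<i> * of_real (pi * real m) * of_real x) * line_transform R x \<partial>lborel)
    = (\<integral>t. (2 * (of_real pi)\<^sup>2) * (line_weight R t * (of_nat m * nome (line t) ^ m)) \<partial>lborel)"
    unfolding line_transform_fubini(2) K nome_line[symmetric]
    by (rule Bochner_Integration.integral_cong[OF refl]) (simp add: power2_eq_square mult_ac)
  also have "\<dots> = (2 * (of_real pi)\<^sup>2) * (\<integral>t. line_weight R t * (of_nat m * nome (line t) ^ m) \<partial>lborel)"
    by (rule integral_mult_right_zero)
  also have "\<dots> = - (2 * (of_real pi)\<^sup>2) * (\<integral>t. R' (line t) * nome (line t) ^ m \<partial>lborel)"
    unfolding line_parts[OF m] by simp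
  finally show ?thesis .
qed

end

section \<open>Residue computations\<close>

text \<open>The functions \<open>S\<^sub>n(1/z)\<close> and \<open>S\<^sub>n(1 / (1 - z))\<close>, with their derivatives. The first has its pole at 0, to the left
  of the line, and produces \<open>H\<^sub>n\<close>; the second has its pole at 1, to the right, and produces \<open>M\<^sub>n\<close>.\<close>

definition cusp0 :: "nat \<Rightarrow> complex \<Rightarrow> complex" where "cusp0 n z = poly (S n) (1 / z)"
definition cusp0' :: "nat \<Rightarrow> complex \<Rightarrow> complex" where "cusp0' n z = - poly (pderiv (S n)) (1 / z) / z\<^sup>2"
definition cusp1 :: "nat \<Rightarrow> complex \<Rightarrow> complex" where "cusp1 n z = poly (S n) (1 / (1 - z))"
definition cusp1' :: "nat \<Rightarrow> complex \<Rightarrow> complex" where "cusp1' n z = poly (pderiv (S n)) (1 / (1 - z)) / (1 - z)\<^sup>2"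

lemma cusp0_deriv:
  assumes "z \<noteq> 0"
  shows "(cusp0 n has_field_derivative cusp0' n z) (at z)"
proof -
  have "((\<lambda>z. 1 / z) has_field_derivative - 1 / z\<^sup>2) (at z)"
    using assms by (auto intro!: derivative_eq_intros simp: power2_eq_square)
  from DERIV_chain2[OF poly_DERIV this, of "S n"] show ?thesis
    by (simp add: cusp0_def[abs_def] cusp0'_def)
qed

lemma cusp1_deriv:
  assumes "z \<noteq> 1"
  shows "(cusp1 n has_field_derivative cusp1' n z) (at z)"
proof -
  have "((\<lambda>z. 1 / (1 - z)) has_field_derivative 1 / (1 - z)\<^sup>2) (at z)"
    using assms by (auto intro!: derivative_eq_intros simp: power2_eq_square)
  from DERIV_chain2[OF poly_DERIV this, of "S n"] show ?thesis
    by (simp add: cusp1_def[abs_def] cusp1'_def)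
qed

lemma poly_bounded_on_cball: "\<exists>B. \<forall>u. norm u \<le> 2 \<longrightarrow> norm (poly p u :: complex) \<le> B"
proof -
  have "compact (poly p ` cball (0 :: complex) 2)"
    by (intro compact_continuous_image continuous_intros) auto
  then have "bounded (poly p ` cball (0 :: complex) 2)" by (rule compact_imp_bounded)
  then obtain B where "\<And>u. u \<in> cball (0 :: complex) 2 \<Longrightarrow> norm (poly p u) \<le> B"
    unfolding bounded_iff by blast
  then show ?thesis by (intro exI[of _ B]) auto
qed

lemma poly_S_bounds:
  assumes n: "n > 0"
  shows "\<exists>C. \<forall>u. norm u \<le> 2 \<longrightarrow> norm (poly (S n) u) \<le> C * norm u \<and> norm (poly (pderiv (S n)) u) \<le> C"
proof -
  obtain p where p: "S n = pCons 0 p"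
    using S_principal_part(1)[OF n] by (cases "S n") auto
  obtain A where A: "\<And>u. norm u \<le> 2 \<Longrightarrow> norm (poly p u) \<le> A" using poly_bounded_on_cball by blast
  obtain B where B: "\<And>u. norm u \<le> 2 \<Longrightarrow> norm (poly (pderiv (S n)) u) \<le> B" using poly_bounded_on_cball by blast
  have "norm (poly (S n) u) \<le> max A B * norm u \<and> norm (poly (pderiv (S n)) u) \<le> max A B" if u: "norm u \<le> 2" for u
  proof
    have "norm (poly (S n) u) = norm (poly p u) * norm u" by (simp add: p norm_mult)
    also have "\<dots> \<le> max A B * norm u" using A[OF u] by (intro mult_right_mono) auto
    finally show "norm (poly (S n) u) \<le> max A B * norm u" .
    show "norm (poly (pderiv (S n)) u) \<le> max A B" using B[OF u] by simp
  qed
  then show ?thesis by blast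
qed

lemma cusp_bounds:
  assumes n: "n > 0"
  shows "\<exists>C. (\<forall>z. norm z \<ge> 1/2 \<longrightarrow> norm (cusp0 n z) \<le> C / norm z \<and> norm (cusp0' n z) \<le> C / (norm z)\<^sup>2)
    \<and> (\<forall>z. norm (1 - z) \<ge> 1/2 \<longrightarrow> norm (cusp1 n z) \<le> C / norm (1 - z) \<and> norm (cusp1' n z) \<le> C / (norm (1 - z))\<^sup>2)"
proof -
  obtain C where C: "\<And>u. norm u \<le> 2 \<Longrightarrow> norm (poly (S n) u) \<le> C * norm u \<and> norm (poly (pderiv (S n)) u) \<le> C"
    using poly_S_bounds[OF n] by blast
  have *: "norm (poly (S n) (1 / v)) \<le> C / norm v \<and> norm (poly (pderiv (S n)) (1 / v)) / (norm v)\<^sup>2 \<le> C / (norm v)\<^sup>2"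
    if v: "norm v \<ge> 1/2" for v
  proof -
    have "norm (1 / v) \<le> 1 / (1/2)"
      unfolding norm_divide norm_one using v by (intro frac_le) auto
    then have u: "norm (1 / v) \<le> 2" by simp
    show ?thesis
      using C[OF u] by (auto simp: norm_divide intro!: divide_right_mono)
  qed
  show ?thesis
    by (intro exI[of _ C] conjI allI impI)
      (use * in \<open>auto simp: cusp0_def cusp0'_def cusp1_def cusp1'_def norm_divide norm_power\<close>)
qed

lemma norm_reflect_ge:
  assumes "Re z \<le> 1/2"
  shows "norm (1 - z) \<ge> norm z" "norm (1 - z) \<ge> 1/2"
proof -
  have "(norm z)\<^sup>2 \<le> (norm (1 - z))\<^sup>2"
    using assms unfolding cmod_power2 by (simp add: power2_eq_square algebra_simps)
  then show "norm (1 - z) \<ge> norm z" by (rule power2_le_imp_le) simp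
  show "norm (1 - z) \<ge> 1/2" using abs_Re_le_cmod[of "1 - z"] assms by simp
qed

definition nome_logderiv :: "complex \<Rightarrow> complex" where
  "nome_logderiv z = 1 / (z * (1 - z) * (hypF z)\<^sup>2)"

text \<open>Differentiate \<open>S\<^sub>n(1/z) = nome\<^sup>-\<^sup>n - g\<close> on the punctured disk.\<close>

lemma cusp0'_principal_part:
  assumes n: "n > 0"
  shows "\<exists>g. g holomorphic_on ball 0 1 \<and>
    (\<forall>z\<in>ball 0 1 - {0}. cusp0' n z = - (of_nat n * nome_logderiv z / nome z ^ n) - g z)"
proof -
  obtain g where g: "g holomorphic_on ball 0 1" "\<And>z. z \<in> ball 0 1 - {0} \<Longrightarrow> 1 / nome z ^ n = cusp0 n z + g z"
    using S_principal_part(2)[OF n] unfolding cusp0_def by blast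
  have "cusp0' n z = - (of_nat n * nome_logderiv z / nome z ^ n) - deriv g z" if z: "z \<in> ball 0 1 - {0}" for z
  proof -
    have s: "z \<in> slit_plane" using z ball_subset_slit_plane by auto
    have z0: "z \<noteq> 0" using z by auto
    then have q: "nome z ^ n \<noteq> 0" by simp
    have dn: "((\<lambda>z. nome z ^ n) has_field_derivative of_nat n * (nome z ^ n * nome_logderiv z)) (at z)"
    proof (rule DERIV_cong[OF DERIV_power[OF nome_deriv[OF s z0]]])
      show "of_nat n * (nome z / (z * (1 - z) * (hypF z)\<^sup>2) * nome z ^ (n - Suc 0)) = of_nat n * (nome z ^ n * nome_logderiv z)"
        using n by (cases n) (simp_all add: nome_logderiv_def mult_ac)
    qed
    have "((\<lambda>z. inverse (nome z ^ n)) has_field_derivative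
        - (inverse (nome z ^ n) * (of_nat n * (nome z ^ n * nome_logderiv z)) * inverse (nome z ^ n))) (at z)"
      by (rule DERIV_inverse'[OF dn q])
    moreover have "- (inverse (nome z ^ n) * (of_nat n * (nome z ^ n * nome_logderiv z)) * inverse (nome z ^ n))
        = - (of_nat n * nome_logderiv z / nome z ^ n)"
      using q by (simp add: field_simps)
    ultimately have 1: "((\<lambda>z. inverse (nome z ^ n)) has_field_derivative - (of_nat n * nome_logderiv z / nome z ^ n)) (at z)"
      by (simp only:)
    have 2: "(g has_field_derivative deriv g z) (at z)"
      using holomorphic_derivI[OF g(1) open_ball] z by blast
    have "((\<lambda>z. inverse (nome z ^ n) - g z) has_field_derivative - (of_nat n * nome_logderiv z / nome z ^ n) - deriv g z) (at z)"
      by (rule DERIV_diff[OF 1 2])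
    then have "(cusp0 n has_field_derivative - (of_nat n * nome_logderiv z / nome z ^ n) - deriv g z) (at z)"
    proof (rule has_field_derivative_transform_within_open)
      show "open (ball 0 1 - {0 :: complex})" by auto
      show "inverse (nome x ^ n) - g x = cusp0 n x" if "x \<in> ball 0 1 - {0}" for x
        using g(2)[OF that] by (simp add: inverse_eq_divide)
    qed (rule z)
    then show ?thesis using cusp0_deriv[OF z0] DERIV_unique by blast
  qed
  moreover have "deriv g holomorphic_on ball 0 1" by (rule holomorphic_deriv[OF g(1) open_ball])
  ultimately show ?thesis by blast
qed

lemma holomorphic_left_half_plane:
  "nome holomorphic_on {z. Re z < 1} - {0}" "nome holomorphic_on ball 0 1"
  "hypF holomorphic_on ball 0 1" "log_nome holomorphic_on ball 0 1" "cusp0' n holomorphic_on {z. Re z < 1} - {0}"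
proof -
  have sub: "{z. Re z < 1} - {0} \<subseteq> slit_plane" by (auto simp: slit_plane_iff)
  show "nome holomorphic_on {z. Re z < 1} - {0}" "nome holomorphic_on ball 0 1" "hypF holomorphic_on ball 0 1"
    "log_nome holomorphic_on ball 0 1"
    using nome_holomorphic hypF_holomorphic log_nome_holomorphic sub ball_subset_slit_plane
    by (blast intro: holomorphic_on_subset)+
  show "cusp0' n holomorphic_on {z. Re z < 1} - {0}"
    unfolding cusp0'_def[abs_def] by (intro holomorphic_intros poly_holomorphic_on) auto
qed

lemma norm_nome_power_le:
  assumes "Re z \<le> 1/2"
  shows "norm (nome z ^ m) \<le> 1"
  unfolding norm_power using assms by (intro power_le_one norm_nome_le) (auto simp: slit_plane_iff)

lemma ball_facts:
  assumes "z \<in> ball (0::complex) 1"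
  shows "1 - z \<noteq> 0" "hypF z \<noteq> 0"
  using assms hypF_nonzero ball_subset_slit_plane by auto

lemma cusp0'_mult_bound:
  assumes n: "n > 0"
  shows "\<exists>C. \<forall>z. Re z \<le> 1/2 \<longrightarrow> norm z \<ge> 1/2 \<longrightarrow> norm (cusp0' n z * nome z ^ m) \<le> C / (norm z)\<^sup>2"
proof -
  obtain C where C: "\<And>z. norm z \<ge> 1/2 \<Longrightarrow> norm (cusp0' n z) \<le> C / (norm z)\<^sup>2" using cusp_bounds[OF n] by blast
  have "norm (cusp0' n z * nome z ^ m) \<le> C / (norm z)\<^sup>2" if z: "Re z \<le> 1/2" "norm z \<ge> 1/2" for z
  proof -
    have "norm (cusp0' n z * nome z ^ m) \<le> (C / (norm z)\<^sup>2) * 1"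
      unfolding norm_mult using order_trans[OF norm_ge_zero C[OF z(2)]]
      by (intro mult_mono C[OF z(2)] norm_nome_power_le[OF z(1)]) auto
    then show ?thesis by simp
  qed
  then show ?thesis by blast
qed

lemma integral_cusp0':
  assumes n: "n > 0"
  shows "integrable lborel (\<lambda>t. cusp0' n (line t))" "(\<integral>t. cusp0' n (line t) \<partial>lborel) = 0"
proof -
  obtain C where C: "\<And>z. norm z \<ge> 1/2 \<Longrightarrow> norm (cusp0 n z) \<le> C / norm z \<and> norm (cusp0' n z) \<le> C / (norm z)\<^sup>2"
    using cusp_bounds[OF n] by blast
  have cont: "continuous_on UNIV (\<lambda>t. cusp0' n (line t))"
    by (rule continuous_on_compose2[OF holomorphic_on_imp_continuous_on[OF holomorphic_left_half_plane(5)] continuous_line])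
      (auto simp: line_nonzero)
  show int: "integrable lborel (\<lambda>t. cusp0' n (line t))"
  proof (rule line_decay_integrable_self)
    show "(\<lambda>t. cusp0' n (line t)) \<in> borel_measurable borel" by (rule borel_measurable_continuous_onI[OF cont])
    fix t
    have C0: "C \<ge> 0"
      using order_trans[OF norm_ge_zero, of "cusp0 n 1" C] C[of 1] by simp
    have "norm (cusp0' n (line t)) \<le> C * (1 / norm (line t))\<^sup>2"
      using C[OF norm_line_ge(1)[of t]] by (simp add: power_divide)
    also have "\<dots> \<le> C * (4 / (1 + \<bar>t\<bar>))\<^sup>2"
      using C0 by (intro mult_left_mono power_mono norm_inverse_line_le) auto
    finally show "norm (cusp0' n (line t)) \<le> (C * 16) / (1 + \<bar>t\<bar>)\<^sup>2" by (simp add: power_divide)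
  qed
  show "(\<integral>t. cusp0' n (line t) \<partial>lborel) = 0"
    by (rule integral_line_total_derivative[OF cusp0_deriv[OF line_nonzero(1)] cont int])
      (use C norm_line_ge(1) in blast)
qed

lemma integral_inverse_line_product:
  shows "integrable lborel (\<lambda>t. 1 / (line t * (1 - line t)))" "(\<integral>t. 1 / (line t * (1 - line t)) \<partial>lborel) = 2 * of_real pi"
proof -
  have eq: "1 / (line t * (1 - line t)) = 1 / ((1/2)\<^sup>2 + (of_real t)\<^sup>2)" for t
    unfolding line_mult_reflect by (simp add: power_divide add.commute)
  show "integrable lborel (\<lambda>t. 1 / (line t * (1 - line t)))" "(\<integral>t. 1 / (line t * (1 - line t)) \<partial>lborel) = 2 * of_real pi"
    unfolding eq using integral_inverse_square_plus[of "1/2"] by auto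
qed

text \<open>Near 0 the integrand agrees with \<open>n/k\<close> times the derivative of \<open>S\<^sub>k(1/z)\<close>, \<open>k = n - m\<close>, up to a
  holomorphic function, because both contain the same multiple of \<open>nome' / nome\<^sup>k\<^sup>+\<^sup>1\<close>. The derivative of
  \<open>S\<^sub>k(1/z)\<close> has a primitive that vanishes at infinity, so it integrates to 0.\<close>

lemma pairing_less:
  assumes m: "0 < m" "m < n"
  shows "(\<integral>t. cusp0' n (line t) * nome (line t) ^ m \<partial>lborel) = 0"
proof -
  define k where "k = n - m"
  have k: "k > 0" "n = m + k" and n: "n > 0" using m by (auto simp: k_def)
  obtain gn where gn: "gn holomorphic_on ball 0 1"
    "\<And>z. z \<in> ball 0 1 - {0} \<Longrightarrow> cusp0' n z = - (of_nat n * nome_logderiv z / nome z ^ n) - gn z"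
    using cusp0'_principal_part[OF n] by blast
  obtain gk where gk: "gk holomorphic_on ball 0 1"
    "\<And>z. z \<in> ball 0 1 - {0} \<Longrightarrow> cusp0' k z = - (of_nat k * nome_logderiv z / nome z ^ k) - gk z"
    using cusp0'_principal_part[OF k(1)] by blast
  obtain C where C: "\<And>z. Re z \<le> 1/2 \<Longrightarrow> norm z \<ge> 1/2 \<Longrightarrow> norm (cusp0' n z * nome z ^ m) \<le> C / (norm z)\<^sup>2"
    using cusp0'_mult_bound[OF n] by blast
  obtain D where D: "\<And>z. norm z \<ge> 1/2 \<Longrightarrow> norm (cusp0' k z) \<le> D / (norm z)\<^sup>2" using cusp_bounds[OF k(1)] by blast
  define c :: complex where "c = of_nat n / of_nat k"
  let ?f = "\<lambda>z. cusp0' n z * nome z ^ m - c * cusp0' k z"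
  have f: "?f holomorphic_on {z. Re z < 1} - {0}"
    by (intro holomorphic_intros holomorphic_left_half_plane)
  have h: "(\<lambda>z. c * gk z - gn z * nome z ^ m) holomorphic_on ball 0 1"
    by (intro holomorphic_intros holomorphic_left_half_plane gn gk)
  have eq: "?f z = c * gk z - gn z * nome z ^ m" if z: "z \<in> ball 0 1 - {0}" for z
  proof -
    have q: "nome z ^ m \<noteq> 0" "nome z ^ k \<noteq> 0" using z by auto
    have ck: "c * of_nat k = of_nat n" using k by (simp add: c_def)
    have "of_nat n * nome_logderiv z / nome z ^ n * nome z ^ m = of_nat n * nome_logderiv z / nome z ^ k"
      using q unfolding k(2) power_add by simp
    moreover have "c * (of_nat k * nome_logderiv z / nome z ^ k) = of_nat n * nome_logderiv z / nome z ^ k"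
      unfolding ck[symmetric] by simp
    moreover have "?f z = - (of_nat n * nome_logderiv z / nome z ^ n * nome z ^ m) - gn z * nome z ^ m
        + c * (of_nat k * nome_logderiv z / nome z ^ k) + c * gk z"
      unfolding gn(2)[OF z] gk(2)[OF z] by (simp only: left_diff_distrib right_diff_distrib mult_minus_left mult_minus_right) simp
    ultimately show ?thesis by simp
  qed
  have bd: "norm (?f z) \<le> (C + norm c * D) / (norm z)\<^sup>2" if z: "Re z \<le> 1/2" "norm z \<ge> 1/2" for z
  proof -
    have "norm (?f z) \<le> norm (cusp0' n z * nome z ^ m) + norm c * norm (cusp0' k z)"
      using norm_triangle_ineq4[of "cusp0' n z * nome z ^ m" "c * cusp0' k z"] by (simp only: norm_mult)
    also have "\<dots> \<le> C / (norm z)\<^sup>2 + norm c * (D / (norm z)\<^sup>2)"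
      by (intro add_mono C z mult_left_mono D) auto
    finally show ?thesis by (simp add: add_divide_distrib)
  qed
  have I: "integrable lborel (\<lambda>t. ?f (line t))" "(\<integral>t. ?f (line t) \<partial>lborel) = 0"
    by (rule integral_line_eq_0[OF f h eq bd]; assumption)+
  have "(\<integral>t. cusp0' n (line t) * nome (line t) ^ m \<partial>lborel)
      = (\<integral>t. ?f (line t) + c * cusp0' k (line t) \<partial>lborel)" by simp
  also have "\<dots> = (\<integral>t. ?f (line t) \<partial>lborel) + (\<integral>t. c * cusp0' k (line t) \<partial>lborel)"
    by (rule Bochner_Integration.integral_add[OF I(1) integrable_mult_right[OF integral_cusp0'(1)[OF k(1)]]])
  also have "\<dots> = 0"
    unfolding integral_mult_right_zero I(2) integral_cusp0'(2)[OF k(1)] by simp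
  finally show ?thesis .
qed

text \<open>The positive power of the nome that is left over cancels the simple pole of its logarithmic
  derivative.\<close>

lemma pairing_greater:
  assumes m: "0 < n" "n < m"
  shows "(\<integral>t. cusp0' n (line t) * nome (line t) ^ m \<partial>lborel) = 0"
proof -
  define k where "k = m - n - 1"
  have k: "m = n + Suc k" using m by (auto simp: k_def)
  obtain gn where gn: "gn holomorphic_on ball 0 1"
    "\<And>z. z \<in> ball 0 1 - {0} \<Longrightarrow> cusp0' n z = - (of_nat n * nome_logderiv z / nome z ^ n) - gn z"
    using cusp0'_principal_part[OF m(1)] by blast
  obtain C where C: "\<And>z. Re z \<le> 1/2 \<Longrightarrow> norm z \<ge> 1/2 \<Longrightarrow> norm (cusp0' n z * nome z ^ m) \<le> C / (norm z)\<^sup>2"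
    using cusp0'_mult_bound[OF m(1)] by blast
  let ?f = "\<lambda>z. cusp0' n z * nome z ^ m"
  let ?h = "\<lambda>z. - (of_nat n * (exp (log_nome z) / ((1 - z) * (hypF z)\<^sup>2)) * nome z ^ k) - gn z * nome z ^ m"
  have f: "?f holomorphic_on {z. Re z < 1} - {0}"
    by (intro holomorphic_intros holomorphic_left_half_plane)
  have h: "?h holomorphic_on ball 0 1"
    by (intro holomorphic_intros holomorphic_left_half_plane gn) (use ball_facts in auto)
  have eq: "?f z = ?h z" if z: "z \<in> ball 0 1 - {0}" for z
  proof -
    have z0: "z \<noteq> 0" and q: "nome z ^ n \<noteq> 0" using z by auto
    have l: "nome_logderiv z * nome z = exp (log_nome z) / ((1 - z) * (hypF z)\<^sup>2)"
      using z0 by (simp add: nome_logderiv_def nome_def)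
    have "of_nat n * nome_logderiv z / nome z ^ n * nome z ^ m = of_nat n * (nome_logderiv z * nome z) * nome z ^ k"
      using q unfolding k power_add power_Suc by simp
    then have "of_nat n * nome_logderiv z / nome z ^ n * nome z ^ m
        = of_nat n * (exp (log_nome z) / ((1 - z) * (hypF z)\<^sup>2)) * nome z ^ k" unfolding l .
    then show ?thesis unfolding gn(2)[OF z] by (simp only: left_diff_distrib mult_minus_left)
  qed
  show ?thesis by (rule integral_line_eq_0(2)[OF f h eq C])
qed

text \<open>The integrand has the polar part \<open>-n/z\<close>, the same as that of \<open>-n / (z (1 - z))\<close>; unlike \<open>1/z\<close>, the
  latter decays quadratically.\<close>

lemma pairing_equal:
  assumes n: "0 < n"
  shows "(\<integral>t. cusp0' n (line t) * nome (line t) ^ n \<partial>lborel) = - (2 * of_real pi * of_nat n)"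
proof -
  obtain gn where gn: "gn holomorphic_on ball 0 1"
    "\<And>z. z \<in> ball 0 1 - {0} \<Longrightarrow> cusp0' n z = - (of_nat n * nome_logderiv z / nome z ^ n) - gn z"
    using cusp0'_principal_part[OF n] by blast
  obtain C where C: "\<And>z. Re z \<le> 1/2 \<Longrightarrow> norm z \<ge> 1/2 \<Longrightarrow> norm (cusp0' n z * nome z ^ n) \<le> C / (norm z)\<^sup>2"
    using cusp0'_mult_bound[OF n] by blast
  define \<phi> where "\<phi> = (\<lambda>z. 1 - 1 / (hypF z)\<^sup>2)"
  have \<phi>: "\<phi> holomorphic_on ball 0 1" "\<phi> 0 = 0"
    unfolding \<phi>_def using ball_facts by (auto intro!: holomorphic_intros holomorphic_left_half_plane)
  define q where "q = (\<lambda>z. if z = 0 then deriv \<phi> 0 else (\<phi> z - \<phi> 0) / (z - 0))"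
  have q: "q holomorphic_on ball 0 1" unfolding q_def by (intro pole_lemma \<phi>(1)) simp
  let ?f = "\<lambda>z. cusp0' n z * nome z ^ n + of_nat n * (1 / (z * (1 - z)))"
  let ?h = "\<lambda>z. of_nat n * (q z / (1 - z)) - gn z * nome z ^ n"
  have f: "?f holomorphic_on {z. Re z < 1} - {0}"
    by (intro holomorphic_intros holomorphic_left_half_plane) auto
  have h: "?h holomorphic_on ball 0 1"
    by (intro holomorphic_intros holomorphic_left_half_plane gn q) (use ball_facts in auto)
  have eq: "?f z = ?h z" if z: "z \<in> ball 0 1 - {0}" for z
  proof -
    have z0: "z \<noteq> 0" and Q: "nome z ^ n \<noteq> 0" and z1: "1 - z \<noteq> 0" using z ball_facts by auto
    have 1: "of_nat n * nome_logderiv z / nome z ^ n * nome z ^ n = of_nat n * nome_logderiv z" using Q by simp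
    have 2: "1 / (z * (1 - z)) - nome_logderiv z = q z / (1 - z)"
      using z0 by (simp add: q_def \<phi>(2) \<phi>_def nome_logderiv_def diff_divide_distrib)
    have "?f z = of_nat n * (1 / (z * (1 - z)) - nome_logderiv z) - gn z * nome z ^ n"
      unfolding gn(2)[OF z] left_diff_distrib mult_minus_left 1 right_diff_distrib by simp
    then show ?thesis unfolding 2 .
  qed
  have bd: "norm (?f z) \<le> (C + real n) / (norm z)\<^sup>2" if z: "Re z \<le> 1/2" "norm z \<ge> 1/2" for z
  proof -
    have "norm (1 / (z * (1 - z))) = 1 / (norm z * norm (1 - z))" by (simp add: norm_divide norm_mult)
    also have "\<dots> \<le> 1 / (norm z * norm z)"
    proof -
      have "0 < norm z" "0 < norm (1 - z)" using norm_reflect_ge(2)[OF z(1)] z(2) by linarith+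
      then show ?thesis
        using norm_reflect_ge(1)[OF z(1)] by (intro divide_left_mono mult_left_mono mult_pos_pos) auto
    qed
    finally have 1: "norm (1 / (z * (1 - z))) \<le> 1 / (norm z)\<^sup>2" by (simp add: power2_eq_square)
    have "norm (?f z) \<le> norm (cusp0' n z * nome z ^ n) + real n * norm (1 / (z * (1 - z)))"
      using norm_triangle_ineq[of "cusp0' n z * nome z ^ n" "of_nat n * (1 / (z * (1 - z)))"]
      by (simp only: norm_mult norm_of_nat)
    also have "\<dots> \<le> C / (norm z)\<^sup>2 + real n * (1 / (norm z)\<^sup>2)"
      by (intro add_mono C z mult_left_mono 1) auto
    finally show ?thesis by (simp add: add_divide_distrib)
  qed
  have I: "integrable lborel (\<lambda>t. ?f (line t))" "(\<integral>t. ?f (line t) \<partial>lborel) = 0"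
    by (rule integral_line_eq_0[OF f h eq bd]; assumption)+
  have "(\<integral>t. cusp0' n (line t) * nome (line t) ^ n \<partial>lborel)
      = (\<integral>t. ?f (line t) - of_nat n * (1 / (line t * (1 - line t))) \<partial>lborel)" by simp
  also have "\<dots> = (\<integral>t. ?f (line t) \<partial>lborel) - (\<integral>t. of_nat n * (1 / (line t * (1 - line t))) \<partial>lborel)"
    by (rule Bochner_Integration.integral_diff[OF I(1) integrable_mult_right[OF integral_inverse_line_product(1)]])
  also have "\<dots> = - (2 * of_real pi * of_nat n)"
    unfolding integral_mult_right_zero I(2) integral_inverse_line_product(2) by simp
  finally show ?thesis .
qed

lemma pairing:
  assumes "0 < n" "0 < m"
  shows "(\<integral>t. cusp0' n (line t) * nome (line t) ^ m \<partial>lborel) = (if m = n then - (2 * of_real pi * of_nat n) else 0)"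
  using pairing_less[of m n] pairing_greater[of n m] pairing_equal[of n] assms by (cases m n rule: linorder_cases) auto

text \<open>The only pole, at 1, lies to the right of the line.\<close>

lemma pairing_cusp1:
  assumes n: "0 < n"
  shows "(\<integral>t. cusp1' n (line t) * nome (line t) ^ m \<partial>lborel) = 0"
proof -
  obtain C where C: "\<And>z. norm (1 - z) \<ge> 1/2 \<Longrightarrow> norm (cusp1' n z) \<le> C / (norm (1 - z))\<^sup>2"
    using cusp_bounds[OF n] by blast
  have c1: "cusp1' n holomorphic_on {z. Re z < 1}"
    unfolding cusp1'_def[abs_def] by (intro holomorphic_intros poly_holomorphic_on) auto
  have nm: "nome holomorphic_on {z. Re z < 1}"
    by (rule holomorphic_on_subset[OF nome_holomorphic]) (auto simp: slit_plane_iff)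
  have sub: "ball 0 1 \<subseteq> {z. Re z < 1}"
  proof
    fix z :: complex assume "z \<in> ball 0 1"
    then show "z \<in> {z. Re z < 1}" using complex_Re_le_cmod[of z] by simp
  qed
  let ?f = "\<lambda>z. cusp1' n z * nome z ^ m"
  have f: "?f holomorphic_on {z. Re z < 1}" by (intro holomorphic_intros c1 nm)
  show ?thesis
  proof (rule integral_line_eq_0(2)[where f = ?f and h = ?f and C = C])
    show "?f holomorphic_on {z. Re z < 1} - {0}" by (rule holomorphic_on_subset[OF f]) auto
    show "?f holomorphic_on ball 0 1" by (rule holomorphic_on_subset[OF f sub])
    fix z :: complex assume z: "Re z \<le> 1/2" "1/2 \<le> norm z"
    have C1: "norm (cusp1' n z) \<le> C / (norm (1 - z))\<^sup>2" by (rule C[OF norm_reflect_ge(2)[OF z(1)]])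
    have "0 \<le> C / (norm (1 - z))\<^sup>2" by (rule order_trans[OF norm_ge_zero C1])
    moreover have p: "0 < norm (1 - z)" using norm_reflect_ge(2)[OF z(1)] by linarith
    ultimately have C0: "C \<ge> 0" by (auto simp: zero_le_divide_iff)
    have "norm (?f z) \<le> (C / (norm (1 - z))\<^sup>2) * 1"
      unfolding norm_mult using C0 by (intro mult_mono C1 norm_nome_power_le[OF z(1)]) auto
    also have "\<dots> \<le> C / (norm z)\<^sup>2"
    proof -
      have "0 < norm z" using z(2) by linarith
      then show ?thesis
        unfolding mult_1_right using C0 p norm_reflect_ge(1)[OF z(1)]
        by (intro divide_left_mono power_mono mult_pos_pos zero_less_power) auto
    qed
    finally show "norm (?f z) \<le> C / (norm z)\<^sup>2" .
  qed simp
qed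

section \<open>The biorthogonal system\<close>

lemma norm_line_reflect: "norm (1 - line t) = norm (line t)"
  using complex_mod_cnj[of "line t"] by simp

lemma cusp0_data:
  assumes n: "n > 0"
  obtains C where "\<And>t. (cusp0 n has_field_derivative cusp0' n (line t)) (at (line t))"
    "continuous_on UNIV (\<lambda>t. cusp0' n (line t))"
    "\<And>t. norm (cusp0 n (line t)) \<le> C / norm (line t)" "\<And>t. norm (cusp0' n (line t)) \<le> C / (norm (line t))\<^sup>2"
proof -
  obtain C where C: "\<And>z. norm z \<ge> 1/2 \<Longrightarrow> norm (cusp0 n z) \<le> C / norm z \<and> norm (cusp0' n z) \<le> C / (norm z)\<^sup>2"
    using cusp_bounds[OF n] by blast
  have "continuous_on UNIV (\<lambda>t. cusp0' n (line t))"
    by (rule continuous_on_compose2[OF holomorphic_on_imp_continuous_on[OF holomorphic_left_half_plane(5)] continuous_line])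
      (auto simp: line_nonzero)
  then show ?thesis
    using cusp0_deriv[OF line_nonzero(1)] C[OF norm_line_ge(1)] by (intro that) auto
qed

lemma cusp1_data:
  assumes n: "n > 0"
  obtains C where "\<And>t. (cusp1 n has_field_derivative cusp1' n (line t)) (at (line t))"
    "continuous_on UNIV (\<lambda>t. cusp1' n (line t))"
    "\<And>t. norm (cusp1 n (line t)) \<le> C / norm (line t)" "\<And>t. norm (cusp1' n (line t)) \<le> C / (norm (line t))\<^sup>2"
proof -
  obtain C where C: "\<And>z. norm (1 - z) \<ge> 1/2 \<Longrightarrow> norm (cusp1 n z) \<le> C / norm (1 - z) \<and> norm (cusp1' n z) \<le> C / (norm (1 - z))\<^sup>2"
    using cusp_bounds[OF n] by blast
  have ne: "1 - line t \<noteq> 0" for t using line_nonzero(1)[of "- t"] by simp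
  have "continuous_on UNIV (\<lambda>t. cusp1' n (line t))"
    unfolding cusp1'_def using ne
    by (intro continuous_intros continuous_on_poly continuous_line) auto
  moreover have "norm (1 - line t) \<ge> 1/2" for t unfolding norm_line_reflect by (rule norm_line_ge(1))
  moreover have "line t \<noteq> 1" for t using ne[of t] diff_self by metis
  moreover have "norm (cusp1 n (line t)) \<le> C / norm (line t) \<and> norm (cusp1' n (line t)) \<le> C / (norm (line t))\<^sup>2" for t
    using C[of "line t"] norm_line_ge(1)[of t] unfolding norm_line_reflect by blast
  ultimately show ?thesis
    using cusp1_deriv by (intro that[of C]) blast+
qed

abbreviation fourier :: "(real \<Rightarrow> complex) \<Rightarrow> int \<Rightarrow> complex" where
  "fourier f k \<equiv> (\<integral>x. exp (\<i> * of_real pi * of_int k * of_real x) * f x \<partial>lborel)"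

lemma fourier_reflect: "fourier (\<lambda>x. f (- x)) k = fourier f (- k)"
  using lborel_integral_reflect[of "\<lambda>x. exp (\<i> * of_real pi * of_int k * of_real x) * f (- x)"] by simp

lemma fourier_cmult: "fourier (\<lambda>x. c * f x) k = c * fourier f k"
  unfolding mult.left_commute[of _ c] by (rule integral_mult_right_zero)

lemma fourier_cases:
  assumes nonpos: "\<And>a. a \<le> 0 \<Longrightarrow> (\<integral>x. exp (- \<i> * of_real a * of_real x) * f x \<partial>lborel) = 0"
    and pos: "\<And>m. m > 0 \<Longrightarrow> (\<integral>x. exp (- \<i> * of_real (pi * real m) * of_real x) * f x \<partial>lborel) = v m"
  shows "fourier f k = (if k < 0 then v (nat (- k)) else 0)"
proof (cases "k < 0")
  case True
  then have e: "- \<i> * of_real (pi * real (nat (- k))) * of_real x = \<i> * of_real pi * of_int k * of_real x" for x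
    by simp
  show ?thesis using pos[of "nat (- k)", unfolded e] True by simp
next
  case False
  have e: "- \<i> * of_real (- (pi * of_int k)) * of_real x = \<i> * of_real pi * of_int k * of_real x" for x
    by simp
  show ?thesis using nonpos[of "- (pi * of_int k)", unfolded e] False by simp
qed

lemma cusp0_transform:
  assumes n: "n > 0"
  shows "smooth (line_transform (cusp0 n))" "integrable lborel (line_transform (cusp0 n))"
    and "fourier (line_transform (cusp0 n)) k = (if k = - int n then 4 * (of_real pi) ^ 3 * of_nat n else 0)"
proof -
  obtain C where C: "\<And>t. (cusp0 n has_field_derivative cusp0' n (line t)) (at (line t))"
    "continuous_on UNIV (\<lambda>t. cusp0' n (line t))"
    "\<And>t. norm (cusp0 n (line t)) \<le> C / norm (line t)" "\<And>t. norm (cusp0' n (line t)) \<le> C / (norm (line t))\<^sup>2"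
    using cusp0_data[OF n] by blast
  show "smooth (line_transform (cusp0 n))" by (rule smooth_line_transform[OF C])
  show "integrable lborel (line_transform (cusp0 n))" by (rule line_transform_integrable[OF C])
  have "fourier (line_transform (cusp0 n)) k
      = (if k < 0 then - (2 * (of_real pi)\<^sup>2) * (\<integral>t. cusp0' n (line t) * nome (line t) ^ nat (- k) \<partial>lborel) else 0)"
    by (rule fourier_cases) (use line_transform_fourier_nonpos[OF C] line_transform_fourier_pos[OF C] in auto)
  also have "\<dots> = (if k = - int n then 4 * (of_real pi) ^ 3 * of_nat n else 0)"
  proof (cases "k < 0")
    case True
    then have "nat (- k) = n \<longleftrightarrow> k = - int n" "0 < nat (- k)" by auto
    then show ?thesis using True by (simp add: pairing[OF n] power2_eq_square power3_eq_cube)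
  qed (use n in auto)
  finally show "fourier (line_transform (cusp0 n)) k = (if k = - int n then 4 * (of_real pi) ^ 3 * of_nat n else 0)" .
qed

lemma cusp1_transform:
  assumes n: "n > 0"
  shows "smooth (line_transform (cusp1 n))" "integrable lborel (line_transform (cusp1 n))"
    "isCont (line_transform (cusp1 n)) x" "fourier (line_transform (cusp1 n)) k = 0"
proof -
  obtain C where C: "\<And>t. (cusp1 n has_field_derivative cusp1' n (line t)) (at (line t))"
    "continuous_on UNIV (\<lambda>t. cusp1' n (line t))"
    "\<And>t. norm (cusp1 n (line t)) \<le> C / norm (line t)" "\<And>t. norm (cusp1' n (line t)) \<le> C / (norm (line t))\<^sup>2"
    using cusp1_data[OF n] by blast
  show "smooth (line_transform (cusp1 n))" by (rule smooth_line_transform[OF C])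
  show "integrable lborel (line_transform (cusp1 n))" by (rule line_transform_integrable[OF C])
  show "isCont (line_transform (cusp1 n)) x" by (rule continuous_line_transform[OF C])
  have "fourier (line_transform (cusp1 n)) k
      = (if k < 0 then - (2 * (of_real pi)\<^sup>2) * (\<integral>t. cusp1' n (line t) * nome (line t) ^ nat (- k) \<partial>lborel) else 0)"
    by (rule fourier_cases) (use line_transform_fourier_nonpos[OF C] line_transform_fourier_pos[OF C] in auto)
  then show "fourier (line_transform (cusp1 n)) k = 0" by (simp add: pairing_cusp1[OF n])
qed

definition H_const :: "nat \<Rightarrow> complex" where
  "H_const n = 1 / (4 * (of_real pi) ^ 3 * of_nat n)"

lemma hypF_line_quot: "hypF (line (- t)) = line_quot t * hypF (line t)"
  using line_nonzero(2)[of t] by (simp add: line_quot_def)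

text \<open>On the line \<open>F(1 - z) = w F(z)\<close> with \<open>w = line_quot\<close>, so \<open>F(z)\<^sup>2\<close> factors out of the squared denominator.\<close>

lemma H_pos_eq: "H_pos n x = H_const n * line_transform (cusp0 n) x"
proof -
  have "poly (S n) (1 / line t) / (of_real (t\<^sup>2 + 1/4) * (hypF (line (- t)) - \<i> * of_real x * hypF (line t))\<^sup>2)
      = line_weight (cusp0 n) t / (line_quot t - \<i> * of_real x)\<^sup>2" for t
  proof -
    have "hypF (line (- t)) - \<i> * of_real x * hypF (line t) = hypF (line t) * (line_quot t - \<i> * of_real x)"
      unfolding hypF_line_quot by (simp add: algebra_simps)
    then show ?thesis
      unfolding line_weight_def line_mult_reflect cusp0_def by (simp add: power_mult_distrib mult.assoc)
  qed
  then show ?thesis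
    unfolding H_pos_def H_const_def line_transform_def kernel_transform_def line_def[symmetric] by simp
qed

text \<open>Reversing the line exchanges \<open>z\<close> with \<open>1 - z\<close> and \<open>w\<close> with \<open>1/w\<close>. This turns the kernel at \<open>-1/x\<close> into
  the one at \<open>x\<close>, and \<open>S\<^sub>n(1/z)\<close> into \<open>S\<^sub>n(1 / (1 - z))\<close>.\<close>

lemma H_pos_inversion:
  assumes x: "x \<noteq> 0"
  shows "H_pos n (- 1 / x) / (of_real x)\<^sup>2 = - H_const n * line_transform (cusp1 n) x"
proof -
  let ?A = "\<lambda>t. poly (S n) (1 / line t) / (of_real (t\<^sup>2 + 1/4) * (hypF (line (- t)) - \<i> * of_real (- 1 / x) * hypF (line t))\<^sup>2)"
  have A: "?A (- t) = - (of_real x)\<^sup>2 * (line_weight (cusp1 n) t / (line_quot t - \<i> * of_real x)\<^sup>2)" for t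
  proof -
    have "hypF (line t) - \<i> * of_real (- 1 / x) * hypF (line (- t)) = hypF (line t) * (\<i> * (line_quot t - \<i> * of_real x)) / of_real x"
      unfolding hypF_line_quot using x by (simp add: field_simps)
    then have "(hypF (line t) - \<i> * of_real (- 1 / x) * hypF (line (- t)))\<^sup>2
        = - ((hypF (line t))\<^sup>2 * (line_quot t - \<i> * of_real x)\<^sup>2) / (of_real x)\<^sup>2"
      by (simp only: power_divide power_mult_distrib) simp
    then have "?A (- t) = poly (S n) (1 / line (- t)) / (of_real (t\<^sup>2 + 1/4)
        * (- ((hypF (line t))\<^sup>2 * (line_quot t - \<i> * of_real x)\<^sup>2) / (of_real x)\<^sup>2))"
      by (simp only: power2_minus minus_minus)
    also have "\<dots> = - (of_real x)\<^sup>2 * (line_weight (cusp1 n) t / (line_quot t - \<i> * of_real x)\<^sup>2)"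
      unfolding line_weight_def line_mult_reflect cusp1_def by (simp add: mult_ac)
    finally show ?thesis .
  qed
  have "(\<integral>t. ?A t \<partial>lborel) = (\<integral>t. ?A (- t) \<partial>lborel)" by (rule lborel_integral_reflect[symmetric])
  also have "\<dots> = (\<integral>t. - (of_real x)\<^sup>2 * (line_weight (cusp1 n) t / (line_quot t - \<i> * of_real x)\<^sup>2) \<partial>lborel)"
    unfolding A ..
  also have "\<dots> = - (of_real x)\<^sup>2 * line_transform (cusp1 n) x"
    unfolding line_transform_def kernel_transform_def by (rule integral_mult_right_zero)
  finally have "(\<integral>t. ?A t \<partial>lborel) = - (of_real x)\<^sup>2 * line_transform (cusp1 n) x" .
  then have "H_pos n (- 1 / x) = H_const n * (- (of_real x)\<^sup>2 * line_transform (cusp1 n) x)"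
    unfolding H_pos_def H_const_def line_def[symmetric] by simp
  then show ?thesis using x by simp
qed

lemma H_nonzero_eq:
  assumes n: "n > 0"
  shows "H (int n) = (\<lambda>x. H_const n * line_transform (cusp0 n) x)"
    "H (- int n) = (\<lambda>x. H_const n * line_transform (cusp0 n) (- x))"
  using n by (auto simp: H_def fun_eq_iff H_pos_eq)

text \<open>Continuity at 0 identifies the limit by which \<open>M p 0\<close> is defined.\<close>

lemma M_eqI:
  assumes g: "\<And>x. x \<noteq> 0 \<Longrightarrow> H p (- 1 / x) / (of_real x)\<^sup>2 = g x" and cont: "isCont g 0"
  shows "M p = g"
proof
  fix x
  show "M p x = g x"
  proof (cases "x = 0")
    case True
    have "(g \<longlongrightarrow> g 0) (at 0)" using cont by (simp add: isCont_def)
    then have "((\<lambda>y. H p (- 1 / y) / (of_real y)\<^sup>2) \<longlongrightarrow> g 0) (at 0)"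
      by (rule Lim_transform_eventually) (use g in \<open>auto simp: eventually_at_filter intro!: always_eventually\<close>)
    then show ?thesis using True tendsto_Lim[OF at_neq_bot] by (simp add: M_def)
  next
    case False
    then show ?thesis using g[of x] by (simp add: M_def)
  qed
qed

lemma M_eq:
  assumes n: "n > 0"
  shows "M (int n) = (\<lambda>x. - H_const n * line_transform (cusp1 n) x)"
    "M (- int n) = (\<lambda>x. - H_const n * line_transform (cusp1 n) (- x))"
proof -
  have c: "isCont (line_transform (cusp1 n)) x" for x by (rule cusp1_transform(3)[OF n])
  show "M (int n) = (\<lambda>x. - H_const n * line_transform (cusp1 n) x)"
  proof (rule M_eqI)
    show "H (int n) (- 1 / x) / (of_real x)\<^sup>2 = - H_const n * line_transform (cusp1 n) x" if "x \<noteq> 0" for x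
      using H_pos_inversion[OF that, of n] n by (simp add: H_def)
    show "isCont (\<lambda>x. - H_const n * line_transform (cusp1 n) x) 0" by (intro continuous_intros c)
  qed
  show "M (- int n) = (\<lambda>x. - H_const n * line_transform (cusp1 n) (- x))"
  proof (rule M_eqI)
    show "H (- int n) (- 1 / x) / (of_real x)\<^sup>2 = - H_const n * line_transform (cusp1 n) (- x)" if "x \<noteq> 0" for x
      using H_pos_inversion[of "- x" n] that n by (simp add: H_def)
    have "isCont (\<lambda>x. line_transform (cusp1 n) (- x)) 0"
      by (rule isCont_o2[OF _ c]) (intro continuous_intros)
    then show "isCont (\<lambda>x. - H_const n * line_transform (cusp1 n) (- x)) 0" by (intro continuous_intros)
  qed
qed

subsection \<open>The function \<open>H\<^sub>0\<close>\<close>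

definition line_unit :: "real \<Rightarrow> complex" where
  "line_unit t = 1 / (line t * (1 - line t))"

lemma line_unit_measurable [measurable]: "line_unit \<in> borel_measurable borel"
proof (rule borel_measurable_continuous_onI)
  have "line t * (1 - line t) \<noteq> 0" for t
    using line_nonzero(1)[of t] line_nonzero(1)[of "- t"] by simp
  then show "continuous_on UNIV line_unit"
    unfolding line_unit_def[abs_def] by (intro continuous_intros continuous_line) auto
qed

lemma norm_line_unit: "norm (line_unit t) \<le> 8 / (1 + \<bar>t\<bar>)\<^sup>2"
proof -
  have "norm (line_unit t) = 1 / (t\<^sup>2 + 1/4)"
    unfolding line_unit_def line_mult_reflect norm_divide norm_of_real by (simp add: add_nonneg_pos abs_of_pos)
  then show ?thesis using one_plus_abs_square_le[of t] by simp
qed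

lemma line_unit_integrable: "integrable lborel (\<lambda>t. norm (line_unit t) / Re (line_quot t) ^ k)"
  by (rule line_decay_integrable[OF line_unit_measurable norm_line_unit])

lemma H_zero_eq:
  "H_zero x = 1 / (2 * (of_real pi)\<^sup>2) * (\<integral>t. line_unit t * (line_quot t / ((line_quot t)\<^sup>2 + (of_real x)\<^sup>2)) \<partial>lborel)"
proof -
  have "of_real ((cmod (hypF (line t)))\<^sup>2) / (of_real (t\<^sup>2 + 1/4) * ((hypF (line (- t)))\<^sup>2 + (of_real x)\<^sup>2 * (hypF (line t))\<^sup>2))
      = line_unit t * (line_quot t / ((line_quot t)\<^sup>2 + (of_real x)\<^sup>2))" for t
  proof -
    have 1: "of_real ((cmod (hypF (line t)))\<^sup>2) = line_quot t * (hypF (line t))\<^sup>2"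
      unfolding complex_norm_square hypF_line_reflect[symmetric] hypF_line_quot
      by (simp add: power2_eq_square)
    have 2: "(hypF (line (- t)))\<^sup>2 + (of_real x)\<^sup>2 * (hypF (line t))\<^sup>2 = ((line_quot t)\<^sup>2 + (of_real x)\<^sup>2) * (hypF (line t))\<^sup>2"
      unfolding hypF_line_quot by (simp add: power_mult_distrib algebra_simps)
    show ?thesis
      unfolding 1 2 line_unit_def line_mult_reflect using line_nonzero(2)[of t] by simp
  qed
  then show ?thesis unfolding H_zero_def line_def[symmetric] by simp
qed

lemma simple_kernel_split:
  assumes w: "Re w > 0"
  shows "w / (w\<^sup>2 + (of_real x)\<^sup>2) = 1/2 * (1 / (w - \<i> * of_real x) + 1 / (w + \<i> * of_real x))"
proof -
  note nz = Re_pos_kernel_nonzero[OF w, of x]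
  have "w\<^sup>2 + (of_real x)\<^sup>2 = (w - \<i> * of_real x) * (w + \<i> * of_real x)"
    by (simp add: algebra_simps power2_eq_square)
  then show ?thesis unfolding add_frac_eq[OF nz(1,2)] by simp
qed

lemma smooth_H_zero: "smooth H_zero"
proof -
  let ?T = "kernel_transform line_quot line_unit 1"
  note facts = line_quot_measurable line_unit_measurable Re_line_quot_pos line_unit_integrable
  have "H_zero x = 1 / (4 * (of_real pi)\<^sup>2) * ?T x + 1 / (4 * (of_real pi)\<^sup>2) * ?T (- x)" for x
  proof -
    have i: "integrable lborel (\<lambda>t. line_unit t / (line_quot t - \<i> * of_real x) ^ 1)" for x
      by (rule kernel_integrand_integrable[OF facts])
    have "line_unit t * (line_quot t / ((line_quot t)\<^sup>2 + (of_real x)\<^sup>2))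
        = 1/2 * (line_unit t / (line_quot t - \<i> * of_real x) ^ 1 + line_unit t / (line_quot t - \<i> * of_real (- x)) ^ 1)" for t
      unfolding simple_kernel_split[OF Re_line_quot_pos] by (simp add: distrib_left)
    then have "(\<integral>t. line_unit t * (line_quot t / ((line_quot t)\<^sup>2 + (of_real x)\<^sup>2)) \<partial>lborel)
        = (\<integral>t. 1/2 * (line_unit t / (line_quot t - \<i> * of_real x) ^ 1 + line_unit t / (line_quot t - \<i> * of_real (- x)) ^ 1) \<partial>lborel)"
      by (simp only:)
    also have "\<dots> = 1/2 * (?T x + ?T (- x))"
      unfolding kernel_transform_def Bochner_Integration.integral_add[OF i[of x] i[of "- x"], symmetric]
      by (rule integral_mult_right_zero)
    finally show ?thesis unfolding H_zero_eq by (simp add: distrib_left)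
  qed
  then have eq: "H_zero = (\<lambda>x. 1 / (4 * (of_real pi)\<^sup>2) * ?T x + 1 / (4 * (of_real pi)\<^sup>2) * ?T (- x))" by (rule ext)
  show ?thesis
    unfolding eq
    by (rule smooth_add[OF smooth_cmult[OF smooth_kernel_transform[OF facts]]
        smooth_cmult[OF smooth_reflect[OF smooth_kernel_transform[OF facts]]]])
qed

lemma H_zero_fubini:
  "integrable lborel (\<lambda>x. exp (\<i> * of_real a * of_real x) * H_zero x)"
  "(\<integral>x. exp (\<i> * of_real a * of_real x) * H_zero x \<partial>lborel)
    = 1 / (2 * of_real pi) * (\<integral>t. line_unit t * exp (- of_real \<bar>a\<bar> * line_quot t) \<partial>lborel)"
proof -
  let ?G = "\<lambda>t x. line_unit t * (line_quot t / ((line_quot t)\<^sup>2 + (of_real x)\<^sup>2))"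
  let ?e = "\<lambda>x::real. exp (\<i> * of_real a * of_real x)"
  have meas: "(\<lambda>(t, x). ?G t x) \<in> borel_measurable (lborel \<Otimes>\<^sub>M lborel)" by measurable
  have e: "?e \<in> borel_measurable borel" by measurable
  have e1: "norm (?e x) \<le> 1" for x by simp
  have int: "integrable lborel (\<lambda>t. norm (line_unit t) / Re (line_quot t))"
    using line_unit_integrable[of 1] by simp
  have bd: "norm (?G t x) \<le> norm (line_unit t) * (1 / (norm (line_quot t - \<i> * of_real x))\<^sup>2
      + 1 / (norm (line_quot t + \<i> * of_real x))\<^sup>2)" for t x
  proof -
    define p q where "p = 1 / norm (line_quot t - \<i> * of_real x)" and "q = 1 / norm (line_quot t + \<i> * of_real x)"
    have sq: "(line_quot t)\<^sup>2 + (of_real x)\<^sup>2 = (line_quot t - \<i> * of_real x) * (line_quot t + \<i> * of_real x)"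
      by (simp add: algebra_simps power2_eq_square)
    have "norm (?G t x) = norm (line_unit t) * (p * q)"
      unfolding norm_mult norm_divide norm_line_quot sq by (simp add: p_def q_def)
    also have "\<dots> \<le> norm (line_unit t) * (p\<^sup>2 + q\<^sup>2)"
    proof (rule mult_left_mono)
      have "0 \<le> (p - q)\<^sup>2 + p\<^sup>2 + q\<^sup>2" by simp
      then show "p * q \<le> p\<^sup>2 + q\<^sup>2" by (simp add: power2_eq_square algebra_simps)
    qed simp
    finally show ?thesis by (simp add: p_def q_def power_divide)
  qed
  note F = kernel_fubini[OF line_quot_measurable Re_line_quot_pos meas e e1 int bd]
  let ?c = "1 / (2 * (complex_of_real pi)\<^sup>2)"
  have eq: "?e x * H_zero x = ?c * (?e x * (\<integral>t. ?G t x \<partial>lborel))" for x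
    unfolding H_zero_eq by (rule mult.left_commute)
  show "integrable lborel (\<lambda>x. ?e x * H_zero x)"
    unfolding eq by (intro integrable_mult_right F(1))
  have "(\<integral>x. ?e x * H_zero x \<partial>lborel) = ?c * (\<integral>t. (\<integral>x. ?e x * ?G t x \<partial>lborel) \<partial>lborel)"
    unfolding eq integral_mult_right_zero F(2) ..
  also have "(\<integral>t. (\<integral>x. ?e x * ?G t x \<partial>lborel) \<partial>lborel) = (\<integral>t. of_real pi * (line_unit t * exp (- of_real \<bar>a\<bar> * line_quot t)) \<partial>lborel)"
  proof (rule Bochner_Integration.integral_cong[OF refl])
    fix t
    have "(\<integral>x. ?e x * ?G t x \<partial>lborel) = (\<integral>x. line_unit t * (?e x * (line_quot t / ((line_quot t)\<^sup>2 + (of_real x)\<^sup>2))) \<partial>lborel)"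
      by (simp only: mult.left_commute)
    also have "\<dots> = line_unit t * (\<integral>x. ?e x * (line_quot t / ((line_quot t)\<^sup>2 + (of_real x)\<^sup>2)) \<partial>lborel)"
      by (rule integral_mult_right_zero)
    also have "\<dots> = of_real pi * (line_unit t * exp (- of_real \<bar>a\<bar> * line_quot t))"
      unfolding fourier_simple_kernel[OF Re_line_quot_pos] by (rule mult.left_commute)
    finally show "(\<integral>x. ?e x * ?G t x \<partial>lborel) = of_real pi * (line_unit t * exp (- of_real \<bar>a\<bar> * line_quot t))" .
  qed
  also have "\<dots> = of_real pi * (\<integral>t. line_unit t * exp (- of_real \<bar>a\<bar> * line_quot t) \<partial>lborel)"
    by (rule integral_mult_right_zero)
  finally show "(\<integral>x. ?e x * H_zero x \<partial>lborel)
    = 1 / (2 * of_real pi) * (\<integral>t. line_unit t * exp (- of_real \<bar>a\<bar> * line_quot t) \<partial>lborel)"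
    by (simp add: power2_eq_square)
qed

text \<open>The zero of the nome at 0 cancels the pole of the weight.\<close>

lemma integral_line_unit_nome:
  assumes m: "m > 0"
  shows "(\<integral>t. line_unit t * nome (line t) ^ m \<partial>lborel) = 0"
proof -
  obtain k where k: "m = Suc k" using m by (cases m) auto
  let ?f = "\<lambda>z. 1 / (z * (1 - z)) * nome z ^ m"
  let ?h = "\<lambda>z. exp (log_nome z) / (1 - z) * nome z ^ k"
  have "(\<integral>t. ?f (line t) \<partial>lborel) = 0"
  proof (rule integral_line_eq_0(2)[where f = ?f and h = ?h and C = 1])
    show "?f holomorphic_on {z. Re z < 1} - {0}"
      by (intro holomorphic_intros holomorphic_left_half_plane) auto
    show "?h holomorphic_on ball 0 1"
      by (intro holomorphic_intros holomorphic_left_half_plane) auto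
    show "?f z = ?h z" if "z \<in> ball 0 1 - {0}" for z
      using that by (simp add: k nome_def)
    fix z :: complex assume z: "Re z \<le> 1/2" "1/2 \<le> norm z"
    have p: "0 < norm z" "0 < norm (1 - z)" using norm_reflect_ge(2)[OF z(1)] z(2) by linarith+
    have "norm (1 / (z * (1 - z))) = 1 / (norm z * norm (1 - z))" by (simp add: norm_divide norm_mult)
    also have "\<dots> \<le> 1 / (norm z * norm z)"
      using norm_reflect_ge(1)[OF z(1)] p by (intro divide_left_mono mult_left_mono mult_pos_pos) auto
    finally have 1: "norm (1 / (z * (1 - z))) \<le> 1 / (norm z)\<^sup>2" by (simp add: power2_eq_square)
    have "norm (?f z) \<le> (1 / (norm z)\<^sup>2) * 1"
      unfolding norm_mult[of "1 / (z * (1 - z))"] by (intro mult_mono 1 norm_nome_power_le[OF z(1)]) auto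
    then show "norm (?f z) \<le> 1 / (norm z)\<^sup>2" by simp
  qed
  then show ?thesis by (simp add: line_unit_def)
qed

lemma H_zero_fourier: "fourier H_zero k = (if k = 0 then 1 else 0)"
proof -
  define N where "N = nat \<bar>k\<bar>"
  have N: "\<bar>pi * of_int k\<bar> = pi * real N" by (simp add: N_def abs_mult)
  have "fourier H_zero k = (\<integral>x. exp (\<i> * of_real (pi * of_int k) * of_real x) * H_zero x \<partial>lborel)"
    by (simp add: mult.assoc)
  also have "\<dots> = 1 / (2 * of_real pi) * (\<integral>t. line_unit t * nome (line t) ^ N \<partial>lborel)"
    unfolding H_zero_fubini(2) N nome_line[symmetric] ..
  also have "\<dots> = (if k = 0 then 1 else 0)"
  proof (cases "k = 0")
    case True
    then show ?thesis
      using integral_inverse_line_product(2) by (simp add: N_def line_unit_def del: line_simps)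
  next
    case False
    then have "N > 0" by (simp add: N_def)
    then show ?thesis using False by (simp only: integral_line_unit_nome) simp
  qed
  finally show ?thesis .
qed

text \<open>Again \<open>w\<close> becomes \<open>1/w\<close> when the line is reversed, and the weight of \<open>H_zero\<close> is symmetric. So this function
  is its own image under the inversion, which explains the absence of a separate \<open>M\<^sub>0\<close>.\<close>

lemma H_zero_inversion:
  assumes x: "x \<noteq> 0"
  shows "H_zero (- 1 / x) / (of_real x)\<^sup>2 = H_zero x"
proof -
  let ?A = "\<lambda>t. line_unit t * (line_quot t / ((line_quot t)\<^sup>2 + (of_real (- 1 / x))\<^sup>2))"
  have A: "?A (- t) = (of_real x)\<^sup>2 * (line_unit t * (line_quot t / ((line_quot t)\<^sup>2 + (of_real x)\<^sup>2)))" for t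
  proof -
    define w where "w = line_quot t"
    have w0: "w \<noteq> 0" using Re_line_quot_pos[of t] by (auto simp: w_def)
    have "cnj w = 1 / w" using line_quot_mult_cnj[of t] w0 by (simp add: w_def field_simps)
    then have r: "line_quot (- t) = 1 / w" by (simp add: line_quot_reflect w_def)
    have u: "line_unit (- t) = line_unit t" by (simp add: line_unit_def mult.commute)
    have n: "w\<^sup>2 + (of_real x)\<^sup>2 \<noteq> 0" using Re_pos_kernel_nonzero(3)[OF Re_line_quot_pos] by (simp add: w_def)
    have "(1 / w)\<^sup>2 + (of_real (- 1 / x))\<^sup>2 = (w\<^sup>2 + (of_real x)\<^sup>2) / (w\<^sup>2 * (of_real x)\<^sup>2)"
      using x w0 by (simp add: power_divide add_frac_eq add.commute)
    then have "(1 / w) / ((1 / w)\<^sup>2 + (of_real (- 1 / x))\<^sup>2) = (of_real x)\<^sup>2 * (w / (w\<^sup>2 + (of_real x)\<^sup>2))"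
      using w0 n by (simp add: power2_eq_square)
    then show ?thesis unfolding r u w_def[symmetric] by simp
  qed
  have "(\<integral>t. ?A t \<partial>lborel) = (\<integral>t. ?A (- t) \<partial>lborel)" by (rule lborel_integral_reflect[symmetric])
  also have "\<dots> = (of_real x)\<^sup>2 * (\<integral>t. line_unit t * (line_quot t / ((line_quot t)\<^sup>2 + (of_real x)\<^sup>2)) \<partial>lborel)"
    unfolding A by (rule integral_mult_right_zero)
  finally show ?thesis unfolding H_zero_eq using x by simp
qed

subsection \<open>Conclusion\<close>

lemma int_sign_cases:
  fixes p :: int
  obtains "p = 0" | n where "n > 0" "p = int n" | n where "n > 0" "p = - int n"
proof -
  have "p = 0 \<or> (nat p > 0 \<and> p = int (nat p)) \<or> (nat (- p) > 0 \<and> p = - int (nat (- p)))" by auto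
  then show ?thesis using that by blast
qed

lemma integrable_reflect: "integrable lborel (f :: real \<Rightarrow> complex) \<Longrightarrow> integrable lborel (\<lambda>x. f (- x))"
  using lborel_integrable_real_affine[of f "-1" 0] by simp

lemma H_const_mult: "n > 0 \<Longrightarrow> H_const n * (4 * (of_real pi) ^ 3 * of_nat n) = 1"
  by (simp add: H_const_def)

lemma
  shows smooth_H: "smooth (H p)" and integrable_H: "integrable lborel (H p)"
    and fourier_H: "fourier (H p) k = (if k = - p then 1 else 0)"
proof -
  have "smooth (H p) \<and> integrable lborel (H p) \<and> fourier (H p) k = (if k = - p then 1 else 0)"
  proof (cases p rule: int_sign_cases)
    case 1
    have "H 0 = H_zero" by (simp add: H_def fun_eq_iff)
    then show ?thesis using 1 smooth_H_zero H_zero_fubini(1)[of 0] H_zero_fourier[of k] by simp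
  next
    case (2 n)
    show ?thesis
      unfolding 2(2) H_nonzero_eq(1)[OF 2(1)] fourier_cmult cusp0_transform(3)[OF 2(1)]
      using cusp0_transform(1,2)[OF 2(1)] H_const_mult[OF 2(1)]
      by (intro conjI smooth_cmult integrable_mult_right) simp_all
  next
    case (3 n)
    have r: "fourier (\<lambda>x. line_transform (cusp0 n) (- x)) k = (if k = int n then 4 * (of_real pi) ^ 3 * of_nat n else 0)"
      unfolding fourier_reflect cusp0_transform(3)[OF 3(1)] by auto
    show ?thesis
      unfolding 3(2) H_nonzero_eq(2)[OF 3(1)] fourier_cmult r
      using smooth_reflect[OF cusp0_transform(1)[OF 3(1)]] integrable_reflect[OF cusp0_transform(2)[OF 3(1)]] H_const_mult[OF 3(1)]
      by (intro conjI smooth_cmult integrable_mult_right) simp_all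
  qed
  then show "smooth (H p)" "integrable lborel (H p)" "fourier (H p) k = (if k = - p then 1 else 0)" by auto
qed

lemma
  assumes "q \<noteq> 0"
  shows smooth_M: "smooth (M q)" and integrable_M: "integrable lborel (M q)" and fourier_M: "fourier (M q) k = 0"
proof -
  have "smooth (M q) \<and> integrable lborel (M q) \<and> fourier (M q) k = 0"
  proof (cases q rule: int_sign_cases)
    case 1 then show ?thesis using assms by simp
  next
    case (2 n)
    show ?thesis
      unfolding 2(2) M_eq(1)[OF 2(1)] fourier_cmult cusp1_transform(4)[OF 2(1)]
      using cusp1_transform(1,2)[OF 2(1)] by (intro conjI smooth_cmult integrable_mult_right) simp_all
  next
    case (3 n)
    show ?thesis
      unfolding 3(2) M_eq(2)[OF 3(1)] fourier_cmult fourier_reflect[where f = "line_transform (cusp1 n)"] cusp1_transform(4)[OF 3(1)]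
      using smooth_reflect[OF cusp1_transform(1)[OF 3(1)]] integrable_reflect[OF cusp1_transform(2)[OF 3(1)]]
      by (intro conjI smooth_cmult integrable_mult_right) simp_all
  qed
  then show "smooth (M q)" "integrable lborel (M q)" "fourier (M q) k = 0" by auto
qed

text \<open>Under \<open>x \<mapsto> -1/x\<close> the characters \<open>exp (\<i>\<pi>m/x)\<close> become \<open>exp (-\<i>\<pi>mx)\<close>, so the last orthogonality relations
  are statements about Fourier coefficients of the inverted functions.\<close>

lemma fourier_inversion:
  assumes f: "integrable lborel f" and meas: "g \<in> borel_measurable borel"
    and g: "\<And>x. x \<noteq> 0 \<Longrightarrow> g x = f (- 1 / x) / (of_real x)\<^sup>2"
  shows "(\<integral>x. exp (\<i> * of_real pi * of_int m / of_real x) * g x \<partial>lborel) = fourier f (- m)"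
proof -
  let ?F = "\<lambda>y::real. exp (\<i> * of_real pi * of_int (- m) * of_real y) * f y"
  have [measurable]: "f \<in> borel_measurable borel" "g \<in> borel_measurable borel" using f meas by auto
  have F: "integrable lborel ?F"
    by (rule Bochner_Integration.integrable_bound[OF f]) (auto simp: norm_mult)
  have "(\<integral>x. exp (\<i> * of_real pi * of_int m / of_real x) * g x \<partial>lborel) = (\<integral>x. ?F (- 1 / x) / (of_real x)\<^sup>2 \<partial>lborel)"
  proof (rule integral_cong_AE)
    show "AE x in lborel. exp (\<i> * of_real pi * of_int m / of_real x) * g x = ?F (- 1 / x) / (of_real x)\<^sup>2"
      using AE_lborel_singleton[of "0 :: real"]
    proof eventually_elim
      case (elim x)
      then show ?case by (simp add: g)
    qed
  qed measurable
  also have "\<dots> = fourier f (- m)" by (rule integral_inversion(2)[OF F])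
  finally show ?thesis .
qed

lemma M_nonzero: "x \<noteq> 0 \<Longrightarrow> M q x = H q (- 1 / x) / (of_real x)\<^sup>2"
  by (simp add: M_def)

theorem theorem4p3:
  shows "(\<forall>n. integrable lborel (H n) \<and> smooth (H n)) \<and>
    (\<forall>n. n \<noteq> 0 \<longrightarrow> integrable lborel (M n) \<and> smooth (M n)) \<and>
    (\<forall>n p :: int. (\<integral>x. exp (- \<i> * of_real pi * of_int n * of_real x) * H p x \<partial>lborel)
        = (if n = p then 1 else 0)) \<and>
    (\<forall>m p :: int. m \<noteq> 0 \<longrightarrow>
        (\<integral>x. exp (\<i> * of_real pi * of_int m / of_real x) * H p x \<partial>lborel) = 0) \<and>
    (\<forall>n q :: int. q \<noteq> 0 \<longrightarrow>
        (\<integral>x. exp (\<i> * of_real pi * of_int n * of_real x) * M q x \<partial>lborel) = 0) \<and>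
    (\<forall>m q :: int. m \<noteq> 0 \<longrightarrow> q \<noteq> 0 \<longrightarrow>
        (\<integral>x. exp (\<i> * of_real pi * of_int m / of_real x) * M q x \<partial>lborel)
        = (if m = q then 1 else 0))"
proof (intro conjI allI impI)
  fix n show "integrable lborel (H n)" "smooth (H n)" by (rule integrable_H smooth_H)+
next
  fix n :: int assume "n \<noteq> 0"
  then show "integrable lborel (M n)" "smooth (M n)" by (rule integrable_M, rule smooth_M)
next
  fix n p :: int
  have e: "- \<i> * of_real pi * of_int n * of_real x = \<i> * of_real pi * of_int (- n) * of_real x" for x :: real
    by simp
  show "(\<integral>x. exp (- \<i> * of_real pi * of_int n * of_real x) * H p x \<partial>lborel) = (if n = p then 1 else 0)"
    unfolding e fourier_H by simp
next
  fix m p :: int assume m: "m \<noteq> 0"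
  have meas: "H p \<in> borel_measurable borel" using integrable_H[of p] by auto
  show "(\<integral>x. exp (\<i> * of_real pi * of_int m / of_real x) * H p x \<partial>lborel) = 0"
  proof (cases "p = 0")
    case True
    have inv: "H p x = H p (- 1 / x) / (of_real x)\<^sup>2" if "x \<noteq> 0" for x
      using H_zero_inversion[OF that] by (simp add: H_def True)
    have "(\<integral>x. exp (\<i> * of_real pi * of_int m / of_real x) * H p x \<partial>lborel) = fourier (H p) (- m)"
      by (rule fourier_inversion[OF integrable_H meas inv])
    also have "\<dots> = 0" unfolding fourier_H using m True by simp
    finally show ?thesis .
  next
    case False
    have inv: "H p x = M p (- 1 / x) / (of_real x)\<^sup>2" if "x \<noteq> 0" for x
      using that by (simp add: M_nonzero power_divide)
    have "(\<integral>x. exp (\<i> * of_real pi * of_int m / of_real x) * H p x \<partial>lborel) = fourier (M p) (- m)"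
      by (rule fourier_inversion[OF integrable_M[OF False] meas inv])
    also have "\<dots> = 0" by (rule fourier_M[OF False])
    finally show ?thesis .
  qed
next
  fix n q :: int assume "q \<noteq> 0"
  then show "(\<integral>x. exp (\<i> * of_real pi * of_int n * of_real x) * M q x \<partial>lborel) = 0" by (rule fourier_M)
next
  fix m q :: int assume "m \<noteq> 0" and q: "q \<noteq> 0"
  have meas: "M q \<in> borel_measurable borel" using integrable_M[OF q] by auto
  have "(\<integral>x. exp (\<i> * of_real pi * of_int m / of_real x) * M q x \<partial>lborel) = fourier (H q) (- m)"
    by (rule fourier_inversion[OF integrable_H meas M_nonzero])
  also have "\<dots> = (if m = q then 1 else 0)" unfolding fourier_H by simp
  finally show "(\<integral>x. exp (\<i> * of_real pi * of_int m / of_real x) * M q x \<partial>lborel) = (if m = q then 1 else 0)" .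
qed

end
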